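(* Let $a\in C^1(\mathbb R)$ with $a>0$ and let $b\in C(\mathbb R)$. Put $B(x)=\int_0^x\frac{b(y)}{a(y)}\,dy$ for $x\in\mathbb R$. Let $$H_D=-\frac12\frac{d}{dx}a\frac{d}{dx}-b\frac{d}{dx}=-\frac12 e^{-2B}\frac{d}{dx}a\,e^{2B}\frac{d}{dx}$$ be the self-adjoint diffusion operator on $L^2(\mathbb R,e^{2B}dx)$. If moreover $b\in C^1(\mathbb R)$, $\frac{b^2}{a}+b'$ is bounded from below and $\int^\infty a(x)\,dx=\int_{-\infty}a(x)\,dx=\infty$, let also $H_S=-\frac12\frac{d}{dx}a\frac{d}{dx}+\frac12\big(\frac{b^2}{a}+b'\big)$ be the self-adjoint Schrödinger-type operator on $L^2(\mathbb R)$. Let $I_+=\int^\infty\frac{1}{a(x)}e^{-2B(x)}dx$ and $I_-=\int_{-\infty}\frac{1}{a(x)}e^{-2B(x)}dx$, and define $\Omega(b,a)\in[0,\infty]$ as follows. - If $I_+=\infty$ and $I_-=\infty$: $\Omega(b,a)=\infty$. - If $I_+=\infty$ and $I_-<\infty$: $$\Omega(b,a)=\sup_{x\in\mathbb R}\Big(\int_{-\infty}^x\frac{1}{a(y)}e^{-2B(y)}dy\Big)\Big(\int_x^\infty e^{2B(y)}dy\Big).$$ - If $I_+<\infty$ and $I_-=\infty$: $$\Omega(b,a)=\sup_{x\in\mathbb R}\Big(\int_x^\infty\frac{1}{a(y)}e^{-2B(y)}dy\Big)\Big(\int_{-\infty}^x e^{2B(y)}dy\Big).$$ - If $I_+<\infty$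 and $I_-<\infty$: with $h_{b,a}(x)=\int_x^\infty\frac{1}{a(y)}e^{-2B(y)}dy$ and $h_{b,a}(-\infty)=\int_{-\infty}^\infty\frac{1}{a(y)}e^{-2B(y)}dy$, $$\Omega(b,a)=\sup_{x\in\mathbb R}\Big(\int_{-\infty}^x h_{b,a}^{-2}(y)\frac{1}{a(y)}e^{-2B(y)}dy\Big)\Big(\int_x^\infty h_{b,a}^2(y)e^{2B(y)}dy\Big)=\sup_{x\in\mathbb R}\big(h_{b,a}^{-1}(x)-h_{b,a}^{-1}(-\infty)\big)\int_x^\infty h_{b,a}^2(y)e^{2B(y)}dy.$$ Then $$\frac{1}{8\,\Omega(b,a)}\le\inf\sigma(H_D)=\inf\sigma(H_S)\le\frac{1}{2\,\Omega(b,a)}$$ (the assertions about $H_S$ being made when $H_S$ is defined, i.e. under the additional assumptions above).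
   Context: $H_D$ is the non-negative self-adjoint operator on $L^2(\mathbb R,e^{2B}dx)$ associated (Friedrichs extension) with the closure of the form $Q_D(f,g)=\frac12\int_{\mathbb R} a f'g'\,e^{2B}dx$, $f,g\in C_0^1(\mathbb R)$ (compactly supported $C^1$ functions). $H_S$ is the self-adjoint operator on $L^2(\mathbb R)$ associated with the closure of the semi-bounded form $Q_S(f,g)=\frac12\int_{\mathbb R} a f'g'\,dx+\int_{\mathbb R}\frac12\big(\frac{b^2}{a}+b'\big)fg\,dx$, $f,g\in C_0^1(\mathbb R)$. $\sigma$ denotes spectrum. Conventions: $1/\infty=0$, (positive)$\cdot\infty=\infty$, $h^{-1}=1/h$, $h^{-2}=1/h^2$. $\int^\infty$ and $\int_{-\infty}$ mean integrals over neighbourhoods $[c,\infty)$, $(-\infty,c]$ of $\pm\infty$ (only finiteness matters). *)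

theory Defs
  imports "HOL-Analysis.Analysis"
begin

section \<open>Square-integrable functions\<close>

text \<open>
  The real Hilbert space \<open>L\<^sup>2(M)\<close> is represented by square-integrable functions rather than by
  their equivalence classes. The operators below are saturated under equality almost everywhere.
\<close>

definition l2_space :: "'a measure \<Rightarrow> ('a \<Rightarrow> real) set" where
  "l2_space M = {f \<in> borel_measurable M. integrable M (\<lambda>x. (f x)\<^sup>2)}"

definition l2_inner :: "'a measure \<Rightarrow> ('a \<Rightarrow> real) \<Rightarrow> ('a \<Rightarrow> real) \<Rightarrow> real" where
  "l2_inner M f g = (\<integral>x. f x * g x \<partial>M)"

definition l2_norm :: "'a measure \<Rightarrow> ('a \<Rightarrow> real) \<Rightarrow> real" where
  "l2_norm M f = sqrt (l2_inner M f f)"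


section \<open>Closure of a semi-bounded form and the associated operator\<close>

text \<open>
  Convergence with respect to a form \<open>Q\<close> with domain \<open>D\<close>: convergence in \<open>L\<^sup>2(M)\<close> of a sequence
  in \<open>D\<close> that is Cauchy with respect to \<open>Q\<close>. For a symmetric form \<open>Q\<close> bounded from below by
  \<open>-c\<close>, this is the same as being Cauchy for the norm induced by \<open>Q + (c + 1) \<langle>\<cdot>,\<cdot>\<rangle>\<close>.
\<close>

definition form_converges ::
  "'a measure \<Rightarrow> ('a \<Rightarrow> real) set \<Rightarrow> (('a \<Rightarrow> real) \<Rightarrow> ('a \<Rightarrow> real) \<Rightarrow> real)
    \<Rightarrow> (nat \<Rightarrow> 'a \<Rightarrow> real) \<Rightarrow> ('a \<Rightarrow> real) \<Rightarrow> bool" where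
  "form_converges M D Q us u \<longleftrightarrow>
     (\<forall>n. us n \<in> D) \<and> u \<in> l2_space M \<and>
     (\<lambda>n. l2_norm M (\<lambda>x. us n x - u x)) \<longlonglongrightarrow> 0 \<and>
     (\<forall>e>0. \<exists>N. \<forall>m\<ge>N. \<forall>n\<ge>N.
        \<bar>Q (\<lambda>x. us m x - us n x) (\<lambda>x. us m x - us n x)\<bar> < e)"

definition closure_dom ::
  "'a measure \<Rightarrow> ('a \<Rightarrow> real) set \<Rightarrow> (('a \<Rightarrow> real) \<Rightarrow> ('a \<Rightarrow> real) \<Rightarrow> real)
    \<Rightarrow> ('a \<Rightarrow> real) set" where
  "closure_dom M D Q = {u. \<exists>us. form_converges M D Q us u}"

text \<open>For a closable form, the limit exists and does not depend on the approximating sequences.\<close>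

definition closure_form ::
  "'a measure \<Rightarrow> ('a \<Rightarrow> real) set \<Rightarrow> (('a \<Rightarrow> real) \<Rightarrow> ('a \<Rightarrow> real) \<Rightarrow> real)
    \<Rightarrow> ('a \<Rightarrow> real) \<Rightarrow> ('a \<Rightarrow> real) \<Rightarrow> real" where
  "closure_form M D Q u v =
     (THE r. \<forall>us vs. form_converges M D Q us u \<longrightarrow> form_converges M D Q vs v \<longrightarrow>
        (\<lambda>n. Q (us n) (vs n)) \<longlonglongrightarrow> r)"

text \<open>
  The operator associated with the closure of \<open>Q\<close>, given by its graph: \<open>u\<close> belongs to the operator
  domain and is mapped to \<open>f\<close> iff \<open>u\<close> belongs to the form domain and
  \<open>Q(u,v) = \<langle>f,v\<rangle>\<close> for all \<open>v\<close> in the form domain.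
\<close>

definition form_operator ::
  "'a measure \<Rightarrow> ('a \<Rightarrow> real) set \<Rightarrow> (('a \<Rightarrow> real) \<Rightarrow> ('a \<Rightarrow> real) \<Rightarrow> real)
    \<Rightarrow> (('a \<Rightarrow> real) \<times> ('a \<Rightarrow> real)) set" where
  "form_operator M D Q =
     {(u, f). u \<in> closure_dom M D Q \<and> f \<in> l2_space M \<and>
        (\<forall>v \<in> closure_dom M D Q. closure_form M D Q u v = l2_inner M f v)}"

text \<open>
  A real number \<open>l\<close> is in the resolvent set of the operator \<open>H\<close> with graph \<open>G\<close> iff \<open>H - l\<close> is
  a bijection from its domain onto \<open>L\<^sup>2(M)\<close> with bounded inverse. As the spectrum of a self-adjoint
  operator is real, only real \<open>l\<close> are considered.
\<close>

definition resolvent_set ::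
  "'a measure \<Rightarrow> (('a \<Rightarrow> real) \<times> ('a \<Rightarrow> real)) set \<Rightarrow> real set" where
  "resolvent_set M G =
     {l. (\<forall>u f. (u, f) \<in> G \<longrightarrow> (AE x in M. f x - l * u x = 0) \<longrightarrow> (AE x in M. u x = 0)) \<and>
         (\<forall>g \<in> l2_space M. \<exists>u f. (u, f) \<in> G \<and> (AE x in M. f x - l * u x = g x)) \<and>
         (\<exists>C. \<forall>u f. (u, f) \<in> G \<longrightarrow> l2_norm M u \<le> C * l2_norm M (\<lambda>x. f x - l * u x))}"

definition spectrum ::
  "'a measure \<Rightarrow> (('a \<Rightarrow> real) \<times> ('a \<Rightarrow> real)) set \<Rightarrow> real set" where
  "spectrum M G = - resolvent_set M G"


section \<open>The diffusion operator and the Schroedinger-type operator\<close>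

definition B_fn :: "(real \<Rightarrow> real) \<Rightarrow> (real \<Rightarrow> real) \<Rightarrow> real \<Rightarrow> real" where
  "B_fn b a x = (LBINT y=0..x. b y / a y)"

definition C1_compact_support :: "(real \<Rightarrow> real) set" where
  "C1_compact_support = {f. f C1_differentiable_on UNIV \<and> compact (closure {x. f x \<noteq> 0})}"

definition diffusion_measure :: "(real \<Rightarrow> real) \<Rightarrow> (real \<Rightarrow> real) \<Rightarrow> real measure" where
  "diffusion_measure b a = density lborel (\<lambda>x. ennreal (exp (2 * B_fn b a x)))"

definition Q_D ::
  "(real \<Rightarrow> real) \<Rightarrow> (real \<Rightarrow> real) \<Rightarrow> (real \<Rightarrow> real) \<Rightarrow> (real \<Rightarrow> real) \<Rightarrow> real" where
  "Q_D b a f g = 1/2 * (\<integral>x. a x * deriv f x * deriv g x * exp (2 * B_fn b a x) \<partial>lborel)"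

definition H_D :: "(real \<Rightarrow> real) \<Rightarrow> (real \<Rightarrow> real) \<Rightarrow> ((real \<Rightarrow> real) \<times> (real \<Rightarrow> real)) set" where
  "H_D b a = form_operator (diffusion_measure b a) C1_compact_support (Q_D b a)"

definition Q_S ::
  "(real \<Rightarrow> real) \<Rightarrow> (real \<Rightarrow> real) \<Rightarrow> (real \<Rightarrow> real) \<Rightarrow> (real \<Rightarrow> real) \<Rightarrow> real" where
  "Q_S b a f g = 1/2 * (\<integral>x. a x * deriv f x * deriv g x \<partial>lborel)
     + (\<integral>x. 1/2 * ((b x)\<^sup>2 / a x + deriv b x) * f x * g x \<partial>lborel)"

definition H_S :: "(real \<Rightarrow> real) \<Rightarrow> (real \<Rightarrow> real) \<Rightarrow> ((real \<Rightarrow> real) \<times> (real \<Rightarrow> real)) set" where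
  "H_S b a = form_operator lborel C1_compact_support (Q_S b a)"

text \<open>
  The infimum is taken in the extended reals, so that it is meaningful without knowing beforehand
  that the spectrum is nonempty and bounded from below.
\<close>

definition inf_spectrum :: "'a measure \<Rightarrow> (('a \<Rightarrow> real) \<times> ('a \<Rightarrow> real)) set \<Rightarrow> ereal" where
  "inf_spectrum M G = (INF l \<in> spectrum M G. ereal l)"


section \<open>The quantity \<open>\<Omega>(b,a)\<close>\<close>

definition scale_density :: "(real \<Rightarrow> real) \<Rightarrow> (real \<Rightarrow> real) \<Rightarrow> real \<Rightarrow> ennreal" where
  "scale_density b a y = ennreal (1 / a y * exp (- 2 * B_fn b a y))"

definition speed_density :: "(real \<Rightarrow> real) \<Rightarrow> (real \<Rightarrow> real) \<Rightarrow> real \<Rightarrow> ennreal" where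
  "speed_density b a y = ennreal (exp (2 * B_fn b a y))"

text \<open>Only the finiteness of the next two integrals matters, so the endpoint \<open>0\<close> is immaterial.\<close>

definition I_plus :: "(real \<Rightarrow> real) \<Rightarrow> (real \<Rightarrow> real) \<Rightarrow> ennreal" where
  "I_plus b a = (\<integral>\<^sup>+ y \<in> {0..}. scale_density b a y \<partial>lborel)"

definition I_minus :: "(real \<Rightarrow> real) \<Rightarrow> (real \<Rightarrow> real) \<Rightarrow> ennreal" where
  "I_minus b a = (\<integral>\<^sup>+ y \<in> {..0}. scale_density b a y \<partial>lborel)"

definition h_fn :: "(real \<Rightarrow> real) \<Rightarrow> (real \<Rightarrow> real) \<Rightarrow> real \<Rightarrow> ennreal" where
  "h_fn b a x = (\<integral>\<^sup>+ y \<in> {x..}. scale_density b a y \<partial>lborel)"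

definition h_fn_minus_infinity :: "(real \<Rightarrow> real) \<Rightarrow> (real \<Rightarrow> real) \<Rightarrow> ennreal" where
  "h_fn_minus_infinity b a = (\<integral>\<^sup>+ y. scale_density b a y \<partial>lborel)"

definition Omega :: "(real \<Rightarrow> real) \<Rightarrow> (real \<Rightarrow> real) \<Rightarrow> ennreal" where
  "Omega b a =
     (if I_plus b a = \<infinity> \<and> I_minus b a = \<infinity> then \<infinity>
      else if I_plus b a = \<infinity> \<and> I_minus b a < \<infinity> then
        (SUP x. (\<integral>\<^sup>+ y \<in> {..x}. scale_density b a y \<partial>lborel)
              * (\<integral>\<^sup>+ y \<in> {x..}. speed_density b a y \<partial>lborel))
      else if I_plus b a < \<infinity> \<and> I_minus b a = \<infinity> then
        (SUP x. (\<integral>\<^sup>+ y \<in> {x..}. scale_density b a y \<partial>lborel)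
              * (\<integral>\<^sup>+ y \<in> {..x}. speed_density b a y \<partial>lborel))
      else
        (SUP x. (\<integral>\<^sup>+ y \<in> {..x}. (1 / (h_fn b a y)\<^sup>2) * scale_density b a y \<partial>lborel)
              * (\<integral>\<^sup>+ y \<in> {x..}. (h_fn b a y)\<^sup>2 * speed_density b a y \<partial>lborel)))"

end

theory Submission
  imports Defs
begin

text \<open>
  The infimum of the spectrum is the infimum \<open>\<lambda>\<close> of the Rayleigh quotient over the form core: below
  \<open>\<lambda>\<close> the resolvent equation is solved by minimising a coercive functional, and \<open>\<lambda>\<close> itself is
  spectral by the Cauchy-Schwarz inequality for the form. Multiplication by \<open>exp B\<close> maps the
  form of \<open>H_D\<close> to that of \<open>H_S\<close>, so both operators have the same \<open>\<lambda>\<close>.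

  With \<open>w = a exp (2 B)\<close> and \<open>v = exp (2 B)\<close> the bounds say that the best constant in the weighted
  Hardy inequality \<open>2 \<lambda> \<integral> v f\<^sup>2 \<le> \<integral> w f'\<^sup>2\<close> lies between \<open>1 / (4 \<Omega>)\<close> and \<open>1 / \<Omega>\<close>. The upper bound
  comes from test functions with \<open>f' = \<plusminus>const / w\<close> on two disjoint half-lines. For the lower bound one
  uses \<open>\<integral> w f'\<^sup>2 \<ge> \<integral> (\<psi>' - \<psi>\<^sup>2 / w) f\<^sup>2\<close> for any \<open>\<psi>\<close>: if \<open>A' = 1 / w\<close>, \<open>V' = - v\<close> and \<open>A V \<le> \<Omega>\<close>, then
  \<open>\<psi> = - V / (4 \<Omega>) - 1 / (4 A)\<close> satisfies \<open>\<psi>' - \<psi>\<^sup>2 / w \<ge> v / (4 \<Omega>)\<close>. If \<open>1 / w\<close> is integrable at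
  both ends, the substitution \<open>f = h g\<close> reduces the problem to the one-sided case.
\<close>

section \<open>Square-integrable functions\<close>

text \<open>The spectral half uses only a lower bound for the form that is sharp on the core, so one
  abstract statement serves both operators. Test functions must be C1 with compact support, while
  the natural ones have \<open>f' = const / w\<close> on unbounded half-lines; hence the cutoffs and
  the limits in \<open>ennreal\<close>. There an infinite tail contributes
  \<open>inverse top = 0\<close>, which also settles an infinite Omega. Origin of the 4: with psi =
  - (alpha V + beta / A) and V \<le> Omega / A it suffices that (alpha Omega + beta)^2 \<le> beta,
  and alpha Omega = sqrt beta - beta is largest at beta = 1/4, with value 1/4. The factor 1/2 in the
  forms then turns 1 / (4 Omega) and 1 / Omega into 1 / (8 Omega) and 1 / (2 Omega). Two-sided case:
  w h' = - 1, so f = h g changes the energy only by a total derivative and leads to the weights w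
  h^2 and v h^2. Since (1 / h)' = 1 / (w h^2) and h tends to 0 at plus infinity, the new scale is
  infinite on the right and finite on the left, as in the case where only I_+ is infinite.\<close>

lemma quadratic_nonneg_imp_discriminant:
  fixes p q r :: real
  assumes "\<And>t. 0 \<le> p + 2 * t * q + t\<^sup>2 * r"
  shows "q\<^sup>2 \<le> p * r"
proof (cases "r = 0")
  case True
  show ?thesis
  proof (cases "q = 0")
    case True
    then show ?thesis using \<open>r = 0\<close> by simp
  next
    case False
    \<comment> \<open>This \<open>t\<close> makes the affine function of \<open>t\<close> equal to
      -1.\<close>
    have "0 \<le> p + 2 * (- (p + 1) / (2 * q)) * q" using assms[of "- (p + 1) / (2 * q)"] True by simp
    also have "\<dots> = - 1" using False by (simp add: field_simps)
    finally show ?thesis by simp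
  qed
next
  case False
  have pos: "r > 0"
  proof (rule ccontr)
    assume "\<not> r > 0"
    with False have r: "r < 0" by simp
    \<comment> \<open>So large that the negative term \<open>t\<^sup>2 * r\<close> outweighs
      \<open>p + 2 * t * q\<close>.\<close>
    define t where "t = 1 + \<bar>p\<bar> / (- r) + 2 * \<bar>q\<bar> / (- r)"
    have "\<bar>p\<bar> / (- r) \<ge> 0" "2 * \<bar>q\<bar> / (- r) \<ge> 0" using r by (intro divide_nonneg_pos; simp)+
    then have t1: "t \<ge> 1" unfolding t_def by linarith
    have rt: "- r * t = - r + \<bar>p\<bar> + 2 * \<bar>q\<bar>" using r by (simp add: t_def field_simps)
    have "t * (- r * t) = t * (- r) + t * \<bar>p\<bar> + t * (2 * \<bar>q\<bar>)"
      unfolding rt by (simp add: algebra_simps)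
    moreover have "t * \<bar>p\<bar> \<ge> p"
      using t1 mult_right_mono[of 1 t "\<bar>p\<bar>"] by simp
    moreover have "t * (2 * \<bar>q\<bar>) \<ge> 2 * t * q" using t1 by (simp add: mult_left_mono)
    moreover have "t * (- r) > 0" using t1 r by (simp add: mult_pos_neg)
    ultimately have "p + 2 * t * q + t\<^sup>2 * r < 0" by (simp add: power2_eq_square algebra_simps)
    with assms[of t] show False by simp
  qed
  \<comment> \<open>Evaluation at the minimiser \<open>t = - q / r\<close>.\<close>
  have "0 \<le> p + 2 * (- q / r) * q + (- q / r)\<^sup>2 * r" by (rule assms)
  also have "\<dots> = p - q\<^sup>2 / r" using pos by (simp add: power2_eq_square field_simps)
  finally show ?thesis using pos by (simp add: field_simps)
qed

section \<open>The pre-Hilbert structure of square-integrable functions\<close>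

lemma l2_space_borel [measurable_dest]: "f \<in> l2_space M \<Longrightarrow> f \<in> borel_measurable M"
  by (simp add: l2_space_def)

lemma l2_space_integrable_mult:
  assumes "f \<in> l2_space M" "g \<in> l2_space M"
  shows "integrable M (\<lambda>x. f x * g x)"
proof (rule Bochner_Integration.integrable_bound)
  show "integrable M (\<lambda>x. (f x)\<^sup>2 + (g x)\<^sup>2)"
    using assms by (simp add: l2_space_def)
  show "(\<lambda>x. f x * g x) \<in> borel_measurable M"
    by (intro borel_measurable_times l2_space_borel assms)
  have "\<bar>f x * g x\<bar> \<le> (f x)\<^sup>2 + (g x)\<^sup>2" for x
  proof -
    have "0 \<le> (\<bar>f x\<bar> - \<bar>g x\<bar>)\<^sup>2" by simp
    then have "2 * \<bar>f x * g x\<bar> \<le> (f x)\<^sup>2 + (g x)\<^sup>2" by (simp add: power2_diff abs_mult)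
    then show ?thesis using abs_ge_zero[of "f x * g x"] by linarith
  qed
  then show "AE x in M. norm (f x * g x) \<le> norm ((f x)\<^sup>2 + (g x)\<^sup>2)" by simp
qed

lemma l2_space_lincomb:
  assumes "f \<in> l2_space M" "g \<in> l2_space M"
  shows "(\<lambda>x. s * f x + t * g x) \<in> l2_space M"
proof -
  have "integrable M (\<lambda>x. s\<^sup>2 * (f x)\<^sup>2 + t\<^sup>2 * (g x)\<^sup>2 + 2 * s * t * (f x * g x))"
    using assms l2_space_integrable_mult[OF assms] by (simp add: l2_space_def)
  moreover have "(\<lambda>x. s\<^sup>2 * (f x)\<^sup>2 + t\<^sup>2 * (g x)\<^sup>2 + 2 * s * t * (f x * g x)) = (\<lambda>x. (s * f x + t * g x)\<^sup>2)"
    by (simp add: fun_eq_iff power2_eq_square algebra_simps)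
  moreover have "(\<lambda>x. s * f x + t * g x) \<in> borel_measurable M"
    by (intro borel_measurable_times borel_measurable_add borel_measurable_const l2_space_borel assms)
  ultimately show ?thesis by (simp add: l2_space_def)
qed

lemma l2_space_diff:
  "f \<in> l2_space M \<Longrightarrow> g \<in> l2_space M \<Longrightarrow> (\<lambda>x. f x - g x) \<in> l2_space M"
  using l2_space_lincomb[of f M g 1 "- 1"] by simp

lemma l2_inner_commute: "l2_inner M f g = l2_inner M g f"
  by (simp add: l2_inner_def mult.commute)

lemma l2_inner_lincomb_left:
  assumes "f \<in> l2_space M" "g \<in> l2_space M" "h \<in> l2_space M"
  shows "l2_inner M (\<lambda>x. s * f x + t * g x) h = s * l2_inner M f h + t * l2_inner M g h"
  using l2_space_integrable_mult[OF assms(1,3)] l2_space_integrable_mult[OF assms(2,3)]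
  by (simp add: l2_inner_def algebra_simps)

lemma l2_inner_diff_left:
  assumes "f \<in> l2_space M" "g \<in> l2_space M" "h \<in> l2_space M"
  shows "l2_inner M (\<lambda>x. f x - g x) h = l2_inner M f h - l2_inner M g h"
  using l2_inner_lincomb_left[OF assms, of 1 "- 1"] by simp

lemma l2_inner_self_nonneg: "0 \<le> l2_inner M f f"
  by (simp add: l2_inner_def)

lemma l2_norm_nonneg: "0 \<le> l2_norm M f"
  by (simp add: l2_norm_def l2_inner_self_nonneg)

lemma l2_norm_square: "(l2_norm M f)\<^sup>2 = l2_inner M f f"
  by (simp add: l2_norm_def l2_inner_self_nonneg)

lemma l2_norm_minus_commute: "l2_norm M (\<lambda>x. f x - g x) = l2_norm M (\<lambda>x. g x - f x)"
proof -
  have "(f x - g x) * (f x - g x) = (g x - f x) * (g x - f x)" for x by (simp add: algebra_simps)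
  then show ?thesis by (simp add: l2_norm_def l2_inner_def)
qed

lemma l2_inner_lincomb_self:
  assumes "f \<in> l2_space M" "g \<in> l2_space M"
  shows "l2_inner M (\<lambda>x. f x + t * g x) (\<lambda>x. f x + t * g x)
    = l2_inner M f f + 2 * t * l2_inner M f g + t\<^sup>2 * l2_inner M g g"
proof -
  let ?k = "\<lambda>x. f x + t * g x"
  have k: "?k \<in> l2_space M" using l2_space_lincomb[OF assms, of 1 t] by simp
  have "l2_inner M ?k ?k = l2_inner M f ?k + t * l2_inner M g ?k"
    using l2_inner_lincomb_left[OF assms k, of 1 t] by simp
  moreover have "l2_inner M ?k f = l2_inner M f f + t * l2_inner M g f"
    using l2_inner_lincomb_left[OF assms assms(1), of 1 t] by simp
  moreover have "l2_inner M ?k g = l2_inner M f g + t * l2_inner M g g"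
    using l2_inner_lincomb_left[OF assms assms(2), of 1 t] by simp
  ultimately show ?thesis
    by (simp add: l2_inner_commute[of M f ?k] l2_inner_commute[of M g ?k] l2_inner_commute[of M g f]
        power2_eq_square algebra_simps)
qed

lemma l2_Cauchy_Schwarz:
  assumes "f \<in> l2_space M" "g \<in> l2_space M"
  shows "\<bar>l2_inner M f g\<bar> \<le> l2_norm M f * l2_norm M g"
proof -
  have "0 \<le> l2_inner M f f + 2 * t * l2_inner M f g + t\<^sup>2 * l2_inner M g g" for t
    using l2_inner_lincomb_self[OF assms, of t]
      l2_inner_self_nonneg[of M "\<lambda>x. f x + t * g x"] by simp
  then have "(l2_inner M f g)\<^sup>2 \<le> l2_inner M f f * l2_inner M g g"
    by (rule quadratic_nonneg_imp_discriminant)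
  then have "(l2_inner M f g)\<^sup>2 \<le> (l2_norm M f * l2_norm M g)\<^sup>2"
    by (simp add: power_mult_distrib l2_norm_square)
  then show ?thesis
    by (metis abs_le_square_iff abs_of_nonneg l2_norm_nonneg mult_nonneg_nonneg)
qed

lemma l2_norm_triangle:
  assumes "f \<in> l2_space M" "g \<in> l2_space M"
  shows "l2_norm M (\<lambda>x. f x + g x) \<le> l2_norm M f + l2_norm M g"
proof (rule power2_le_imp_le)
  show "(l2_norm M (\<lambda>x. f x + g x))\<^sup>2 \<le> (l2_norm M f + l2_norm M g)\<^sup>2"
    using l2_inner_lincomb_self[OF assms, of 1] l2_Cauchy_Schwarz[OF assms]
    by (simp add: l2_norm_square power2_sum)
qed (simp add: l2_norm_nonneg)

lemma l2_norm_triangle_diff: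
  assumes "f \<in> l2_space M" "g \<in> l2_space M" "h \<in> l2_space M"
  shows "l2_norm M (\<lambda>x. f x - h x) \<le> l2_norm M (\<lambda>x. f x - g x) + l2_norm M (\<lambda>x. g x - h x)"
  using l2_norm_triangle[OF l2_space_diff[OF assms(1,2)] l2_space_diff[OF assms(2,3)]] by simp

lemma nn_integral_l2:
  assumes "f \<in> l2_space M"
  shows "(\<integral>\<^sup>+x. ennreal ((f x)\<^sup>2) \<partial>M) = ennreal ((l2_norm M f)\<^sup>2)"
proof -
  have "(\<integral>\<^sup>+x. ennreal ((f x)\<^sup>2) \<partial>M) = ennreal (\<integral>x. (f x)\<^sup>2 \<partial>M)"
    using assms by (intro nn_integral_eq_integral) (simp_all add: l2_space_def)
  then show ?thesis by (simp add: l2_norm_square l2_inner_def flip: power2_eq_square)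
qed

lemma l2_inner_tendsto:
  assumes "\<And>n. us n \<in> l2_space M" "u \<in> l2_space M"
    and "(\<lambda>n. l2_norm M (\<lambda>x. us n x - u x)) \<longlonglongrightarrow> 0"
    and "\<And>n. vs n \<in> l2_space M" "v \<in> l2_space M"
    and "(\<lambda>n. l2_norm M (\<lambda>x. vs n x - v x)) \<longlonglongrightarrow> 0"
  shows "(\<lambda>n. l2_inner M (us n) (vs n)) \<longlonglongrightarrow> l2_inner M u v"
proof -
  have b: "\<bar>l2_inner M (us n) (vs n) - l2_inner M u v\<bar>
      \<le> l2_norm M (\<lambda>x. us n x - u x) * (l2_norm M (\<lambda>x. vs n x - v x) + l2_norm M v)
        + l2_norm M u * l2_norm M (\<lambda>x. vs n x - v x)" for n
  proof -
    have "l2_inner M (us n) (vs n) - l2_inner M u v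
      = l2_inner M (\<lambda>x. us n x - u x) (vs n) + l2_inner M u (\<lambda>x. vs n x - v x)"
      using assms
      by (simp add: l2_inner_diff_left l2_inner_commute[of M u])
    moreover have "\<bar>l2_inner M (\<lambda>x. us n x - u x) (vs n)\<bar> \<le> l2_norm M (\<lambda>x. us n x - u x) * l2_norm M (vs n)"
      by (intro l2_Cauchy_Schwarz l2_space_diff assms)
    moreover have "l2_norm M (\<lambda>x. us n x - u x) * l2_norm M (vs n)
      \<le> l2_norm M (\<lambda>x. us n x - u x) * (l2_norm M (\<lambda>x. vs n x - v x) + l2_norm M v)"
      using l2_norm_triangle[OF l2_space_diff[OF assms(4)[of n] assms(5)] assms(5)]
      by (intro mult_left_mono l2_norm_nonneg) simp
    moreover have "\<bar>l2_inner M u (\<lambda>x. vs n x - v x)\<bar> \<le> l2_norm M u * l2_norm M (\<lambda>x. vs n x - v x)"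
      by (intro l2_Cauchy_Schwarz l2_space_diff assms)
    ultimately show ?thesis by linarith
  qed
  have "(\<lambda>n. l2_norm M (\<lambda>x. us n x - u x) * (l2_norm M (\<lambda>x. vs n x - v x) + l2_norm M v)
        + l2_norm M u * l2_norm M (\<lambda>x. vs n x - v x)) \<longlonglongrightarrow> 0 * (0 + l2_norm M v) + l2_norm M u * 0"
    by (intro tendsto_intros assms)
  then have lim: "(\<lambda>n. l2_norm M (\<lambda>x. us n x - u x) * (l2_norm M (\<lambda>x. vs n x - v x) + l2_norm M v)
        + l2_norm M u * l2_norm M (\<lambda>x. vs n x - v x)) \<longlonglongrightarrow> 0" by simp
  have "(\<lambda>n. l2_inner M (us n) (vs n) - l2_inner M u v) \<longlonglongrightarrow> 0"
    by (rule Lim_null_comparison[OF _ lim]) (use b in simp)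
  then show ?thesis by (simp add: LIM_zero_iff)
qed

text \<open>Riesz-Fischer, done with squares only. Along a subsequence whose increments
  \<open>d k\<close> have norm at most \<open>(1/4)^k\<close>, the sum of
  \<open>4^k * (d k)\<^sup>2\<close> has finite integral; where that sum is finite the increments
  decay like \<open>(1/2)^k\<close>, so the subsequence converges. Fatou's lemma then compares the
  limit with the whole sequence.\<close>

lemma l2_complete:
  assumes us: "\<And>n. us n \<in> l2_space M"
    and cauchy: "\<And>e. e > 0 \<Longrightarrow> \<exists>N. \<forall>m\<ge>N. \<forall>n\<ge>N. l2_norm M (\<lambda>x. us m x - us n x) < e"
  shows "\<exists>u\<in>l2_space M. (\<lambda>n. l2_norm M (\<lambda>x. us n x - u x)) \<longlonglongrightarrow> 0"
proof -
  have [measurable]: "us n \<in> borel_measurable M" for n using us by (simp add: l2_space_def)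
  have "\<forall>k. \<exists>N. \<forall>m\<ge>N. \<forall>n\<ge>N. l2_norm M (\<lambda>x. us m x - us n x) < (1/4)^k"
    by (intro allI cauchy) simp
  then obtain N where N: "\<And>k m n. m \<ge> N k \<Longrightarrow> n \<ge> N k \<Longrightarrow> l2_norm M (\<lambda>x. us m x - us n x) < (1/4)^k"
    by metis
  \<comment> \<open>Summing the \<open>N i\<close> makes \<open>r\<close> monotone with
    \<open>r k\<close> at least \<open>N k\<close>; the summand \<open>k\<close> makes it tend to
    infinity.\<close>
  define r where "r k = k + (\<Sum>i\<le>k. N i)" for k
  have rN: "r k \<ge> N k" for k
  proof -
    have "N k \<le> (\<Sum>i\<le>k. N i)" by (rule member_le_sum) auto
    then show ?thesis by (simp add: r_def)
  qed
  have rk: "r k \<ge> k" for k by (simp add: r_def)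
  have rS: "r k \<le> r (Suc k)" for k by (simp add: r_def)
  define d where "d k x = us (r (Suc k)) x - us (r k) x" for k x
  have d_meas [measurable]: "d k \<in> borel_measurable M" for k unfolding d_def by measurable
  have d_l2: "d k \<in> l2_space M" for k unfolding d_def by (intro l2_space_diff us)
  have d_norm: "l2_norm M (d k) \<le> (1/4)^k" for k
    unfolding d_def using N[of k "r (Suc k)" "r k"] rN[of k] rS[of k] by (meson le_trans less_imp_le)
  have "(\<integral>\<^sup>+x. (\<Sum>k. ennreal (4^k * (d k x)\<^sup>2)) \<partial>M) = (\<Sum>k. \<integral>\<^sup>+x. ennreal (4^k * (d k x)\<^sup>2) \<partial>M)"
    by (intro nn_integral_suminf) measurable
  also have "\<dots> = (\<Sum>k. ennreal (4^k * (l2_norm M (d k))\<^sup>2))"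
  proof (rule arg_cong[where f = suminf], rule ext)
    fix k
    have "(\<integral>\<^sup>+x. ennreal (4^k * (d k x)\<^sup>2) \<partial>M) = ennreal (4^k) * (\<integral>\<^sup>+x. ennreal ((d k x)\<^sup>2) \<partial>M)"
      by (subst nn_integral_cmult[symmetric]) (auto simp: ennreal_mult)
    then show "(\<integral>\<^sup>+x. ennreal (4^k * (d k x)\<^sup>2) \<partial>M) = ennreal (4^k * (l2_norm M (d k))\<^sup>2)"
      by (simp add: nn_integral_l2[OF d_l2] ennreal_mult)
  qed
  also have "\<dots> \<le> (\<Sum>k. ennreal ((1/4)^k))"
  proof (intro suminf_le ennreal_leI summableI)
    fix k :: nat
    have "(l2_norm M (d k))\<^sup>2 \<le> ((1/4)^k)\<^sup>2" by (intro power_mono d_norm l2_norm_nonneg)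
    then have "4^k * (l2_norm M (d k))\<^sup>2 \<le> 4^k * ((1/4)^k)\<^sup>2" by simp
    also have "\<dots> = (1/4)^k" by (simp add: power2_eq_square power_divide)
    finally show "4^k * (l2_norm M (d k))\<^sup>2 \<le> (1/4)^k" .
  qed
  also have "\<dots> = ennreal (\<Sum>k. (1/4)^k)" by (intro suminf_ennreal2) auto
  also have "\<dots> < \<infinity>" by simp
  finally have fin: "(\<integral>\<^sup>+x. (\<Sum>k. ennreal (4^k * (d k x)\<^sup>2)) \<partial>M) < \<infinity>" .
  have fin_AE: "AE x in M. (\<Sum>k. ennreal (4^k * (d k x)\<^sup>2)) \<noteq> \<infinity>"
  proof (rule nn_integral_PInf_AE)
    show "(\<lambda>x. \<Sum>k. ennreal (4^k * (d k x)\<^sup>2)) \<in> borel_measurable M"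
      by measurable
  qed (use fin in simp)
  have conv_pt: "convergent (\<lambda>k. us (r k) x)"
    if "(\<Sum>k. ennreal (4^k * (d k x)\<^sup>2)) \<noteq> \<infinity>" for x
  proof -
    have "\<exists>C\<ge>0. S = ennreal C" if "S \<noteq> \<infinity>" for S :: ennreal
      using that by (cases S) auto
    from this[OF that] obtain C where C: "C \<ge> 0" "(\<Sum>k. ennreal (4^k * (d k x)\<^sup>2)) = ennreal C"
      by blast
    have dC: "4^k * (d k x)\<^sup>2 \<le> C" for k
    proof -
      have "ennreal (4^k * (d k x)\<^sup>2) = (\<Sum>k\<in>{k}. ennreal (4^k * (d k x)\<^sup>2))" by simp
      also have "\<dots> \<le> (\<Sum>k. ennreal (4^k * (d k x)\<^sup>2))" by (rule sum_le_suminf) auto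
      finally show ?thesis using C by simp
    qed
    then have "(2^k * \<bar>d k x\<bar>)\<^sup>2 \<le> (sqrt C)\<^sup>2" for k
    proof -
      have "((2::real)^k)\<^sup>2 = 4^k" by (simp add: power2_eq_square flip: power_mult_distrib)
      then show ?thesis using dC[of k] C(1) by (simp add: power_mult_distrib)
    qed
    then have "2^k * \<bar>d k x\<bar> \<le> sqrt C" for k using C(1) by (meson power2_le_imp_le real_sqrt_ge_zero)
    then have "\<bar>d k x\<bar> \<le> sqrt C * (1/2)^k" for k by (simp add: field_simps power_divide)
    then have "summable (\<lambda>k. d k x)"
      by (intro summable_comparison_test'[where g = "\<lambda>k. sqrt C * (1/2)^k" and N = 0 and f = "\<lambda>k. d k x"]) 
         (simp_all add: summable_mult summable_geometric)
    then have "convergent (\<lambda>n. \<Sum>k<n. d k x)" by (simp add: summable_iff_convergent)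
    moreover have "(\<Sum>k<n. d k x) = us (r n) x - us (r 0) x" for n
      unfolding d_def by (rule sum_lessThan_telescope)
    ultimately have "convergent (\<lambda>n. us (r n) x - us (r 0) x)" by simp
    then show "convergent (\<lambda>k. us (r k) x)"
      by (rule convergent_diff_const_right_iff[THEN iffD1])
  qed
  have conv: "AE x in M. convergent (\<lambda>k. us (r k) x)"
    using fin_AE by (rule eventually_mono) (rule conv_pt)
  define u where "u x = lim (\<lambda>k. us (r k) x)" for x
  have u_meas [measurable]: "u \<in> borel_measurable M" unfolding u_def by measurable
  have lim: "AE x in M. (\<lambda>k. us (r k) x) \<longlonglongrightarrow> u x"
    using conv by eventually_elim (simp add: u_def convergent_LIMSEQ_iff)
  \<comment> \<open>Fatou's lemma along \<open>us (r k)\<close> with \<open>n\<close> fixed.\<close>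
  have bound: "(\<integral>\<^sup>+x. ennreal ((us n x - u x)\<^sup>2) \<partial>M) \<le> ennreal (((1/4)^j)\<^sup>2)" if "n \<ge> N j" for n j
  proof -
    have "(\<integral>\<^sup>+x. ennreal ((us n x - u x)\<^sup>2) \<partial>M) = (\<integral>\<^sup>+x. liminf (\<lambda>k. ennreal ((us n x - us (r k) x)\<^sup>2)) \<partial>M)"
    proof (rule nn_integral_cong_AE)
      show "AE x in M. ennreal ((us n x - u x)\<^sup>2) = liminf (\<lambda>k. ennreal ((us n x - us (r k) x)\<^sup>2))"
        using lim
      proof eventually_elim
        case (elim x)
        then have "(\<lambda>k. ennreal ((us n x - us (r k) x)\<^sup>2)) \<longlonglongrightarrow> ennreal ((us n x - u x)\<^sup>2)"
          by (intro tendsto_ennrealI tendsto_intros)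
        from lim_imp_Liminf[OF _ this] show ?case by simp
      qed
    qed
    also have "\<dots> \<le> liminf (\<lambda>k. \<integral>\<^sup>+x. ennreal ((us n x - us (r k) x)\<^sup>2) \<partial>M)"
      by (rule nn_integral_liminf) measurable
    also have "\<dots> = liminf (\<lambda>k. ennreal ((l2_norm M (\<lambda>x. us n x - us (r k) x))\<^sup>2))"
      by (simp add: nn_integral_l2[OF l2_space_diff[OF us us]])
    also have "\<dots> \<le> liminf (\<lambda>k. ennreal (((1/4)^j)\<^sup>2))"
    proof (rule Liminf_mono)
      have "\<forall>k\<ge>N j. ennreal ((l2_norm M (\<lambda>x. us n x - us (r k) x))\<^sup>2) \<le> ennreal (((1/4)^j)\<^sup>2)"
      proof (intro allI impI ennreal_leI power_mono l2_norm_nonneg)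
        fix k assume "N j \<le> k"
        then have "N j \<le> r k" using rk[of k] by linarith
        then show "l2_norm M (\<lambda>x. us n x - us (r k) x) \<le> (1/4)^j" using N[OF that, of "r k"] by simp
      qed
      then show "\<forall>\<^sub>F k in sequentially. ennreal ((l2_norm M (\<lambda>x. us n x - us (r k) x))\<^sup>2) \<le> ennreal (((1/4)^j)\<^sup>2)"
        unfolding eventually_sequentially by blast
    qed
    also have "\<dots> = ennreal (((1/4)^j)\<^sup>2)" by (simp add: Liminf_const)
    finally show ?thesis .
  qed
  have diff_l2: "(\<lambda>x. us n x - u x) \<in> l2_space M" if "n \<ge> N 0" for n
  proof -
    have "(\<integral>\<^sup>+x. ennreal ((us n x - u x)\<^sup>2) \<partial>M) < \<infinity>"
      using bound[OF that] by (simp add: le_less_trans)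
    then show ?thesis by (auto simp: l2_space_def integrable_iff_bounded)
  qed
  \<comment> \<open>\<open>u\<close> is \<open>us (N 0)\<close> minus \<open>us (N 0) - u\<close>,
    and the latter is square-integrable by the Fatou bound.\<close>
  have u_l2: "u \<in> l2_space M"
    using l2_space_diff[OF us[of "N 0"] diff_l2[of "N 0"]] by simp
  have diff_l2': "(\<lambda>x. us n x - u x) \<in> l2_space M" for n
    by (intro l2_space_diff us u_l2)
  have norm_le: "l2_norm M (\<lambda>x. us n x - u x) \<le> (1/4)^j" if "n \<ge> N j" for n j
  proof (rule power2_le_imp_le)
    show "(l2_norm M (\<lambda>x. us n x - u x))\<^sup>2 \<le> ((1/4)^j)\<^sup>2"
      using bound[OF that] unfolding nn_integral_l2[OF diff_l2'] by (subst (asm) ennreal_le_iff) simp_all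
  qed simp
  have "(\<lambda>n. l2_norm M (\<lambda>x. us n x - u x)) \<longlonglongrightarrow> 0"
  proof (rule LIMSEQ_I)
    fix e :: real assume "e > 0"
    then obtain j where "(1/4)^j < e" using real_arch_pow_inv[of e "1/4"] by auto
    then have "\<forall>n\<ge>N j. norm (l2_norm M (\<lambda>x. us n x - u x) - 0) < e"
      by (auto simp: l2_norm_nonneg intro: le_less_trans[OF norm_le[of j]])
    then show "\<exists>no. \<forall>n\<ge>no. norm (l2_norm M (\<lambda>x. us n x - u x) - 0) < e" by blast
  qed
  with u_l2 show ?thesis by blast
qed

section \<open>The bottom of the spectrum of a closable form\<close>

text \<open>Distances to a common limit, and the defects of a minimising sequence, both bound mutual
  distances by such a sum.\<close>

lemma Cauchy_of_le_sum:
  fixes g :: "nat \<Rightarrow> nat \<Rightarrow> real"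
  assumes "\<And>m n. g m n \<le> e m + e n" "e \<longlonglongrightarrow> 0" "d > 0"
  shows "\<exists>N. \<forall>m\<ge>N. \<forall>n\<ge>N. g m n < d"
proof -
  obtain N where N: "\<And>n. n \<ge> N \<Longrightarrow> norm (e n - 0) < d / 2"
    using LIMSEQ_D[OF assms(2), of "d / 2"] assms(3) by auto
  have "g m n < d" if "m \<ge> N" "n \<ge> N" for m n
    using N[OF that(1)] N[OF that(2)] assms(1)[of m n] by (simp add: abs_less_iff)
  then show ?thesis by blast
qed

text \<open>
  The assumption \<open>weakly_closable\<close> is easier to verify than closability and implies it: a Cauchy
  sequence for the form norm that tends weakly to zero tends to zero.
\<close>

locale closable_form =
  fixes M :: "'a measure" and D :: "('a \<Rightarrow> real) set"
    and Q :: "('a \<Rightarrow> real) \<Rightarrow> ('a \<Rightarrow> real) \<Rightarrow> real" and l0 :: real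
  assumes D_l2: "f \<in> D \<Longrightarrow> f \<in> l2_space M"
    and D_lincomb: "f \<in> D \<Longrightarrow> g \<in> D \<Longrightarrow> (\<lambda>x. s * f x + t * g x) \<in> D"
    and Q_commute: "f \<in> D \<Longrightarrow> g \<in> D \<Longrightarrow> Q f g = Q g f"
    and Q_lincomb: "f \<in> D \<Longrightarrow> g \<in> D \<Longrightarrow> h \<in> D \<Longrightarrow>
      Q (\<lambda>x. s * f x + t * g x) h = s * Q f h + t * Q g h"
    and lower: "f \<in> D \<Longrightarrow> l0 * l2_inner M f f \<le> Q f f"
    and sharp: "e > 0 \<Longrightarrow> \<exists>f\<in>D. 0 < l2_inner M f f \<and> Q f f < (l0 + e) * l2_inner M f f"
    and weakly_closable: "(\<And>n. us n \<in> D) \<Longrightarrow> (\<lambda>n. l2_norm M (us n)) \<longlonglongrightarrow> 0 \<Longrightarrow>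
      (\<And>n. Q (us n) (us n) \<le> K) \<Longrightarrow> \<phi> \<in> D \<Longrightarrow> (\<lambda>n. Q (us n) \<phi>) \<longlonglongrightarrow> 0"
begin

text \<open>The form of \<open>H - l\<close>. It is coercive for \<open>l < l0\<close>, which makes
  the resolvent equation solvable, and still non-negative at \<open>l = l0\<close>, which gives
  Cauchy-Schwarz there.\<close>

definition shifted :: "real \<Rightarrow> ('a \<Rightarrow> real) \<Rightarrow> ('a \<Rightarrow> real) \<Rightarrow> real" where
  "shifted l f g = Q f g - l * l2_inner M f g"

lemma D_add_scaled: "f \<in> D \<Longrightarrow> g \<in> D \<Longrightarrow> (\<lambda>x. f x + t * g x) \<in> D"
  using D_lincomb[of f g 1 t] by simp

lemma D_diff: "f \<in> D \<Longrightarrow> g \<in> D \<Longrightarrow> (\<lambda>x. f x - g x) \<in> D"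
  using D_lincomb[of f g 1 "- 1"] by simp

lemma shifted_commute: "f \<in> D \<Longrightarrow> g \<in> D \<Longrightarrow> shifted l f g = shifted l g f"
  by (simp add: shifted_def Q_commute l2_inner_commute)

lemma shifted_lincomb:
  "f \<in> D \<Longrightarrow> g \<in> D \<Longrightarrow> h \<in> D \<Longrightarrow>
    shifted l (\<lambda>x. s * f x + t * g x) h = s * shifted l f h + t * shifted l g h"
  by (simp add: shifted_def Q_lincomb l2_inner_lincomb_left D_l2 algebra_simps)

lemma shifted_diff:
  "f \<in> D \<Longrightarrow> g \<in> D \<Longrightarrow> h \<in> D \<Longrightarrow> shifted l (\<lambda>x. f x - g x) h = shifted l f h - shifted l g h"
  using shifted_lincomb[of f g h l 1 "- 1"] by simp

lemma shifted_diff_right: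
  "f \<in> D \<Longrightarrow> g \<in> D \<Longrightarrow> h \<in> D \<Longrightarrow> shifted l h (\<lambda>x. f x - g x) = shifted l h f - shifted l h g"
  by (simp add: shifted_commute[of h] shifted_diff D_diff)

lemma shifted_add_scaled_self:
  assumes "f \<in> D" "g \<in> D"
  shows "shifted l (\<lambda>x. f x + t * g x) (\<lambda>x. f x + t * g x)
    = shifted l f f + 2 * t * shifted l f g + t\<^sup>2 * shifted l g g"
proof -
  let ?k = "\<lambda>x. f x + t * g x"
  have k: "?k \<in> D" using assms by (rule D_add_scaled)
  have "shifted l ?k ?k = shifted l f ?k + t * shifted l g ?k"
    using shifted_lincomb[OF assms k, of l 1 t] by simp
  moreover have "shifted l ?k f = shifted l f f + t * shifted l g f"
    using shifted_lincomb[OF assms assms(1), of l 1 t] by simp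
  moreover have "shifted l ?k g = shifted l f g + t * shifted l g g"
    using shifted_lincomb[OF assms assms(2), of l 1 t] by simp
  ultimately show ?thesis
    by (simp add: shifted_commute[OF assms(1) k] shifted_commute[OF assms(2) k]
        shifted_commute[OF assms(2,1)] power2_eq_square algebra_simps)
qed

lemma shifted_coercive: "f \<in> D \<Longrightarrow> (l0 - l) * l2_inner M f f \<le> shifted l f f"
  using lower[of f] by (simp add: shifted_def algebra_simps)

lemma shifted_nonneg:
  assumes "f \<in> D" "l \<le> l0"
  shows "0 \<le> shifted l f f"
proof -
  have "0 \<le> (l0 - l) * l2_inner M f f" using assms(2) by (simp add: l2_inner_self_nonneg)
  with shifted_coercive[OF assms(1), of l] show ?thesis by linarith
qed

lemma shifted_Cauchy_Schwarz:
  assumes "f \<in> D" "g \<in> D" "l \<le> l0"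
  shows "(shifted l f g)\<^sup>2 \<le> shifted l f f * shifted l g g"
  using shifted_add_scaled_self[OF assms(1,2)] shifted_nonneg[OF D_add_scaled[OF assms(1,2)] assms(3)]
  by (intro quadratic_nonneg_imp_discriminant) metis

text \<open>At \<open>l0 - 1\<close> the shifted form dominates \<open>l2_inner M f f\<close>, so
  this norm is stronger than the L2 norm.\<close>

definition form_norm :: "('a \<Rightarrow> real) \<Rightarrow> real" where
  "form_norm f = sqrt (shifted (l0 - 1) f f)"

lemma form_norm_square: "f \<in> D \<Longrightarrow> (form_norm f)\<^sup>2 = shifted (l0 - 1) f f"
  by (simp add: form_norm_def shifted_nonneg)

lemma form_norm_nonneg: "f \<in> D \<Longrightarrow> 0 \<le> form_norm f"
  by (simp add: form_norm_def shifted_nonneg)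

lemma shifted_le_form_norm:
  assumes "f \<in> D" "g \<in> D"
  shows "\<bar>shifted (l0 - 1) f g\<bar> \<le> form_norm f * form_norm g"
proof -
  have "(shifted (l0 - 1) f g)\<^sup>2 \<le> (form_norm f * form_norm g)\<^sup>2"
    using shifted_Cauchy_Schwarz[OF assms, of "l0 - 1"] by (simp add: power_mult_distrib form_norm_square assms)
  then show ?thesis
    by (metis abs_le_square_iff abs_of_nonneg form_norm_nonneg assms mult_nonneg_nonneg)
qed

lemma form_norm_triangle_diff:
  assumes "f \<in> D" "g \<in> D"
  shows "form_norm (\<lambda>x. f x - g x) \<le> form_norm f + form_norm g"
proof (rule power2_le_imp_le)
  show "(form_norm (\<lambda>x. f x - g x))\<^sup>2 \<le> (form_norm f + form_norm g)\<^sup>2"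
    using shifted_add_scaled_self[OF assms, of "l0 - 1" "- 1"] shifted_le_form_norm[OF assms]
    by (simp add: form_norm_square D_diff assms power2_sum)
qed (simp add: form_norm_nonneg assms)

section \<open>Form convergence, closability and the closed form\<close>

lemma form_converges_D: "form_converges M D Q us u \<Longrightarrow> us n \<in> D"
  by (simp add: form_converges_def)

lemma form_converges_l2: "form_converges M D Q us u \<Longrightarrow> u \<in> l2_space M"
  by (simp add: form_converges_def)

lemma form_converges_tendsto:
  "form_converges M D Q us u \<Longrightarrow> (\<lambda>n. l2_norm M (\<lambda>x. us n x - u x)) \<longlonglongrightarrow> 0"
  by (simp add: form_converges_def)

lemma form_converges_const:
  assumes "u \<in> D"
  shows "form_converges M D Q (\<lambda>_. u) u"
proof -
  have "Q (\<lambda>x. u x - u x) (\<lambda>x. u x - u x) = 0"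
    using Q_lincomb[OF assms assms, of "\<lambda>x. u x - u x" 1 "- 1"] D_diff[OF assms assms] by simp
  then show ?thesis
    using assms by (auto simp: form_converges_def D_l2 l2_norm_def l2_inner_def)
qed

text \<open>\<open>form_converges\<close> controls \<open>Q\<close> and the L2 norm separately; the
  shifted form differs from \<open>Q\<close> by a multiple of the squared L2 norm. The budget
  \<open>e\<^sup>2\<close> is split evenly between the two.\<close>

lemma form_converges_Cauchy:
  assumes fc: "form_converges M D Q us u" and "e > 0"
  shows "\<exists>N. \<forall>m\<ge>N. \<forall>n\<ge>N. form_norm (\<lambda>x. us m x - us n x) < e"
proof -
  define d where "d = e\<^sup>2 / 2"
  have d: "d > 0" using assms(2) by (simp add: d_def)
  have us: "us n \<in> D" for n using fc by (rule form_converges_D)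
  have u: "u \<in> l2_space M" using fc by (rule form_converges_l2)
  have "\<exists>N. \<forall>m\<ge>N. \<forall>n\<ge>N. l2_norm M (\<lambda>x. us m x - us n x) < sqrt (d / (1 + \<bar>l0 - 1\<bar>))"
  proof (rule Cauchy_of_le_sum[OF _ form_converges_tendsto[OF fc]])
    fix m n
    show "l2_norm M (\<lambda>x. us m x - us n x)
        \<le> l2_norm M (\<lambda>x. us m x - u x) + l2_norm M (\<lambda>x. us n x - u x)"
      using l2_norm_triangle_diff[OF D_l2[OF us] u D_l2[OF us], of m n]
      by (simp add: l2_norm_minus_commute[of M u])
  qed (use d in simp)
  then obtain N1 where N1: "\<And>m n. m \<ge> N1 \<Longrightarrow> n \<ge> N1 \<Longrightarrow>
      l2_norm M (\<lambda>x. us m x - us n x) < sqrt (d / (1 + \<bar>l0 - 1\<bar>))" by blast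
  obtain N2 where N2: "\<And>m n. m \<ge> N2 \<Longrightarrow> n \<ge> N2 \<Longrightarrow>
      \<bar>Q (\<lambda>x. us m x - us n x) (\<lambda>x. us m x - us n x)\<bar> < d"
    using fc d unfolding form_converges_def by blast
  have "form_norm (\<lambda>x. us m x - us n x) < e" if "m \<ge> max N1 N2" "n \<ge> max N1 N2" for m n
  proof -
    let ?w = "\<lambda>x. us m x - us n x"
    have "(l2_norm M ?w)\<^sup>2 < (sqrt (d / (1 + \<bar>l0 - 1\<bar>)))\<^sup>2"
      using N1[of m n] that by (intro power_strict_mono l2_norm_nonneg) auto
    then have "l2_inner M ?w ?w < d / (1 + \<bar>l0 - 1\<bar>)"
      using d by (simp add: l2_norm_square)
    then have "(1 + \<bar>l0 - 1\<bar>) * l2_inner M ?w ?w < d"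
      by (subst (asm) pos_less_divide_eq) (simp_all add: mult.commute)
    moreover have "- (l0 - 1) * l2_inner M ?w ?w \<le> (1 + \<bar>l0 - 1\<bar>) * l2_inner M ?w ?w"
      by (intro mult_right_mono l2_inner_self_nonneg) auto
    moreover have "Q ?w ?w < d" using N2[of m n] that by auto
    moreover have "shifted (l0 - 1) ?w ?w = Q ?w ?w + - (l0 - 1) * l2_inner M ?w ?w" "e\<^sup>2 = d + d"
      by (simp_all add: shifted_def d_def algebra_simps)
    ultimately have "shifted (l0 - 1) ?w ?w < e\<^sup>2" by linarith
    then have "(form_norm ?w)\<^sup>2 < e\<^sup>2" by (simp add: form_norm_square us D_diff)
    then show ?thesis using assms(2) power2_less_imp_less less_imp_le by blast
  qed
  then show ?thesis by blast
qed

lemma Cauchy_form_norm_bounded: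
  fixes us :: "nat \<Rightarrow> 'a \<Rightarrow> real"
  assumes us: "\<And>n. us n \<in> D"
    and cauchy: "\<And>e. e > 0 \<Longrightarrow> \<exists>N. \<forall>m\<ge>N. \<forall>n\<ge>N. form_norm (\<lambda>x. us m x - us n x) < e"
  shows "\<exists>K>0. \<forall>n. form_norm (us n) \<le> K"
proof -
  obtain N where N: "\<And>m n. m \<ge> N \<Longrightarrow> n \<ge> N \<Longrightarrow> form_norm (\<lambda>x. us m x - us n x) < 1"
    using cauchy[of 1] by auto
  define K where "K = 1 + form_norm (us N) + (\<Sum>i\<le>N. form_norm (us i))"
  have "form_norm (us n) \<le> K" for n
  proof (cases "n \<le> N")
    case True
    then have "form_norm (us n) \<le> (\<Sum>i\<le>N. form_norm (us i))"
      by (intro member_le_sum form_norm_nonneg us finite_atMost) auto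
    then show ?thesis using form_norm_nonneg[OF us, of N] by (simp add: K_def)
  next
    case False
    \<comment> \<open>The triangle inequality is stated for differences, so \<open>us n\<close> is
      written as \<open>(us n - us N) - (- us N)\<close>.\<close>
    have neg: "(\<lambda>x. - us N x) \<in> D" using D_lincomb[OF us us, of "- 1" N 0 N] by simp
    have "form_norm (\<lambda>x. - us N x) = form_norm (us N)"
      using shifted_lincomb[OF us us neg, of "l0 - 1" "- 1" N 0 N] shifted_commute[OF us neg, of "l0 - 1" N]
        shifted_lincomb[OF us us us, of "l0 - 1" "- 1" N 0 N N]
      by (simp add: form_norm_def)
    then have "form_norm (us n) \<le> form_norm (\<lambda>x. us n x - us N x) + form_norm (us N)"
      using form_norm_triangle_diff[OF D_diff[OF us us] neg, of n N] by simp
    moreover have "0 \<le> (\<Sum>i\<le>N. form_norm (us i))" by (intro sum_nonneg form_norm_nonneg us)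
    ultimately show ?thesis using N[of n N] False by (simp add: K_def)
  qed
  moreover have "K > 0"
    unfolding K_def by (intro add_pos_nonneg sum_nonneg form_norm_nonneg us) auto
  ultimately show ?thesis by blast
qed

text \<open>Pair \<open>us n\<close> with \<open>us n - us N\<close> and with \<open>us N\<close>.
  The first pairing is small uniformly in large \<open>n\<close>, because the form norms are bounded
  and the sequence is Cauchy; the second tends to zero for fixed \<open>N\<close> by
  \<open>weakly_closable\<close>.\<close>

lemma closable:
  assumes us: "\<And>n. us n \<in> D"
    and cauchy: "\<And>e. e > 0 \<Longrightarrow> \<exists>N. \<forall>m\<ge>N. \<forall>n\<ge>N. form_norm (\<lambda>x. us m x - us n x) < e"
    and null: "(\<lambda>n. l2_norm M (us n)) \<longlonglongrightarrow> 0"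
  shows "(\<lambda>n. form_norm (us n)) \<longlonglongrightarrow> 0"
proof -
  obtain K where K: "K > 0" "\<And>n. form_norm (us n) \<le> K"
    using Cauchy_form_norm_bounded[OF us cauchy] by blast
  have norm2: "(\<lambda>n. l2_inner M (us n) (us n)) \<longlonglongrightarrow> 0"
    using tendsto_power[OF null, of 2] by (simp add: l2_norm_square)
  have weak: "(\<lambda>n. shifted (l0 - 1) (us n) \<phi>) \<longlonglongrightarrow> 0" if "\<phi> \<in> D" for \<phi>
  proof -
    obtain L where L: "\<And>n. \<bar>l2_inner M (us n) (us n)\<bar> \<le> L"
      using convergent_imp_Bseq[OF convergentI[OF norm2]] by (auto simp: Bseq_def)
    have "Q (us n) (us n) \<le> K\<^sup>2 + \<bar>l0 - 1\<bar> * L" for n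
    proof -
      have "shifted (l0 - 1) (us n) (us n) \<le> K\<^sup>2"
        using power_mono[OF K(2) form_norm_nonneg[OF us], of n 2] by (simp add: form_norm_square us)
      moreover have "(l0 - 1) * l2_inner M (us n) (us n) \<le> \<bar>l0 - 1\<bar> * L"
        using L[of n] by (metis abs_ge_self abs_ge_zero abs_mult mult_left_mono order_trans)
      ultimately show ?thesis by (simp add: shifted_def)
    qed
    then have 1: "(\<lambda>n. Q (us n) \<phi>) \<longlonglongrightarrow> 0" by (intro weakly_closable[OF us null _ that])
    have "(\<lambda>n. l2_inner M (us n) \<phi>) \<longlonglongrightarrow> 0"
    proof (rule Lim_null_comparison)
      show "\<forall>\<^sub>F n in sequentially. norm (l2_inner M (us n) \<phi>) \<le> l2_norm M (us n) * l2_norm M \<phi>"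
        by (intro always_eventually allI) (simp add: l2_Cauchy_Schwarz D_l2 us that)
      show "(\<lambda>n. l2_norm M (us n) * l2_norm M \<phi>) \<longlonglongrightarrow> 0"
        using tendsto_mult_right[OF null, of "l2_norm M \<phi>"] by simp
    qed
    then have "(\<lambda>n. (l0 - 1) * l2_inner M (us n) \<phi>) \<longlonglongrightarrow> (l0 - 1) * 0" by (rule tendsto_mult_left)
    from tendsto_diff[OF 1 this] show ?thesis by (simp add: shifted_def)
  qed
  have "(\<lambda>n. shifted (l0 - 1) (us n) (us n)) \<longlonglongrightarrow> 0"
  proof (rule LIMSEQ_I)
    fix e :: real assume e: "e > 0"
    then obtain N where N: "\<And>m n. m \<ge> N \<Longrightarrow> n \<ge> N \<Longrightarrow> form_norm (\<lambda>x. us m x - us n x) < e / (2 * K)"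
      using cauchy[of "e / (2 * K)"] K(1) by auto
    obtain N' where N': "\<And>n. n \<ge> N' \<Longrightarrow> \<bar>shifted (l0 - 1) (us n) (us N)\<bar> < e / 2"
      using LIMSEQ_D[OF weak[OF us[of N]], of "e / 2"] e by auto
    have "norm (shifted (l0 - 1) (us n) (us n) - 0) < e" if "n \<ge> max N N'" for n
    proof -
      have "\<bar>shifted (l0 - 1) (us n) (\<lambda>x. us n x - us N x)\<bar>
          \<le> form_norm (us n) * form_norm (\<lambda>x. us n x - us N x)"
        by (intro shifted_le_form_norm us D_diff)
      also have "\<dots> \<le> K * (e / (2 * K))"
        using N[of n N] that by (intro mult_mono K) (auto intro: less_imp_le form_norm_nonneg us D_diff simp: K less_imp_le[OF K(1)])
      also have "\<dots> = e / 2" using K by simp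
      finally have "\<bar>shifted (l0 - 1) (us n) (us n) - shifted (l0 - 1) (us n) (us N)\<bar> \<le> e / 2"
        by (simp only: shifted_diff_right us)
      moreover have "\<bar>shifted (l0 - 1) (us n) (us N)\<bar> < e / 2" using N'[of n] that by simp
      ultimately show ?thesis unfolding real_norm_def by linarith
    qed
    then show "\<exists>no. \<forall>n\<ge>no. norm (shifted (l0 - 1) (us n) (us n) - 0) < e" by blast
  qed
  from tendsto_real_sqrt[OF this] show ?thesis by (simp add: form_norm_def)
qed

text \<open>The difference of two approximations of \<open>u\<close> is form-Cauchy and tends to
  zero in L2, so \<open>closable\<close> applies. This makes the closed form independent of the
  approximation.\<close>

lemma form_converges_diff_null:
  assumes "form_converges M D Q us u" "form_converges M D Q vs u"
  shows "(\<lambda>n. form_norm (\<lambda>x. us n x - vs n x)) \<longlonglongrightarrow> 0"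
proof (rule closable)
  have us: "us n \<in> D" and vs: "vs n \<in> D" for n using assms by (auto intro: form_converges_D)
  have u: "u \<in> l2_space M" using assms(1) by (rule form_converges_l2)
  show "(\<lambda>x. us n x - vs n x) \<in> D" for n by (intro D_diff us vs)
  show "\<exists>N. \<forall>m\<ge>N. \<forall>n\<ge>N. form_norm (\<lambda>x. us m x - vs m x - (us n x - vs n x)) < e" if "e > 0" for e
  proof -
    obtain N1 where N1: "\<And>m n. m \<ge> N1 \<Longrightarrow> n \<ge> N1 \<Longrightarrow> form_norm (\<lambda>x. us m x - us n x) < e / 2"
      using form_converges_Cauchy[OF assms(1) half_gt_zero[OF \<open>e > 0\<close>]] by blast
    obtain N2 where N2: "\<And>m n. m \<ge> N2 \<Longrightarrow> n \<ge> N2 \<Longrightarrow> form_norm (\<lambda>x. vs m x - vs n x) < e / 2"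
      using form_converges_Cauchy[OF assms(2) half_gt_zero[OF \<open>e > 0\<close>]] by blast
    have "form_norm (\<lambda>x. us m x - vs m x - (us n x - vs n x)) < e"
      if "m \<ge> max N1 N2" "n \<ge> max N1 N2" for m n
    proof -
      have "form_norm (\<lambda>x. (us m x - us n x) - (vs m x - vs n x))
          \<le> form_norm (\<lambda>x. us m x - us n x) + form_norm (\<lambda>x. vs m x - vs n x)"
        by (intro form_norm_triangle_diff D_diff us vs)
      moreover have "(\<lambda>x. (us m x - us n x) - (vs m x - vs n x)) = (\<lambda>x. us m x - vs m x - (us n x - vs n x))"
        by (simp add: algebra_simps)
      ultimately show ?thesis using N1[of m n] N2[of m n] that by auto
    qed
    then show ?thesis by blast
  qed
  show "(\<lambda>n. l2_norm M (\<lambda>x. us n x - vs n x)) \<longlonglongrightarrow> 0"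
  proof (rule Lim_null_comparison)
    show "\<forall>\<^sub>F n in sequentially. norm (l2_norm M (\<lambda>x. us n x - vs n x))
        \<le> l2_norm M (\<lambda>x. us n x - u x) + l2_norm M (\<lambda>x. vs n x - u x)"
    proof (intro always_eventually allI)
      fix n
      show "norm (l2_norm M (\<lambda>x. us n x - vs n x))
          \<le> l2_norm M (\<lambda>x. us n x - u x) + l2_norm M (\<lambda>x. vs n x - u x)"
        using l2_norm_triangle_diff[OF D_l2[OF us] u D_l2[OF vs], of n n]
        by (simp add: l2_norm_nonneg l2_norm_minus_commute[of M u])
    qed
    show "(\<lambda>n. l2_norm M (\<lambda>x. us n x - u x) + l2_norm M (\<lambda>x. vs n x - u x)) \<longlonglongrightarrow> 0"
      using tendsto_add[OF form_converges_tendsto[OF assms(1)] form_converges_tendsto[OF assms(2)]] by simp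
  qed
qed

lemma shifted_Cauchy_convergent:
  assumes us: "form_converges M D Q us u" and vs: "form_converges M D Q vs v"
  shows "convergent (\<lambda>n. shifted (l0 - 1) (us n) (vs n))"
proof -
  note usD = form_converges_D[OF us] and vsD = form_converges_D[OF vs]
  obtain K where K: "K > 0" "\<And>n. form_norm (us n) \<le> K"
    using Cauchy_form_norm_bounded[OF usD form_converges_Cauchy[OF us]] by blast
  obtain L where L: "L > 0" "\<And>n. form_norm (vs n) \<le> L"
    using Cauchy_form_norm_bounded[OF vsD form_converges_Cauchy[OF vs]] by blast
  have "Cauchy (\<lambda>n. shifted (l0 - 1) (us n) (vs n))"
  proof (rule CauchyI)
    fix e :: real assume e: "e > 0"
    obtain N1 where N1: "\<And>m n. m \<ge> N1 \<Longrightarrow> n \<ge> N1 \<Longrightarrow> form_norm (\<lambda>x. us m x - us n x) < e / (2 * L)"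
      using form_converges_Cauchy[OF us, of "e / (2 * L)"] e L by auto
    obtain N2 where N2: "\<And>m n. m \<ge> N2 \<Longrightarrow> n \<ge> N2 \<Longrightarrow> form_norm (\<lambda>x. vs m x - vs n x) < e / (2 * K)"
      using form_converges_Cauchy[OF vs, of "e / (2 * K)"] e K by auto
    have "norm (shifted (l0 - 1) (us m) (vs m) - shifted (l0 - 1) (us n) (vs n)) < e"
      if "m \<ge> max N1 N2" "n \<ge> max N1 N2" for m n
    proof -
      have "shifted (l0 - 1) (us m) (vs m) - shifted (l0 - 1) (us n) (vs n)
        = shifted (l0 - 1) (\<lambda>x. us m x - us n x) (vs m) + shifted (l0 - 1) (us n) (\<lambda>x. vs m x - vs n x)"
        by (simp add: shifted_diff shifted_diff_right usD vsD)
      moreover have "\<bar>shifted (l0 - 1) (\<lambda>x. us m x - us n x) (vs m)\<bar> < e / (2 * L) * L"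
      proof (rule le_less_trans[OF shifted_le_form_norm])
        have "form_norm (\<lambda>x. us m x - us n x) * form_norm (vs m) \<le> form_norm (\<lambda>x. us m x - us n x) * L"
          by (intro mult_left_mono L form_norm_nonneg D_diff usD)
        also have "\<dots> < e / (2 * L) * L" using N1[of m n] that L by (intro mult_strict_right_mono) auto
        finally show "form_norm (\<lambda>x. us m x - us n x) * form_norm (vs m) < e / (2 * L) * L" .
      qed (auto intro: D_diff usD vsD)
      moreover have "\<bar>shifted (l0 - 1) (us n) (\<lambda>x. vs m x - vs n x)\<bar> < K * (e / (2 * K))"
      proof (rule le_less_trans[OF shifted_le_form_norm])
        have "form_norm (us n) * form_norm (\<lambda>x. vs m x - vs n x) \<le> K * form_norm (\<lambda>x. vs m x - vs n x)"
          by (intro mult_right_mono K form_norm_nonneg D_diff vsD)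
        also have "\<dots> < K * (e / (2 * K))" using N2[of m n] that K by (intro mult_strict_left_mono) auto
        finally show "form_norm (us n) * form_norm (\<lambda>x. vs m x - vs n x) < K * (e / (2 * K))" .
      qed (auto intro: D_diff usD vsD)
      ultimately show ?thesis using K L by simp
    qed
    then show "\<exists>N. \<forall>m\<ge>N. \<forall>n\<ge>N. norm (shifted (l0 - 1) (us m) (vs m) - shifted (l0 - 1) (us n) (vs n)) < e"
      by blast
  qed
  then show ?thesis by (rule Cauchy_convergent)
qed

lemma shifted_diff_null:
  assumes us: "form_converges M D Q us u" and us': "form_converges M D Q us' u"
    and vs: "form_converges M D Q vs v" and vs': "form_converges M D Q vs' v"
  shows "(\<lambda>n. shifted (l0 - 1) (us n) (vs n) - shifted (l0 - 1) (us' n) (vs' n)) \<longlonglongrightarrow> 0"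
proof -
  note D = form_converges_D[OF us] form_converges_D[OF vs] form_converges_D[OF us'] form_converges_D[OF vs']
  obtain K where K: "K > 0" "\<And>n. form_norm (us' n) \<le> K"
    using Cauchy_form_norm_bounded[OF D(3) form_converges_Cauchy[OF us']] by blast
  obtain L where L: "L > 0" "\<And>n. form_norm (vs n) \<le> L"
    using Cauchy_form_norm_bounded[OF D(2) form_converges_Cauchy[OF vs]] by blast
  let ?g = "\<lambda>n. form_norm (\<lambda>x. us n x - us' n x) * L + K * form_norm (\<lambda>x. vs n x - vs' n x)"
  have lim: "?g \<longlonglongrightarrow> 0"
    using tendsto_add[OF tendsto_mult_right[OF form_converges_diff_null[OF us us'], of L]
        tendsto_mult_left[OF form_converges_diff_null[OF vs vs'], of K]] by simp
  have "norm (shifted (l0 - 1) (us n) (vs n) - shifted (l0 - 1) (us' n) (vs' n)) \<le> ?g n" for n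
  proof -
    have "shifted (l0 - 1) (us n) (vs n) - shifted (l0 - 1) (us' n) (vs' n)
      = shifted (l0 - 1) (\<lambda>x. us n x - us' n x) (vs n) + shifted (l0 - 1) (us' n) (\<lambda>x. vs n x - vs' n x)"
      by (simp add: shifted_diff shifted_diff_right D)
    moreover have "\<bar>shifted (l0 - 1) (\<lambda>x. us n x - us' n x) (vs n)\<bar> \<le> form_norm (\<lambda>x. us n x - us' n x) * L"
      by (rule order_trans[OF shifted_le_form_norm]) (auto intro!: D_diff D mult_left_mono L form_norm_nonneg)
    moreover have "\<bar>shifted (l0 - 1) (us' n) (\<lambda>x. vs n x - vs' n x)\<bar> \<le> K * form_norm (\<lambda>x. vs n x - vs' n x)"
      by (rule order_trans[OF shifted_le_form_norm]) (auto intro!: D_diff D mult_right_mono K form_norm_nonneg)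
    ultimately show ?thesis by simp
  qed
  then show ?thesis by (intro Lim_null_comparison[OF _ lim] always_eventually allI)
qed

lemma form_converges_inner_tendsto:
  assumes "form_converges M D Q us u" "form_converges M D Q vs v"
  shows "(\<lambda>n. l2_inner M (us n) (vs n)) \<longlonglongrightarrow> l2_inner M u v"
  using assms
  by (intro l2_inner_tendsto) (auto intro: D_l2 form_converges_D form_converges_l2 form_converges_tendsto)

text \<open>Justifies the \<open>THE\<close> in \<open>closure_form\<close>: the limit exists along
  one pair of sequences, carries over to every other pair, and is unique because at least one pair
  exists.\<close>

lemma closure_form_tendsto:
  assumes us: "form_converges M D Q us u" and vs: "form_converges M D Q vs v"
  shows "(\<lambda>n. Q (us n) (vs n)) \<longlonglongrightarrow> closure_form M D Q u v"
proof -
  obtain r where r: "(\<lambda>n. shifted (l0 - 1) (us n) (vs n)) \<longlonglongrightarrow> r"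
    using shifted_Cauchy_convergent[OF us vs] by (auto simp: convergent_def)
  define c where "c = r + (l0 - 1) * l2_inner M u v"
  have c: "(\<lambda>n. Q (us' n) (vs' n)) \<longlonglongrightarrow> c"
    if us': "form_converges M D Q us' u" and vs': "form_converges M D Q vs' v" for us' vs'
  proof -
    have "(\<lambda>n. shifted (l0 - 1) (us n) (vs n)
        - (shifted (l0 - 1) (us n) (vs n) - shifted (l0 - 1) (us' n) (vs' n))) \<longlonglongrightarrow> r - 0"
      by (intro tendsto_diff r shifted_diff_null[OF us us' vs vs'])
    then have "(\<lambda>n. shifted (l0 - 1) (us' n) (vs' n) + (l0 - 1) * l2_inner M (us' n) (vs' n)) \<longlonglongrightarrow> c"
      unfolding c_def by (intro tendsto_add tendsto_mult_left form_converges_inner_tendsto us' vs') simp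
    then show ?thesis by (simp add: shifted_def)
  qed
  have "closure_form M D Q u v = c"
    unfolding closure_form_def
  proof (rule the_equality)
    show "\<forall>us vs. form_converges M D Q us u \<longrightarrow> form_converges M D Q vs v \<longrightarrow>
      (\<lambda>n. Q (us n) (vs n)) \<longlonglongrightarrow> c" using c by blast
    fix r' assume "\<forall>us vs. form_converges M D Q us u \<longrightarrow> form_converges M D Q vs v \<longrightarrow>
      (\<lambda>n. Q (us n) (vs n)) \<longlonglongrightarrow> r'"
    then show "r' = c" using c us vs LIMSEQ_unique by blast
  qed
  with c[OF us vs] show ?thesis by simp
qed

section \<open>Resolvent and spectrum of the associated operator\<close>

lemma closure_domE:
  assumes "u \<in> closure_dom M D Q"
  obtains us where "form_converges M D Q us u"
  using assms by (auto simp: closure_dom_def)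

lemma closure_dom_l2: "u \<in> closure_dom M D Q \<Longrightarrow> u \<in> l2_space M"
  by (auto simp: closure_dom_def form_converges_l2)

lemma closure_form_lower:
  assumes "u \<in> closure_dom M D Q"
  shows "l0 * l2_inner M u u \<le> closure_form M D Q u u"
proof -
  obtain us where us: "form_converges M D Q us u" using assms by (rule closure_domE)
  show ?thesis
    by (rule LIMSEQ_le[OF tendsto_mult_left[OF form_converges_inner_tendsto[OF us us]] closure_form_tendsto[OF us us]])
      (auto intro!: lower form_converges_D[OF us])
qed

text \<open>The solution of \<open>(H - l) u = g\<close> minimises \<open>\<lambda>u. shifted l u u - 2 \<langle>g,u\<rangle>\<close>.\<close>

lemma resolvent_equation_solvable:
  assumes l: "l < l0" and g: "g \<in> l2_space M"
  shows "\<exists>u. (u, \<lambda>x. g x + l * u x) \<in> form_operator M D Q"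
proof -
  define J where "J f = shifted l f f - 2 * l2_inner M g f" for f
  define \<delta> where "\<delta> = l0 - l"
  have \<delta>: "\<delta> > 0" using l by (simp add: \<delta>_def)
  \<comment> \<open>Completing the square: the squared norm of \<open>\<delta> * f - g\<close>,
    divided by \<open>\<delta>\<close>, is non-negative, and coercivity bounds its term
    \<open>\<delta> * l2_inner M f f\<close> by the shifted form.\<close>
  have J_lower: "- (l2_inner M g g / \<delta>) \<le> J f" if "f \<in> D" for f
  proof -
    have "0 \<le> l2_inner M (\<lambda>x. \<delta> * f x + (- 1) * g x) (\<lambda>x. \<delta> * f x + (- 1) * g x)"
      by (rule l2_inner_self_nonneg)
    also have "\<dots> = l2_inner M g g + 2 * (- \<delta>) * l2_inner M g f + (- \<delta>)\<^sup>2 * l2_inner M f f"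
      using l2_inner_lincomb_self[OF g D_l2[OF that], of "- \<delta>"]
      by (simp add: l2_inner_def algebra_simps)
    finally have "0 \<le> (l2_inner M g g + 2 * (- \<delta>) * l2_inner M g f + (- \<delta>)\<^sup>2 * l2_inner M f f) / \<delta>"
      using \<delta> by (intro divide_nonneg_pos)
    also have "\<dots> = l2_inner M g g / \<delta> - 2 * l2_inner M g f + \<delta> * l2_inner M f f"
      using \<delta> by (simp add: field_simps power2_eq_square)
    finally show ?thesis using shifted_coercive[OF that, of l] by (simp add: J_def \<delta>_def)
  qed
  obtain f0 where f0: "f0 \<in> D" using sharp[of 1] by auto
  define j where "j = Inf (J ` D)"
  have bdd: "bdd_below (J ` D)" using J_lower by (auto intro!: bdd_belowI)
  have "\<exists>f\<in>D. J f < j + 1 / real (Suc n)" for n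
  proof -
    have "Inf (J ` D) < j + 1 / real (Suc n)" by (simp add: j_def)
    then show ?thesis using f0 by (subst (asm) cInf_less_iff) (use bdd in auto)
  qed
  then obtain us where us: "\<And>n. us n \<in> D" and Jus: "\<And>n. J (us n) < j + 1 / real (Suc n)"
    by metis
  \<comment> \<open>\<open>J\<close> along the line \<open>us n + t * v\<close> is a quadratic in
    \<open>t\<close> that stays above \<open>J (us n) - 1 / (n + 1)\<close>. Its discriminant says
    that \<open>us n\<close> solves the weak equation up to an error of order
    \<open>1 / sqrt n\<close>.\<close>
  have near: "(shifted l (us n) v - l2_inner M g v)\<^sup>2 \<le> 1 / real (Suc n) * shifted l v v" if v: "v \<in> D" for n v
  proof (rule quadratic_nonneg_imp_discriminant)
    fix t
    have "j \<le> J (\<lambda>x. us n x + t * v x)"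
      unfolding j_def by (intro cInf_lower bdd imageI D_add_scaled us v)
    also have "\<dots> = J (us n) + 2 * t * (shifted l (us n) v - l2_inner M g v) + t\<^sup>2 * shifted l v v"
      using l2_inner_lincomb_left[OF D_l2[OF us[of n]] D_l2[OF v] g, of 1 t]
      by (simp add: J_def shifted_add_scaled_self us v l2_inner_commute[of M g] algebra_simps)
    finally show "0 \<le> 1 / real (Suc n) + 2 * t * (shifted l (us n) v - l2_inner M g v) + t\<^sup>2 * shifted l v v"
      using Jus[of n] by linarith
  qed
  have near': "\<bar>shifted l (us n) v - l2_inner M g v\<bar> \<le> sqrt (1 / real (Suc n)) * sqrt (shifted l v v)"
    if v: "v \<in> D" for n v
    using real_sqrt_le_mono[OF near[OF v, of n]] unfolding real_sqrt_mult real_sqrt_abs .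
  have inv0: "(\<lambda>n. sqrt (1 / real (Suc n))) \<longlonglongrightarrow> 0"
    using tendsto_real_sqrt[OF LIMSEQ_inverse_real_of_nat] by (simp add: inverse_eq_divide)
  \<comment> \<open>Test the almost-solutions \<open>us m\<close> and \<open>us n\<close> with their
    own difference and subtract: the terms with \<open>g\<close> cancel.\<close>
  have sq_diff: "sqrt (shifted l (\<lambda>x. us m x - us n x) (\<lambda>x. us m x - us n x))
      \<le> sqrt (1 / real (Suc m)) + sqrt (1 / real (Suc n))" (is "sqrt ?s \<le> _") for m n
  proof (cases "?s = 0")
    case False
    have D: "(\<lambda>x. us m x - us n x) \<in> D" by (intro D_diff us)
    then have "?s > 0" using False shifted_nonneg[OF D, of l] l by simp
    have "?s = (shifted l (us m) (\<lambda>x. us m x - us n x) - l2_inner M g (\<lambda>x. us m x - us n x))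
        - (shifted l (us n) (\<lambda>x. us m x - us n x) - l2_inner M g (\<lambda>x. us m x - us n x))"
      by (simp add: shifted_diff us D)
    also have "\<dots> \<le> sqrt (1 / real (Suc m)) * sqrt ?s + sqrt (1 / real (Suc n)) * sqrt ?s"
      using near'[OF D, of m] near'[OF D, of n] by linarith
    finally have "sqrt ?s * sqrt ?s \<le> (sqrt (1 / real (Suc m)) + sqrt (1 / real (Suc n))) * sqrt ?s"
      using \<open>?s > 0\<close> by (simp add: algebra_simps)
    then show ?thesis using \<open>?s > 0\<close> by (meson mult_right_le_imp_le real_sqrt_gt_zero)
  qed simp
  have shifted_cauchy: "\<exists>N. \<forall>m\<ge>N. \<forall>n\<ge>N. sqrt (shifted l (\<lambda>x. us m x - us n x) (\<lambda>x. us m x - us n x)) < e"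
    if "e > 0" for e
    by (rule Cauchy_of_le_sum[OF sq_diff inv0 that])
  have norm_le: "l2_norm M f \<le> sqrt (shifted l f f) / sqrt \<delta>" if "f \<in> D" for f
  proof -
    have "l2_inner M f f \<le> shifted l f f / \<delta>"
      using shifted_coercive[OF that, of l] \<delta> by (simp add: \<delta>_def field_simps)
    then show ?thesis by (simp add: l2_norm_def flip: real_sqrt_divide)
  qed
  have "\<exists>u\<in>l2_space M. (\<lambda>n. l2_norm M (\<lambda>x. us n x - u x)) \<longlonglongrightarrow> 0"
  proof (rule l2_complete)
    fix e :: real assume "e > 0"
    then obtain N where N: "\<And>m n. m \<ge> N \<Longrightarrow> n \<ge> N \<Longrightarrow>
        sqrt (shifted l (\<lambda>x. us m x - us n x) (\<lambda>x. us m x - us n x)) < e * sqrt \<delta>"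
      using shifted_cauchy[of "e * sqrt \<delta>"] \<delta> by auto
    have "l2_norm M (\<lambda>x. us m x - us n x) < e" if "m \<ge> N" "n \<ge> N" for m n
    proof (rule le_less_trans[OF norm_le])
      show "(\<lambda>x. us m x - us n x) \<in> D" by (intro D_diff us)
      show "sqrt (shifted l (\<lambda>x. us m x - us n x) (\<lambda>x. us m x - us n x)) / sqrt \<delta> < e"
        using N[OF that] \<delta> by (simp add: pos_divide_less_eq)
    qed
    then show "\<exists>N. \<forall>m\<ge>N. \<forall>n\<ge>N. l2_norm M (\<lambda>x. us m x - us n x) < e" by blast
  qed (intro D_l2 us)
  then obtain u where u: "u \<in> l2_space M" and lim: "(\<lambda>n. l2_norm M (\<lambda>x. us n x - u x)) \<longlonglongrightarrow> 0" by blast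
  have fc: "form_converges M D Q us u"
    unfolding form_converges_def
  proof (intro conjI allI impI us u lim)
    fix e :: real assume e: "e > 0"
    \<comment> \<open>\<open>Q\<close> is the shifted form plus \<open>l\<close> times the squared
      norm, and that norm is at most the shifted form divided by \<open>\<delta>\<close>; hence
      \<open>\<bar>Q\<bar>\<close> is at most \<open>c\<close> times the shifted form.\<close>
    define c where "c = 1 + \<bar>l\<bar> / \<delta>"
    have c: "c > 0" using \<delta> by (simp add: c_def add_pos_nonneg)
    obtain N where N: "\<And>m n. m \<ge> N \<Longrightarrow> n \<ge> N \<Longrightarrow>
        sqrt (shifted l (\<lambda>x. us m x - us n x) (\<lambda>x. us m x - us n x)) < sqrt (e / c)"
      using shifted_cauchy[of "sqrt (e / c)"] e c by auto
    have "\<bar>Q (\<lambda>x. us m x - us n x) (\<lambda>x. us m x - us n x)\<bar> < e" if mn: "m \<ge> N" "n \<ge> N" for m n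
    proof -
      let ?w = "\<lambda>x. us m x - us n x"
      have w: "?w \<in> D" by (intro D_diff us)
      have s: "0 \<le> shifted l ?w ?w" "shifted l ?w ?w < e / c"
        using N[OF mn] shifted_nonneg[OF w] l by auto
      have "l2_inner M ?w ?w \<le> shifted l ?w ?w / \<delta>"
        using shifted_coercive[OF w, of l] \<delta> by (simp add: \<delta>_def field_simps)
      then have "\<bar>l\<bar> * l2_inner M ?w ?w \<le> \<bar>l\<bar> * (shifted l ?w ?w / \<delta>)" by (intro mult_left_mono) auto
      moreover have "Q ?w ?w = shifted l ?w ?w + l * l2_inner M ?w ?w" by (simp add: shifted_def)
      moreover have "\<bar>l * l2_inner M ?w ?w\<bar> = \<bar>l\<bar> * l2_inner M ?w ?w"
        by (simp add: abs_mult l2_inner_self_nonneg)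
      ultimately have "\<bar>Q ?w ?w\<bar> \<le> shifted l ?w ?w * c"
        using s(1) by (simp add: c_def algebra_simps)
      also have "\<dots> < e" using s c by (simp add: pos_less_divide_eq)
      finally show ?thesis .
    qed
    then show "\<exists>N. \<forall>m\<ge>N. \<forall>n\<ge>N. \<bar>Q (\<lambda>x. us m x - us n x) (\<lambda>x. us m x - us n x)\<bar> < e" by blast
  qed
  have "closure_form M D Q u v = l2_inner M (\<lambda>x. g x + l * u x) v" if v: "v \<in> closure_dom M D Q" for v
  proof -
    obtain vs where vs: "form_converges M D Q vs v" using v by (rule closure_domE)
    note vsD = form_converges_D[OF vs]
    have inner_gv: "(\<lambda>n. l2_inner M g (vs n)) \<longlonglongrightarrow> l2_inner M g v"
    proof (rule l2_inner_tendsto)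
      show "(\<lambda>n. l2_norm M (\<lambda>x. g x - g x)) \<longlonglongrightarrow> 0" by (simp add: l2_norm_def l2_inner_def)
    qed (use vs g in \<open>auto intro: D_l2 vsD form_converges_l2 form_converges_tendsto\<close>)
    have "(\<lambda>n. shifted l (vs n) (vs n)) \<longlonglongrightarrow> closure_form M D Q v v - l * l2_inner M v v"
      unfolding shifted_def
      by (intro tendsto_diff tendsto_mult_left closure_form_tendsto form_converges_inner_tendsto vs)
    \<comment> \<open>In \<open>near'\<close> with \<open>v = vs n\<close> the second factor
      converges, so the first one drives the error to zero and the limit solves the equation
      exactly.\<close>
    then have "(\<lambda>n. sqrt (1 / real (Suc n)) * sqrt (shifted l (vs n) (vs n))) \<longlonglongrightarrow>
        0 * sqrt (closure_form M D Q v v - l * l2_inner M v v)"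
      by (intro tendsto_mult inv0 tendsto_real_sqrt)
    then have null: "(\<lambda>n. sqrt (1 / real (Suc n)) * sqrt (shifted l (vs n) (vs n))) \<longlonglongrightarrow> 0" by simp
    have "(\<lambda>n. shifted l (us n) (vs n) - l2_inner M g (vs n)) \<longlonglongrightarrow> 0"
      by (rule Lim_null_comparison[OF _ null]) (use near'[OF vsD] in simp)
    moreover have "(\<lambda>n. shifted l (us n) (vs n) - l2_inner M g (vs n)) \<longlonglongrightarrow>
        closure_form M D Q u v - l * l2_inner M u v - l2_inner M g v"
      unfolding shifted_def
      by (intro tendsto_diff tendsto_mult_left closure_form_tendsto form_converges_inner_tendsto fc vs inner_gv)
    ultimately have "closure_form M D Q u v - l * l2_inner M u v - l2_inner M g v = 0"
      using LIMSEQ_unique by blast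
    then show ?thesis
      using l2_inner_lincomb_left[OF g u closure_dom_l2[OF v], of 1 l] by simp
  qed
  moreover have "u \<in> closure_dom M D Q" using fc by (auto simp: closure_dom_def)
  moreover have "(\<lambda>x. g x + l * u x) \<in> l2_space M" using l2_space_lincomb[OF g u, of 1 l] by simp
  ultimately have "(u, \<lambda>x. g x + l * u x) \<in> form_operator M D Q" by (simp add: form_operator_def)
  then show ?thesis by blast
qed

text \<open>The operator equation tested with \<open>u\<close> itself. For \<open>l < l0\<close> it
  yields injectivity and, by Cauchy-Schwarz, the resolvent bound
  \<open>1 / (l0 - l)\<close>.\<close>

lemma form_operator_coercive:
  assumes "(u, f) \<in> form_operator M D Q"
  shows "(l0 - l) * l2_inner M u u \<le> l2_inner M (\<lambda>x. f x - l * u x) u"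
proof -
  have u: "u \<in> closure_dom M D Q" and f: "f \<in> l2_space M" and eq: "closure_form M D Q u u = l2_inner M f u"
    using assms by (auto simp: form_operator_def)
  have "l2_inner M (\<lambda>x. f x - l * u x) u = l2_inner M f u - l * l2_inner M u u"
    using l2_inner_lincomb_left[OF f closure_dom_l2[OF u] closure_dom_l2[OF u], of 1 "- l"] by simp
  then show ?thesis using closure_form_lower[OF u] eq by (simp add: algebra_simps)
qed

lemma resolvent_set_below:
  assumes l: "l < l0"
  shows "l \<in> resolvent_set M (form_operator M D Q)"
proof -
  have l2: "u \<in> l2_space M" "f \<in> l2_space M" if "(u, f) \<in> form_operator M D Q" for u f
    using that by (auto simp: form_operator_def closure_dom_l2)
  have "AE x in M. u x = 0" if uf: "(u, f) \<in> form_operator M D Q" and "AE x in M. f x - l * u x = 0" for u f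
  proof -
    have "l2_inner M (\<lambda>x. f x - l * u x) u = 0"
      unfolding l2_inner_def by (rule integral_eq_zero_AE) (use that(2) in auto)
    then have "l2_inner M u u \<le> 0"
      using form_operator_coercive[OF uf, of l] l by (simp add: mult_le_0_iff)
    then have "l2_inner M u u = 0" using l2_inner_self_nonneg[of M u] by simp
    then show ?thesis
      using integral_nonneg_eq_0_iff_AE[OF l2_space_integrable_mult[OF l2(1)[OF uf] l2(1)[OF uf]]]
      by (simp add: l2_inner_def)
  qed
  moreover have "l2_norm M u \<le> 1 / (l0 - l) * l2_norm M (\<lambda>x. f x - l * u x)"
    if uf: "(u, f) \<in> form_operator M D Q" for u f
  proof (cases "l2_norm M u = 0")
    case True
    then show ?thesis using l by (simp add: l2_norm_nonneg)
  next
    case False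
    have fu: "(\<lambda>x. f x - l * u x) \<in> l2_space M" using l2_space_lincomb[OF l2(2,1)[OF uf], of 1 "- l"] by simp
    have "(l0 - l) * l2_norm M u * l2_norm M u \<le> l2_norm M (\<lambda>x. f x - l * u x) * l2_norm M u"
      using form_operator_coercive[OF uf, of l] l2_Cauchy_Schwarz[OF fu l2(1)[OF uf]]
      by (simp add: l2_norm_square[symmetric] power2_eq_square mult.assoc)
    then have "(l0 - l) * l2_norm M u \<le> l2_norm M (\<lambda>x. f x - l * u x)"
      using False l2_norm_nonneg[of M u] by simp
    then show ?thesis using l by (simp add: field_simps)
  qed
  moreover have "\<exists>u f. (u, f) \<in> form_operator M D Q \<and> (AE x in M. f x - l * u x = g x)"
    if g: "g \<in> l2_space M" for g
  proof -
    obtain u where "(u, \<lambda>x. g x + l * u x) \<in> form_operator M D Q"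
      using resolvent_equation_solvable[OF l g] by blast
    then show ?thesis by (intro exI[of _ u] exI[of _ "\<lambda>x. g x + l * u x"]) simp
  qed
  ultimately show ?thesis unfolding resolvent_set_def by blast
qed

text \<open>Cauchy-Schwarz at the borderline \<open>l0\<close>, where the shifted form is only a
  seminorm; it passes to the limit in \<open>u\<close> while \<open>v\<close> stays in the
  core.\<close>

lemma closure_form_Cauchy_Schwarz:
  assumes u: "u \<in> closure_dom M D Q" and v: "v \<in> D"
  shows "(closure_form M D Q u v - l0 * l2_inner M u v)\<^sup>2
    \<le> (closure_form M D Q u u - l0 * l2_inner M u u) * (Q v v - l0 * l2_inner M v v)"
proof -
  obtain us where us: "form_converges M D Q us u" using u by (rule closure_domE)
  note vc = form_converges_const[OF v]
  have "(\<lambda>n. (shifted l0 (us n) v)\<^sup>2) \<longlonglongrightarrow> (closure_form M D Q u v - l0 * l2_inner M u v)\<^sup>2"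
    unfolding shifted_def
    by (intro tendsto_power tendsto_diff tendsto_mult_left closure_form_tendsto[OF us vc]
        form_converges_inner_tendsto[OF us vc])
  moreover have "(\<lambda>n. shifted l0 (us n) (us n) * shifted l0 v v) \<longlonglongrightarrow>
      (closure_form M D Q u u - l0 * l2_inner M u u) * shifted l0 v v"
    unfolding shifted_def
    by (intro tendsto_mult_right tendsto_diff tendsto_mult_left closure_form_tendsto[OF us us]
        form_converges_inner_tendsto[OF us us])
  ultimately have "(closure_form M D Q u v - l0 * l2_inner M u v)\<^sup>2
      \<le> (closure_form M D Q u u - l0 * l2_inner M u u) * shifted l0 v v"
    by (rule LIMSEQ_le) (auto intro!: shifted_Cauchy_Schwarz form_converges_D[OF us] v)
  then show ?thesis by (simp add: shifted_def)
qed

text \<open>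
  If \<open>l0\<close> were in the resolvent set, then testing the solution \<open>u\<close> of \<open>(H - l0) u = v\<close> against \<open>v\<close> itself
  would bound the Rayleigh quotient of \<open>v\<close> away from \<open>l0\<close>.
\<close>

lemma lower_bound_in_spectrum: "l0 \<in> spectrum M (form_operator M D Q)"
proof -
  have "l0 \<notin> resolvent_set M (form_operator M D Q)"
  proof
    assume "l0 \<in> resolvent_set M (form_operator M D Q)"
    then obtain C where surj: "\<And>g. g \<in> l2_space M \<Longrightarrow> \<exists>u f. (u, f) \<in> form_operator M D Q \<and> (AE x in M. f x - l0 * u x = g x)"
      and C: "\<And>u f. (u, f) \<in> form_operator M D Q \<Longrightarrow> l2_norm M u \<le> C * l2_norm M (\<lambda>x. f x - l0 * u x)"
      unfolding resolvent_set_def by blast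
    \<comment> \<open>\<open>C\<close> may be zero or negative; \<open>c\<close> is positive and
      still an upper bound.\<close>
    define c where "c = \<bar>C\<bar> + 1"
    have c: "c > 0" by (simp add: c_def)
    \<comment> \<open>The tolerance \<open>1 / c\<close> is the one that closes the final chain, in
      which \<open>c * l2_inner M v v\<close> times the excess of \<open>Q v v\<close> falls
      strictly below the square of \<open>l2_inner M v v\<close>.\<close>
    obtain v where v: "v \<in> D" "0 < l2_inner M v v" "Q v v < (l0 + 1 / c) * l2_inner M v v"
      using sharp[of "1 / c"] c by auto
    obtain u f where uf: "(u, f) \<in> form_operator M D Q" and ae: "AE x in M. f x - l0 * u x = v x"
      using surj[OF D_l2[OF v(1)]] by blast
    have u: "u \<in> closure_dom M D Q" and f: "f \<in> l2_space M"
      using uf by (auto simp: form_operator_def)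
    have ul2: "u \<in> l2_space M" using u by (rule closure_dom_l2)
    have vd: "v \<in> closure_dom M D Q" using form_converges_const[OF v(1)] by (auto simp: closure_dom_def)
    have fu: "(\<lambda>x. f x - l0 * u x) \<in> l2_space M" using l2_space_lincomb[OF f ul2, of 1 "- l0"] by simp
    have eq: "closure_form M D Q u h - l0 * l2_inner M u h = l2_inner M v h" if h: "h \<in> closure_dom M D Q" for h
    proof -
      have "closure_form M D Q u h = l2_inner M f h" using uf h by (simp add: form_operator_def)
      moreover have "l2_inner M (\<lambda>x. f x - l0 * u x) h = l2_inner M f h - l0 * l2_inner M u h"
        using l2_inner_lincomb_left[OF f ul2 closure_dom_l2[OF h], of 1 "- l0"] by simp
      moreover have "l2_inner M (\<lambda>x. f x - l0 * u x) h = l2_inner M v h"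
        unfolding l2_inner_def
      proof (rule integral_cong_AE)
        show "AE x in M. (f x - l0 * u x) * h x = v x * h x" using ae by eventually_elim simp
      qed (intro borel_measurable_times l2_space_borel fu D_l2 v closure_dom_l2 h)+
      ultimately show ?thesis by simp
    qed
    have n_eq: "l2_norm M (\<lambda>x. f x - l0 * u x) = l2_norm M v"
      unfolding l2_norm_def l2_inner_def
    proof (rule arg_cong[where f = sqrt], rule integral_cong_AE)
      show "AE x in M. (f x - l0 * u x) * (f x - l0 * u x) = v x * v x" using ae by eventually_elim simp
    qed (intro borel_measurable_times l2_space_borel fu D_l2 v)+
    have nv: "l2_norm M v > 0" using v(2) by (simp add: l2_norm_def)
    have "l2_norm M u \<le> C * l2_norm M v" using C[OF uf] n_eq by simp
    also have "\<dots> \<le> c * l2_norm M v" using nv by (simp add: c_def)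
    finally have nu: "l2_norm M u \<le> c * l2_norm M v" .
    have "l2_inner M v u \<le> l2_norm M v * l2_norm M u"
      using l2_Cauchy_Schwarz[OF D_l2[OF v(1)] ul2] by simp
    also have "\<dots> \<le> l2_norm M v * (c * l2_norm M v)" using nu nv by simp
    finally have vu: "l2_inner M v u \<le> c * l2_inner M v v"
      by (simp add: l2_norm_square[symmetric] power2_eq_square algebra_simps)
    \<comment> \<open>By \<open>eq\<close>, the closed shifted form equals
      \<open>l2_inner M v v\<close> on the pair \<open>u\<close>, \<open>v\<close> and
      \<open>l2_inner M v u\<close> on the pair \<open>u\<close>, \<open>u\<close>.\<close>
    have "(l2_inner M v v)\<^sup>2 \<le> l2_inner M v u * (Q v v - l0 * l2_inner M v v)"
      using closure_form_Cauchy_Schwarz[OF u v(1)] by (simp add: eq u vd)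
    also have "\<dots> \<le> c * l2_inner M v v * (Q v v - l0 * l2_inner M v v)"
      using lower[OF v(1)] by (intro mult_right_mono vu) simp
    also have "\<dots> < c * l2_inner M v v * (1 / c * l2_inner M v v)"
      using v c by (intro mult_strict_left_mono) (auto simp: algebra_simps)
    also have "\<dots> = (l2_inner M v v)\<^sup>2" using c by (simp add: power2_eq_square)
    finally show False by simp
  qed
  then show ?thesis by (simp add: spectrum_def)
qed

theorem inf_spectrum_form_operator: "inf_spectrum M (form_operator M D Q) = ereal l0"
  unfolding inf_spectrum_def
proof (rule antisym)
  show "(INF l\<in>spectrum M (form_operator M D Q). ereal l) \<le> ereal l0"
    by (intro INF_lower lower_bound_in_spectrum)
  show "ereal l0 \<le> (INF l\<in>spectrum M (form_operator M D Q). ereal l)"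
  proof (rule INF_greatest)
    fix l assume "l \<in> spectrum M (form_operator M D Q)"
    then show "ereal l0 \<le> ereal l"
      using resolvent_set_below[of l] by (cases "l < l0") (auto simp: spectrum_def)
  qed
qed

end

section \<open>Test functions on the line\<close>

lemma C1_differentiable_onD:
  fixes f :: "real \<Rightarrow> real"
  assumes "f C1_differentiable_on UNIV"
  shows "(f has_real_derivative deriv f x) (at x)" "continuous_on UNIV (deriv f)"
proof -
  obtain D where D: "\<And>x. (f has_vector_derivative D x) (at x)" "continuous_on UNIV D"
    using assms by (auto simp: C1_differentiable_on_def)
  have deriv: "(f has_real_derivative D x) (at x)" for x
    using D(1) by (simp add: has_real_derivative_iff_has_vector_derivative)
  then have "deriv f = D" by (auto intro: DERIV_imp_deriv)
  then show "(f has_real_derivative deriv f x) (at x)" "continuous_on UNIV (deriv f)"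
    using deriv D(2) by simp_all
qed

lemma C1_compact_supportD:
  assumes "f \<in> C1_compact_support"
  shows "(f has_real_derivative deriv f x) (at x)"
    and "continuous_on UNIV (deriv f)"
    and "\<exists>R>0. \<forall>x. R \<le> \<bar>x\<bar> \<longrightarrow> f x = 0 \<and> deriv f x = 0"
proof -
  have C1: "f C1_differentiable_on UNIV" and K: "compact (closure {x. f x \<noteq> 0})"
    using assms by (auto simp: C1_compact_support_def)
  note deriv = C1_differentiable_onD[OF C1]
  show "(f has_real_derivative deriv f x) (at x)" "continuous_on UNIV (deriv f)"
    by (rule deriv)+
  have "bounded {x. f x \<noteq> 0}"
    using compact_imp_bounded[OF K] bounded_subset closure_subset by blast
  then obtain R where R: "\<And>x. f x \<noteq> 0 \<Longrightarrow> \<bar>x\<bar> \<le> R"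
    by (auto simp: bounded_iff)
  \<comment> \<open>The margin 1 keeps \<open>x\<close> off the closed ball, so \<open>f\<close>
    vanishes on a neighbourhood of \<open>x\<close> and the derivative vanishes too.\<close>
  have "f x = 0 \<and> deriv f x = 0" if "\<bar>R\<bar> + 1 \<le> \<bar>x\<bar>" for x
  proof
    show "f x = 0" using R[of x] that by linarith
    have "((\<lambda>_. 0) has_real_derivative deriv f x) (at x)"
    proof (rule has_field_derivative_transform_within_open)
      show "(f has_real_derivative deriv f x) (at x)" by (rule deriv)
      show "open (- cball 0 \<bar>R\<bar>)" by (simp add: open_Compl)
      show "x \<in> - cball 0 \<bar>R\<bar>" using that by simp
      show "f y = 0" if "y \<in> - cball 0 \<bar>R\<bar>" for y using R[of y] that by fastforce
    qed
    then show "deriv f x = 0" using DERIV_unique DERIV_const by blast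
  qed
  then show "\<exists>R>0. \<forall>x. R \<le> \<bar>x\<bar> \<longrightarrow> f x = 0 \<and> deriv f x = 0"
    by (intro exI[of _ "\<bar>R\<bar> + 1"]) auto
qed

lemma C1_compact_supportI:
  fixes f :: "real \<Rightarrow> real"
  assumes "\<And>x. (f has_real_derivative f' x) (at x)" "continuous_on UNIV f'"
    and "\<And>x. R \<le> \<bar>x\<bar> \<Longrightarrow> f x = 0"
  shows "f \<in> C1_compact_support"
proof -
  have "f C1_differentiable_on UNIV"
    using assms(1,2) unfolding C1_differentiable_on_def has_real_derivative_iff_has_vector_derivative by blast
  moreover have "bounded {x. f x \<noteq> 0}"
    unfolding bounded_iff using assms(3) by (intro exI[of _ R]) (auto, meson linear)
  ultimately show ?thesis by (simp add: C1_compact_support_def)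
qed

lemma C1_compact_support_continuous: "f \<in> C1_compact_support \<Longrightarrow> continuous_on S f"
  using C1_compact_supportD(1) by (meson DERIV_isCont continuous_at_imp_continuous_on)

text \<open>The class in which the integrands live: closed under multiplication by continuous
  weights and contained in the integrable functions, so supports seldom have to be tracked.\<close>

definition Cc :: "(real \<Rightarrow> real) set" where
  "Cc = {f. continuous_on UNIV f \<and> (\<exists>R. \<forall>x. R \<le> \<bar>x\<bar> \<longrightarrow> f x = 0)}"

lemma CcI: "continuous_on UNIV f \<Longrightarrow> (\<And>x. R \<le> \<bar>x\<bar> \<Longrightarrow> f x = 0) \<Longrightarrow> f \<in> Cc"
  by (auto simp: Cc_def)

lemma Cc_continuous: "f \<in> Cc \<Longrightarrow> continuous_on S f"
  by (auto simp: Cc_def intro: continuous_on_subset)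

lemma C1_compact_support_Cc: "f \<in> C1_compact_support \<Longrightarrow> f \<in> Cc"
  using C1_compact_supportD(3)[of f] C1_compact_support_continuous[of f UNIV] by (auto simp: Cc_def)

lemma deriv_Cc: "f \<in> C1_compact_support \<Longrightarrow> deriv f \<in> Cc"
  using C1_compact_supportD(2,3)[of f] by (auto simp: Cc_def)

lemma Cc_mult_left: "continuous_on UNIV g \<Longrightarrow> f \<in> Cc \<Longrightarrow> (\<lambda>x. g x * f x) \<in> Cc"
  by (auto simp: Cc_def intro!: continuous_intros)

lemma Cc_mult_right: "f \<in> Cc \<Longrightarrow> continuous_on UNIV g \<Longrightarrow> (\<lambda>x. f x * g x) \<in> Cc"
  by (auto simp: Cc_def intro!: continuous_intros)

lemma Cc_add:
  assumes "f \<in> Cc" "g \<in> Cc"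
  shows "(\<lambda>x. f x + g x) \<in> Cc"
proof -
  obtain R S where R: "\<And>x. R \<le> \<bar>x\<bar> \<Longrightarrow> f x = 0" and S: "\<And>x. S \<le> \<bar>x\<bar> \<Longrightarrow> g x = 0"
    using assms unfolding Cc_def by blast
  show ?thesis
  proof (rule CcI[of _ "max R S"])
    show "continuous_on UNIV (\<lambda>x. f x + g x)"
      by (intro continuous_on_add Cc_continuous assms)
    show "f x + g x = 0" if "max R S \<le> \<bar>x\<bar>" for x
      using R[of x] S[of x] that by simp
  qed
qed

lemma Cc_diff: "f \<in> Cc \<Longrightarrow> g \<in> Cc \<Longrightarrow> (\<lambda>x. f x - g x) \<in> Cc"
  using Cc_add[of f "\<lambda>x. - 1 * g x"] Cc_mult_left[of "\<lambda>_. - 1" g] by simp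

lemma Cc_borel: "f \<in> Cc \<Longrightarrow> f \<in> borel_measurable borel"
  by (auto simp: Cc_def intro: borel_measurable_continuous_onI)

lemma Cc_integrable:
  assumes "f \<in> Cc"
  shows "integrable lborel f"
proof -
  obtain R where R: "\<And>x. R \<le> \<bar>x\<bar> \<Longrightarrow> f x = 0" using assms by (auto simp: Cc_def)
  have "set_integrable lborel {- R..R} f"
    by (intro borel_integrable_atLeastAtMost' Cc_continuous assms)
  then have "integrable lborel (\<lambda>x. indicator {- R..R} x *\<^sub>R f x)" by (simp add: set_integrable_def)
  also have "(\<lambda>x. indicator {- R..R} x *\<^sub>R f x) = f"
  proof
    fix x show "indicator {- R..R} x *\<^sub>R f x = f x"
      using R[of x] by (cases "R \<le> \<bar>x\<bar>") (auto simp: indicator_def)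
  qed
  finally show ?thesis .
qed

lemma integral_deriv_Cc:
  fixes F f :: "real \<Rightarrow> real"
  assumes "\<And>x. (F has_real_derivative f x) (at x)" "continuous_on UNIV f"
    and R: "\<And>x. R \<le> \<bar>x\<bar> \<Longrightarrow> F x = 0 \<and> f x = 0"
  shows "integrable lborel f" "(\<integral>x. f x \<partial>lborel) = 0"
proof -
  \<comment> \<open>\<open>R\<close> may be negative, but the interval \<open>{- r..r}\<close> needs
    its endpoints in order.\<close>
  define r where "r = \<bar>R\<bar>"
  show "integrable lborel f" by (intro Cc_integrable CcI[of _ R]) (use assms in auto)
  have "(\<integral>x. f x * indicator {- r..r} x \<partial>lborel) = F r - F (- r)"
    using assms(1,2) by (intro integral_FTC_Icc_real) (auto simp: r_def continuous_on_eq_continuous_at)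
  also have "(\<lambda>x. f x * indicator {- r..r} x) = f"
  proof
    fix x show "f x * indicator {- r..r} x = f x"
      using R[of x] by (cases "R \<le> \<bar>x\<bar>") (auto simp: indicator_def r_def)
  qed
  also have "F r - F (- r) = 0" using R[of r] R[of "- r"] by (simp add: r_def)
  finally show "(\<integral>x. f x \<partial>lborel) = 0" .
qed

lemma integration_by_parts_Cc:
  fixes F G :: "real \<Rightarrow> real"
  assumes F: "\<And>x. (F has_real_derivative f x) (at x)" "continuous_on UNIV f"
    and G: "\<And>x. (G has_real_derivative g x) (at x)" "continuous_on UNIV g"
    and supp: "\<And>x. R \<le> \<bar>x\<bar> \<Longrightarrow> F x = 0 \<and> f x = 0"
  shows "(\<integral>x. f x * G x \<partial>lborel) = - (\<integral>x. F x * g x \<partial>lborel)"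
proof -
  have c: "continuous_on UNIV F" "continuous_on UNIV G"
    using F(1) G(1) by (meson DERIV_isCont continuous_at_imp_continuous_on)+
  have i: "integrable lborel (\<lambda>x. f x * G x)" "integrable lborel (\<lambda>x. F x * g x)"
    by (intro Cc_integrable Cc_mult_right CcI[of _ R] c assms; use supp in auto)+
  have "(\<integral>x. f x * G x + F x * g x \<partial>lborel) = 0"
  proof (rule integral_deriv_Cc(2))
    show "((\<lambda>x. F x * G x) has_real_derivative f x * G x + F x * g x) (at x)" for x
      using DERIV_mult[OF F(1) G(1), of x] by (simp add: algebra_simps)
    show "continuous_on UNIV (\<lambda>x. f x * G x + F x * g x)" by (intro continuous_intros assms c)
    show "F x * G x = 0 \<and> f x * G x + F x * g x = 0" if "R \<le> \<bar>x\<bar>" for x using supp[OF that] by simp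
  qed
  then show ?thesis using i by simp
qed

lemma C1_compact_support_lincomb:
  assumes "f \<in> C1_compact_support" "g \<in> C1_compact_support"
  shows "(\<lambda>x. s * f x + t * g x) \<in> C1_compact_support"
    and "deriv (\<lambda>x. s * f x + t * g x) = (\<lambda>x. s * deriv f x + t * deriv g x)"
proof -
  have d: "((\<lambda>x. s * f x + t * g x) has_real_derivative s * deriv f x + t * deriv g x) (at x)" for x
    by (intro DERIV_add DERIV_cmult C1_compact_supportD assms)
  then show "deriv (\<lambda>x. s * f x + t * g x) = (\<lambda>x. s * deriv f x + t * deriv g x)"
    by (auto intro: DERIV_imp_deriv)
  obtain R S where R: "\<And>x. R \<le> \<bar>x\<bar> \<Longrightarrow> f x = 0" and S: "\<And>x. S \<le> \<bar>x\<bar> \<Longrightarrow> g x = 0"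
    using C1_compact_supportD(3)[OF assms(1)] C1_compact_supportD(3)[OF assms(2)] by blast
  show "(\<lambda>x. s * f x + t * g x) \<in> C1_compact_support"
  proof (rule C1_compact_supportI[OF d, of "max R S"])
    show "continuous_on UNIV (\<lambda>x. s * deriv f x + t * deriv g x)"
      by (intro continuous_intros C1_compact_supportD assms)
    show "s * f x + t * g x = 0" if "max R S \<le> \<bar>x\<bar>" for x
      using R[of x] S[of x] that by simp
  qed
qed

section \<open>Antiderivatives and C1 approximation\<close>

lemma continuous_antiderivative:
  fixes f :: "real \<Rightarrow> real"
  assumes "continuous_on UNIV f"
  shows "\<exists>F. \<forall>x. (F has_real_derivative f x) (at x)"
proof -
  have int: "f integrable_on {u..v}" for u v
    using assms continuous_on_subset by (intro integrable_continuous_real) blast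
  \<comment> \<open>The oriented integral from 0 to \<open>x\<close>: at most one of the two terms
    is over a nondegenerate interval.\<close>
  define F where "F x = integral {0..x} f - integral {x..0} f" for x
  have "(F has_real_derivative f x) (at x)" for x
  proof -
    \<comment> \<open>A base point to the left of both 0 and \<open>x\<close>. Near \<open>x\<close>
      the function \<open>F\<close> is then an indefinite integral from \<open>b\<close> up to a
      constant.\<close>
    define b where "b = min 0 x - 1"
    have "F y = integral {b..y} f - integral {b..0} f" if "y \<ge> b" for y
    proof (cases "y \<ge> 0")
      case True
      then have "integral {b..0} f + integral {0..y} f = integral {b..y} f"
        by (intro Henstock_Kurzweil_Integration.integral_combine int) (auto simp: b_def)
      moreover have "integral {y..0} f = 0" using True by (cases "y = 0") auto
      ultimately show ?thesis by (simp add: F_def)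
    next
      case False
      then have "integral {b..y} f + integral {y..0} f = integral {b..0} f"
        using that by (intro Henstock_Kurzweil_Integration.integral_combine int) auto
      then show ?thesis using False by (simp add: F_def)
    qed
    moreover have "((\<lambda>y. integral {b..y} f - integral {b..0} f) has_real_derivative f x) (at x)"
    proof -
      have "((\<lambda>y. integral {b..y} f) has_real_derivative f x) (at x within {b..x + 1})"
        using assms continuous_on_subset by (intro integral_has_real_derivative) (auto simp: b_def)
      then have "((\<lambda>y. integral {b..y} f) has_real_derivative f x) (at x)"
        using at_within_Icc_at[of b x "x + 1"] by (simp add: b_def)
      from DERIV_diff[OF this DERIV_const] show ?thesis by simp
    qed
    moreover have "x \<in> {b<..}" by (simp add: b_def)
    ultimately show ?thesis
      by (metis (mono_tags, lifting) has_field_derivative_transform_within_open open_greaterThan greaterThan_iff less_imp_le)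
  qed
  then show ?thesis by blast
qed

text \<open>The approximations are the averages of \<open>f\<close> over the intervals \<open>[x, x + h]\<close>.\<close>

lemma Cc_approx_C1:
  assumes f: "f \<in> Cc"
  shows "\<exists>R. \<forall>e>0. \<exists>\<psi>. \<psi> \<in> C1_compact_support \<and> (\<forall>x. \<bar>f x - \<psi> x\<bar> \<le> e) \<and> (\<forall>x. R \<le> \<bar>x\<bar> \<longrightarrow> f x = 0 \<and> \<psi> x = 0)"
proof -
  obtain R where R: "\<And>x. R \<le> \<bar>x\<bar> \<Longrightarrow> f x = 0" using f by (auto simp: Cc_def)
  \<comment> \<open>Averaging over an interval of length at most 1 enlarges the support by at most
    1, whatever the accuracy; hence \<open>R\<close> can be chosen before \<open>e\<close>.\<close>
  define R' where "R' = \<bar>R\<bar> + 1"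
  have "\<exists>\<psi>. \<psi> \<in> C1_compact_support \<and> (\<forall>x. \<bar>f x - \<psi> x\<bar> \<le> e) \<and> (\<forall>x. R' \<le> \<bar>x\<bar> \<longrightarrow> f x = 0 \<and> \<psi> x = 0)"
    if e: "e > 0" for e
  proof -
    have cont: "continuous_on S f" for S using f by (rule Cc_continuous)
    have "uniformly_continuous_on {- R' - 1..R' + 1} f"
      by (intro compact_uniformly_continuous cont compact_Icc)
    then obtain d where d: "d > 0" and unif: "\<And>x y. x \<in> {- R' - 1..R' + 1} \<Longrightarrow> y \<in> {- R' - 1..R' + 1} \<Longrightarrow>
        dist y x < d \<Longrightarrow> dist (f y) (f x) < e"
      unfolding uniformly_continuous_on_def using e by metis
    define h where "h = min (d / 2) 1"
    have h: "h > 0" "h < d" "h \<le> 1" using d by (auto simp: h_def)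
    obtain F where dF: "\<And>x. (F has_real_derivative f x) (at x)"
      using continuous_antiderivative[OF cont] by blast
    define \<psi> where "\<psi> x = (F (x + h) - F x) / h" for x
    have mvt: "\<exists>z. x \<le> z \<and> z \<le> x + h \<and> \<psi> x = f z" for x
    proof -
      obtain z where "x < z" "z < x + h" "F (x + h) - F x = (x + h - x) * f z"
        using MVT2[of x "x + h" F f] dF h by auto
      then show ?thesis using h by (intro exI[of _ z]) (auto simp: \<psi>_def)
    qed
    have d\<psi>: "(\<psi> has_real_derivative (f (x + h) - f x) / h) (at x)" for x
      unfolding \<psi>_def
      by (intro DERIV_cdivide DERIV_diff dF) (use DERIV_shift[of F "f (x + h)" x h] dF in auto)
    have supp: "f x = 0 \<and> \<psi> x = 0" if "R' \<le> \<bar>x\<bar>" for x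
    proof
      show "f x = 0" using R[of x] that by (auto simp: R'_def)
      obtain z where "x \<le> z" "z \<le> x + h" "\<psi> x = f z" using mvt by blast
      moreover have "R \<le> \<bar>z\<bar>" using that calculation h by (auto simp: R'_def abs_if split: if_splits)
      ultimately show "\<psi> x = 0" using R by simp
    qed
    have "\<bar>f x - \<psi> x\<bar> \<le> e" for x
    proof (cases "R' \<le> \<bar>x\<bar>")
      case True
      then show ?thesis using supp e by simp
    next
      case False
      obtain z where z: "x \<le> z" "z \<le> x + h" "\<psi> x = f z" using mvt by blast
      have "dist (f z) (f x) < e"
        using False z h by (intro unif) (auto simp: dist_real_def abs_if split: if_splits)
      then show ?thesis using z by (simp add: dist_real_def abs_minus_commute)
    qed
    moreover have "\<psi> \<in> C1_compact_support"
      by (intro C1_compact_supportI[OF d\<psi>, of R'] continuous_intros continuous_on_compose2[OF cont[of UNIV]] cont) (use supp h in auto)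
    ultimately show ?thesis using supp by blast
  qed
  then show ?thesis by blast
qed

section \<open>Energy forms with two weights\<close>

lemma Cc_l2: "f \<in> Cc \<Longrightarrow> f \<in> l2_space lborel"
  using Cc_integrable[OF Cc_mult_left[of f f]] by (auto simp: l2_space_def Cc_borel Cc_continuous power2_eq_square)

locale weighted_line =
  fixes w v :: "real \<Rightarrow> real"
  assumes w_cont: "continuous_on UNIV w" and v_cont: "continuous_on UNIV v"
    and w_pos: "\<And>x. w x > 0" and v_pos: "\<And>x. v x > 0"
begin

definition \<nu> :: "real measure" where
  "\<nu> = density lborel (\<lambda>x. ennreal (v x))"

definition energy :: "(real \<Rightarrow> real) \<Rightarrow> (real \<Rightarrow> real) \<Rightarrow> real" where
  "energy f g = 1/2 * (\<integral>x. w x * deriv f x * deriv g x \<partial>lborel)"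

lemma inverse_w_cont: "continuous_on S (\<lambda>x. 1 / w x)"
  using w_cont w_pos by (intro continuous_intros) (auto intro: continuous_on_subset simp: less_imp_neq[symmetric])

lemma v_borel [measurable]: "v \<in> borel_measurable borel"
  using v_cont by (rule borel_measurable_continuous_onI)

lemma l2_\<nu>_iff:
  assumes [measurable]: "f \<in> borel_measurable borel"
  shows "f \<in> l2_space \<nu> \<longleftrightarrow> integrable lborel (\<lambda>x. v x * (f x)\<^sup>2)"
  using v_pos by (simp add: l2_space_def \<nu>_def integrable_density less_imp_le)

lemma Cc_l2_\<nu>: "f \<in> Cc \<Longrightarrow> f \<in> l2_space \<nu>"
  by (simp add: l2_\<nu>_iff Cc_borel power2_eq_square)
    (intro Cc_integrable Cc_mult_left Cc_continuous v_cont)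

lemma l2_inner_\<nu>:
  assumes [measurable]: "f \<in> borel_measurable borel" "g \<in> borel_measurable borel"
  shows "l2_inner \<nu> f g = (\<integral>x. v x * (f x * g x) \<partial>lborel)"
  using v_pos by (simp add: l2_inner_def \<nu>_def integral_density less_imp_le)

lemma energy_integrable:
  "f \<in> C1_compact_support \<Longrightarrow> g \<in> C1_compact_support \<Longrightarrow> integrable lborel (\<lambda>x. w x * deriv f x * deriv g x)"
  by (intro Cc_integrable Cc_mult_left deriv_Cc continuous_on_mult w_cont Cc_continuous)

lemma energy_commute: "energy f g = energy g f"
  by (simp add: energy_def mult.assoc mult.left_commute mult.commute)

lemma energy_lincomb:
  assumes "f \<in> C1_compact_support" "g \<in> C1_compact_support" "h \<in> C1_compact_support"
  shows "energy (\<lambda>x. s * f x + t * g x) h = s * energy f h + t * energy g h"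
proof -
  have "(\<integral>x. w x * (s * deriv f x + t * deriv g x) * deriv h x \<partial>lborel)
      = (\<integral>x. s * (w x * deriv f x * deriv h x) + t * (w x * deriv g x * deriv h x) \<partial>lborel)"
    by (intro Bochner_Integration.integral_cong) (auto simp: algebra_simps)
  also have "\<dots> = s * (\<integral>x. w x * deriv f x * deriv h x \<partial>lborel) + t * (\<integral>x. w x * deriv g x * deriv h x \<partial>lborel)"
    using energy_integrable[OF assms(1,3)] energy_integrable[OF assms(2,3)] by simp
  finally show ?thesis
    unfolding energy_def C1_compact_support_lincomb(2)[OF assms(1,2)] by (simp add: algebra_simps)
qed

lemma energy_nonneg: "0 \<le> energy f f"
proof -
  have "0 \<le> w x * deriv f x * deriv f x" for x
    using w_pos[of x] by (simp add: mult.assoc)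
  then show ?thesis by (simp add: energy_def)
qed

text \<open>
  Integration by parts moves the derivative onto a smooth approximation of \<open>w \<phi>'\<close>; the error is
  controlled by the energy bound.
\<close>

lemma energy_weakly_closable:
  assumes us: "\<And>n. us n \<in> C1_compact_support"
    and null: "(\<lambda>n. l2_norm \<nu> (us n)) \<longlonglongrightarrow> 0"
    and K: "\<And>n. energy (us n) (us n) \<le> K"
    and \<phi>: "\<phi> \<in> C1_compact_support"
  shows "(\<lambda>n. energy (us n) \<phi>) \<longlonglongrightarrow> 0"
proof (rule LIMSEQ_I)
  fix e :: real assume e: "e > 0"
  define g where "g x = w x * deriv \<phi> x" for x
  have g: "g \<in> Cc" unfolding g_def by (intro Cc_mult_left w_cont deriv_Cc \<phi>)
  obtain R where R: "\<And>e. e > 0 \<Longrightarrow> \<exists>\<psi>. \<psi> \<in> C1_compact_support \<and> (\<forall>x. \<bar>g x - \<psi> x\<bar> \<le> e)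
      \<and> (\<forall>x. R \<le> \<bar>x\<bar> \<longrightarrow> g x = 0 \<and> \<psi> x = 0)"
    using Cc_approx_C1[OF g] by blast
  \<comment> \<open>The squared norm of the weighted error \<open>r\<close> below is at most
    \<open>\<eta>\<^sup>2 * L\<close>. This needs a support bound common to all approximations,
    since \<open>1 / w\<close> may fail to be integrable on the line.\<close>
  define L where "L = (\<integral>x. indicator {- R..R} x *\<^sub>R (1 / w x) \<partial>lborel)"
  have L_int: "integrable lborel (\<lambda>x. indicator {- R..R} x *\<^sub>R (1 / w x))"
    using borel_integrable_atLeastAtMost'[OF inverse_w_cont] by (simp add: set_integrable_def)
  have L: "L \<ge> 0" unfolding L_def using w_pos by (intro integral_nonneg_AE AE_I2) (auto simp: indicator_def less_imp_le)
  have K0: "K \<ge> 0" using K[of 0] energy_nonneg[of "us 0"] by simp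
  \<comment> \<open>Makes the approximation error \<open>sqrt (2 * K) * (\<eta> * sqrt L)\<close>
    smaller than \<open>e\<close>; the summand 1 also keeps the denominator positive.\<close>
  define \<eta> where "\<eta> = e / (1 + sqrt (2 * K) * sqrt L)"
  have pos: "1 + sqrt (2 * K) * sqrt L > 0" using K0 L by (simp add: add_pos_nonneg)
  then have \<eta>: "\<eta> > 0" using e by (simp add: \<eta>_def)
  obtain \<psi> where \<psi>: "\<psi> \<in> C1_compact_support" "\<And>x. \<bar>g x - \<psi> x\<bar> \<le> \<eta>"
      "\<And>x. R \<le> \<bar>x\<bar> \<Longrightarrow> g x = 0 \<and> \<psi> x = 0"
    using R[OF \<eta>] by blast
  \<comment> \<open>The factor \<open>sqrt (w x)\<close> is moved to the other side:
    \<open>k = sqrt w * deriv (us n)\<close> has its norm bounded by the energy, and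
    \<open>k * r\<close> is \<open>deriv (us n)\<close> times the error
    \<open>g - \<psi>\<close>.\<close>
  define r where "r x = 1 / sqrt (w x) * (g x - \<psi> x)" for x
  have sqrt_w: "continuous_on UNIV (\<lambda>x. sqrt (w x))" "continuous_on UNIV (\<lambda>x. 1 / sqrt (w x))"
    using w_pos by (intro continuous_intros w_cont; simp add: less_imp_neq[symmetric])+
  have r: "r \<in> Cc" unfolding r_def by (intro Cc_mult_left sqrt_w Cc_diff g C1_compact_support_Cc \<psi>)
  have r_norm: "l2_norm lborel r \<le> \<eta> * sqrt L"
  proof (rule power2_le_imp_le)
    have "(l2_norm lborel r)\<^sup>2 = (\<integral>x. r x * r x \<partial>lborel)" by (simp add: l2_norm_square l2_inner_def)
    also have "\<dots> \<le> (\<integral>x. \<eta>\<^sup>2 * (indicator {- R..R} x *\<^sub>R (1 / w x)) \<partial>lborel)"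
    proof (rule integral_mono)
      show "integrable lborel (\<lambda>x. r x * r x)" by (intro Cc_integrable Cc_mult_left Cc_continuous r)
      show "integrable lborel (\<lambda>x. \<eta>\<^sup>2 * (indicator {- R..R} x *\<^sub>R (1 / w x)))"
        using L_int by (rule integrable_mult_right)
      fix x
      show "r x * r x \<le> \<eta>\<^sup>2 * (indicator {- R..R} x *\<^sub>R (1 / w x))"
      proof (cases "x \<in> {- R..R}")
        case True
        have "r x * r x = (g x - \<psi> x)\<^sup>2 / w x"
          using w_pos[of x] by (simp add: r_def power2_eq_square field_simps)
        also have "\<dots> \<le> \<eta>\<^sup>2 / w x"
          using \<psi>(2)[of x] \<eta> w_pos[of x] by (intro divide_right_mono) (auto simp: abs_le_square_iff[symmetric])
        finally show ?thesis using True by simp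
      next
        case False
        then have "g x = 0 \<and> \<psi> x = 0" using \<psi>(3)[of x] by auto
        then show ?thesis using False by (simp add: r_def)
      qed
    qed
    also have "\<dots> = (\<eta> * sqrt L)\<^sup>2"
      unfolding integral_mult_right_zero L_def[symmetric] using L by (simp add: power_mult_distrib)
    finally show "(l2_norm lborel r)\<^sup>2 \<le> (\<eta> * sqrt L)\<^sup>2" .
  qed (use \<eta> L in simp)
  \<comment> \<open>Division by \<open>v\<close> turns the integral of
    \<open>us n * deriv \<psi>\<close> into an inner product with respect to \<open>\<nu>\<close>,
    where \<open>us n\<close> tends to zero.\<close>
  define \<theta> where "\<theta> x = 1 / v x * deriv \<psi> x" for x
  have \<theta>: "\<theta> \<in> Cc" unfolding \<theta>_def
    by (intro Cc_mult_left deriv_Cc \<psi> continuous_intros v_cont) (use v_pos in \<open>simp add: less_imp_neq[symmetric]\<close>)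
  have key: "\<bar>2 * energy (us n) \<phi>\<bar> \<le> sqrt (2 * K) * (\<eta> * sqrt L) + l2_norm \<nu> (us n) * l2_norm \<nu> \<theta>" for n
  proof -
    define k where "k x = sqrt (w x) * deriv (us n) x" for x
    have k: "k \<in> Cc" unfolding k_def by (intro Cc_mult_left sqrt_w deriv_Cc us)
    have "(l2_norm lborel k)\<^sup>2 = 2 * energy (us n) (us n)"
      using w_pos by (simp add: l2_norm_square l2_inner_def k_def energy_def mult.assoc mult.left_commute less_imp_le
          flip: mult.assoc)
    then have "(l2_norm lborel k)\<^sup>2 \<le> 2 * K" using K[of n] by simp
    then have k_norm: "l2_norm lborel k \<le> sqrt (2 * K)" by (rule real_le_rsqrt)
    have "k x * r x = w x * deriv (us n) x * deriv \<phi> x - deriv (us n) x * \<psi> x" for x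
      using w_pos[of x] by (simp add: k_def r_def g_def field_simps)
    then have "l2_inner lborel k r = (\<integral>x. w x * deriv (us n) x * deriv \<phi> x - deriv (us n) x * \<psi> x \<partial>lborel)"
      by (simp add: l2_inner_def)
    also have "\<dots> = 2 * energy (us n) \<phi> - (\<integral>x. deriv (us n) x * \<psi> x \<partial>lborel)"
      using energy_integrable[OF us \<phi>, of n]
        Cc_integrable[OF Cc_mult_right[OF deriv_Cc[OF us[of n]] C1_compact_support_continuous[OF \<psi>(1)]]]
      by (simp add: energy_def)
    also have "(\<integral>x. deriv (us n) x * \<psi> x \<partial>lborel) = - (\<integral>x. us n x * deriv \<psi> x \<partial>lborel)"
      using C1_compact_supportD(3)[OF us[of n]] by (elim exE conjE)
        (rule integration_by_parts_Cc, auto intro: C1_compact_supportD us \<psi>)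
    also have "(\<integral>x. us n x * deriv \<psi> x \<partial>lborel) = l2_inner \<nu> (us n) \<theta>"
    proof -
      have eq: "(\<lambda>x. us n x * deriv \<psi> x) = (\<lambda>x. v x * (us n x * \<theta> x))"
        using v_pos by (simp add: fun_eq_iff \<theta>_def less_imp_neq[symmetric])
      show ?thesis
        unfolding l2_inner_\<nu>[OF Cc_borel[OF C1_compact_support_Cc[OF us]] Cc_borel[OF \<theta>]] eq ..
    qed
    finally have "2 * energy (us n) \<phi> = l2_inner lborel k r - l2_inner \<nu> (us n) \<theta>" by simp
    moreover have "\<bar>l2_inner lborel k r\<bar> \<le> sqrt (2 * K) * (\<eta> * sqrt L)"
      using l2_Cauchy_Schwarz[OF Cc_l2[OF k] Cc_l2[OF r]] mult_mono[OF k_norm r_norm] K0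
      by (simp add: l2_norm_nonneg)
    moreover have "\<bar>l2_inner \<nu> (us n) \<theta>\<bar> \<le> l2_norm \<nu> (us n) * l2_norm \<nu> \<theta>"
      by (intro l2_Cauchy_Schwarz Cc_l2_\<nu> C1_compact_support_Cc us \<theta>)
    ultimately show ?thesis by linarith
  qed
  have "(\<lambda>n. l2_norm \<nu> (us n) * l2_norm \<nu> \<theta>) \<longlonglongrightarrow> 0"
    using tendsto_mult_right[OF null, of "l2_norm \<nu> \<theta>"] by simp
  then obtain N where N: "\<And>n. n \<ge> N \<Longrightarrow> \<bar>l2_norm \<nu> (us n) * l2_norm \<nu> \<theta>\<bar> < e"
    using LIMSEQ_D e by (metis diff_zero real_norm_def)
  have small: "sqrt (2 * K) * (\<eta> * sqrt L) < e"
  proof -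
    have "sqrt (2 * K) * (\<eta> * sqrt L) < \<eta> * (1 + sqrt (2 * K) * sqrt L)"
      using \<eta> by (simp add: algebra_simps)
    also have "\<dots> = e" using pos by (simp add: \<eta>_def)
    finally show ?thesis .
  qed
  \<comment> \<open>\<open>key\<close> bounds twice the energy, so two errors below \<open>e\<close>
    are enough.\<close>
  have "norm (energy (us n) \<phi> - 0) < e" if "n \<ge> N" for n
    using key[of n] N[OF that] small by simp
  then show "\<exists>no. \<forall>n\<ge>no. norm (energy (us n) \<phi> - 0) < e" by blast
qed

text \<open>\<open>f\<close> has derivative
  \<open>\<kappa>1 / (w * A) - \<kappa>2 / (w * C)\<close>: it rises from 0 to 1 before
  \<open>x\<close> and returns to 0 after \<open>y\<close>, because \<open>A\<close> and
  \<open>C\<close> are the total masses. The factors \<open>\<kappa>1\<close>,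
  \<open>\<kappa>2\<close> make it C1 with compact support; if both were 1 on the half-lines, the
  energy bound would be attained there.\<close>

lemma test_function:
  assumes \<kappa>1: "\<kappa>1 \<in> Cc" "\<And>z. 0 \<le> \<kappa>1 z" "\<And>z. \<kappa>1 z \<le> 1" "\<And>z. x \<le> z \<Longrightarrow> \<kappa>1 z = 0"
    and \<kappa>2: "\<kappa>2 \<in> Cc" "\<And>z. 0 \<le> \<kappa>2 z" "\<And>z. \<kappa>2 z \<le> 1" "\<And>z. z \<le> y \<Longrightarrow> \<kappa>2 z = 0"
    and xy: "x \<le> y"
    and A: "A = (\<integral>z. \<kappa>1 z / w z \<partial>lborel)" "A > 0"
    and C: "C = (\<integral>z. \<kappa>2 z / w z \<partial>lborel)" "C > 0"
  shows "\<exists>f\<in>C1_compact_support. (\<forall>z\<in>{x..y}. f z = 1)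
    \<and> (\<forall>z\<ge>y. f z = (\<integral>t. indicator {z..} t * (\<kappa>2 t / w t) \<partial>lborel) / C)
    \<and> 2 * energy f f \<le> 1 / A + 1 / C"
proof -
  define s1 where "s1 z = \<kappa>1 z / w z" for z
  define s2 where "s2 z = \<kappa>2 z / w z" for z
  have s1: "s1 \<in> Cc" unfolding s1_def using Cc_mult_right[OF \<kappa>1(1) inverse_w_cont] by simp
  have s2: "s2 \<in> Cc" unfolding s2_def using Cc_mult_right[OF \<kappa>2(1) inverse_w_cont] by simp
  obtain P1 where P1: "\<And>z. (P1 has_real_derivative s1 z) (at z)"
    using continuous_antiderivative[OF Cc_continuous[OF s1]] by blast
  obtain P2 where P2: "\<And>z. (P2 has_real_derivative s2 z) (at z)"
    using continuous_antiderivative[OF Cc_continuous[OF s2]] by blast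
  obtain R1 where R1: "\<And>z. R1 \<le> \<bar>z\<bar> \<Longrightarrow> s1 z = 0" using s1 unfolding Cc_def by blast
  obtain R2 where R2: "\<And>z. R2 \<le> \<bar>z\<bar> \<Longrightarrow> s2 z = 0" using s2 unfolding Cc_def by blast
  define R where "R = max (max \<bar>R1\<bar> \<bar>R2\<bar>) (max \<bar>x\<bar> \<bar>y\<bar>)"
  have R: "R \<ge> 0" "- R \<le> x" "y \<le> R" by (auto simp: R_def)
  have sR: "s1 z = 0" "s2 z = 0" if "R \<le> \<bar>z\<bar>" for z
    using R1[of z] R2[of z] that by (auto simp: R_def)
  have s1x: "s1 z = 0" if "x \<le> z" for z using \<kappa>1(4)[OF that] by (simp add: s1_def)
  have s2y: "s2 z = 0" if "z \<le> y" for z using \<kappa>2(4)[OF that] by (simp add: s2_def)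
  have const: "F u = F u'" if "\<And>z. (F has_real_derivative s z) (at z)" "u \<le> u'" "\<And>z. u < z \<Longrightarrow> z < u' \<Longrightarrow> s z = 0"
    for F s :: "real \<Rightarrow> real" and u u'
  proof (cases "u = u'")
    case False
    then have "u < u'" using that(2) by simp
    from MVT2[OF this that(1)] obtain z where "u < z" "z < u'" "F u' - F u = (u' - u) * s z"
      by blast
    then show ?thesis using that(3)[of z] by simp
  qed simp
  have low: "P1 z = P1 (- R)" "P2 z = P2 (- R)" if "z \<le> - R" for z
    using that R(1) by (auto intro!: const[OF P1] const[OF P2] sR)
  have high: "P1 z = P1 R" "P2 z = P2 R" if "z \<ge> R" for z
    using that R(1) by (auto intro!: const[OF P1, symmetric] const[OF P2, symmetric] sR)
  have P1x: "P1 z = P1 R" if "z \<ge> x" for z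
  proof (cases "z \<le> R")
    case True
    then show ?thesis using that by (intro const[OF P1] s1x) auto
  next
    case False
    then show ?thesis by (intro high) simp
  qed
  have P2y: "P2 z = P2 (- R)" if "z \<le> y" for z
  proof (cases "- R \<le> z")
    case True
    then show ?thesis using that by (intro const[OF P2, symmetric] s2y) auto
  next
    case False
    then show ?thesis by (intro low) simp
  qed
  have tail: "(\<integral>t. indicator {z..} t * s t \<partial>lborel) = F r - F z"
    if F: "\<And>z. (F has_real_derivative s z) (at z)" and s: "s \<in> Cc" "\<And>z. R \<le> \<bar>z\<bar> \<Longrightarrow> s z = 0"
      and r: "r = max R z" for F s :: "real \<Rightarrow> real" and z r
  proof -
    have "(\<integral>t. s t * indicator {z..r} t \<partial>lborel) = F r - F z"
      using F Cc_continuous[OF s(1), of UNIV] r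
      by (intro integral_FTC_Icc_real) (auto simp: continuous_on_eq_continuous_at)
    also have "(\<lambda>t. s t * indicator {z..r} t) = (\<lambda>t. indicator {z..} t * s t)"
    proof
      fix t show "s t * indicator {z..r} t = indicator {z..} t * s t"
        using s(2)[of t] r R(1) by (cases "t \<le> r") (auto simp: indicator_def)
    qed
    finally show ?thesis .
  qed
  have full: "(\<integral>t. s t \<partial>lborel) = F R - F (- R)"
    if F: "\<And>z. (F has_real_derivative s z) (at z)" and s: "s \<in> Cc" "\<And>z. R \<le> \<bar>z\<bar> \<Longrightarrow> s z = 0"
    for F s :: "real \<Rightarrow> real"
  proof -
    have eq: "(\<lambda>t. indicator {- R..} t * s t) = s"
    proof
      fix t show "indicator {- R..} t * s t = s t"
        using s(2)[of t] R(1) by (cases "t \<ge> - R") (auto simp: indicator_def)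
    qed
    show ?thesis using tail[OF F s, of R "- R"] R(1) unfolding eq by simp
  qed
  have A': "A = P1 R - P1 (- R)" using full[OF P1 s1 sR(1)] A(1) by (simp add: s1_def)
  have C': "C = P2 R - P2 (- R)" using full[OF P2 s2 sR(2)] C(1) by (simp add: s2_def)
  define f where "f z = (P1 z - P1 (- R)) / A - (P2 z - P2 (- R)) / C" for z
  have df: "(f has_real_derivative s1 z / A - s2 z / C) (at z)" for z
    unfolding f_def using DERIV_diff[OF DERIV_cdivide[OF DERIV_diff[OF P1 DERIV_const]] DERIV_cdivide[OF DERIV_diff[OF P2 DERIV_const]]]
    by simp
  have f_cont: "continuous_on UNIV (\<lambda>z. s1 z / A - s2 z / C)"
    using A(2) C(2) by (intro continuous_intros Cc_continuous s1 s2) auto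
  have fD: "f \<in> C1_compact_support"
  proof (rule C1_compact_supportI[OF df f_cont])
    fix z assume z: "R \<le> \<bar>z\<bar>"
    show "f z = 0"
    proof (cases "z \<ge> 0")
      case True
      then show ?thesis using z high[of z] A' C' A(2) C(2) by (simp add: f_def)
    next
      case False
      then show ?thesis using z low[of z] by (simp add: f_def)
    qed
  qed
  have deriv_f: "deriv f = (\<lambda>z. s1 z / A - s2 z / C)" using df by (auto intro: DERIV_imp_deriv)
  have one: "f z = 1" if "z \<in> {x..y}" for z
    using P1x[of z] P2y[of z] that A' A(2) by (simp add: f_def)
  have right: "f z = (\<integral>t. indicator {z..} t * (\<kappa>2 t / w t) \<partial>lborel) / C" if z: "z \<ge> y" for z
  proof -
    have "(\<integral>t. indicator {z..} t * s2 t \<partial>lborel) = P2 (max R z) - P2 z"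
      by (rule tail[OF P2 s2 sR(2)]) auto
    also have "P2 (max R z) = P2 R" using high(2)[of z] by (simp add: max_def)
    finally have "(\<integral>t. indicator {z..} t * s2 t \<partial>lborel) = P2 R - P2 z" .
    moreover have "f z = 1 - (P2 z - P2 (- R)) / C"
      using P1x[of z] z xy A' A(2) by (simp add: f_def)
    moreover have "\<dots> = (P2 R - P2 z) / C" using C(2) unfolding C' by (simp add: field_simps)
    ultimately show ?thesis by (simp add: s2_def)
  qed
  have "2 * energy f f = (\<integral>z. w z * deriv f z * deriv f z \<partial>lborel)" by (simp add: energy_def)
  also have "\<dots> \<le> (\<integral>z. s1 z / A\<^sup>2 + s2 z / C\<^sup>2 \<partial>lborel)"
  proof (rule integral_mono)
    show "integrable lborel (\<lambda>z. w z * deriv f z * deriv f z)" by (rule energy_integrable[OF fD fD])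
    show "integrable lborel (\<lambda>z. s1 z / A\<^sup>2 + s2 z / C\<^sup>2)"
      using Cc_integrable[OF s1] Cc_integrable[OF s2] by simp
    fix z
    have sq: "w z * s z * s z \<le> s z" if "s z = \<kappa> z / w z" "0 \<le> \<kappa> z" "\<kappa> z \<le> 1" for s \<kappa> :: "real \<Rightarrow> real"
    proof -
      have "w z * s z * s z = \<kappa> z * \<kappa> z / w z" using w_pos[of z] by (simp add: that(1))
      also have "\<dots> \<le> \<kappa> z / w z"
        using that w_pos[of z] by (intro divide_right_mono) (auto simp: mult_left_le)
      finally show ?thesis by (simp add: that(1))
    qed
    have "s1 z * s2 z = 0"
      using s1x[of z] s2y[of z] xy by (cases "x \<le> z") auto
    then have "w z * deriv f z * deriv f z = w z * s1 z * s1 z / A\<^sup>2 + w z * s2 z * s2 z / C\<^sup>2"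
      by (auto simp: deriv_f power2_eq_square)
    also have "\<dots> \<le> s1 z / A\<^sup>2 + s2 z / C\<^sup>2"
      by (intro add_mono divide_right_mono sq[of s1 \<kappa>1] sq[of s2 \<kappa>2]) (auto simp: s1_def s2_def \<kappa>1 \<kappa>2)
    finally show "w z * deriv f z * deriv f z \<le> s1 z / A\<^sup>2 + s2 z / C\<^sup>2" .
  qed
  also have "\<dots> = A / A\<^sup>2 + C / C\<^sup>2"
  proof -
    have "(\<integral>z. s1 z \<partial>lborel) = A" "(\<integral>z. s2 z \<partial>lborel) = C" by (simp_all add: A(1) C(1) s1_def s2_def)
    then show ?thesis using Cc_integrable[OF s1] Cc_integrable[OF s2] by simp
  qed
  also have "\<dots> = 1 / A + 1 / C" using A(2) C(2) by (simp add: power2_eq_square)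
  finally show ?thesis using fD one right by blast
qed

section \<open>The infimum of the Rayleigh quotient\<close>

definition rayleigh_inf :: real where
  "rayleigh_inf = Inf {energy f f / l2_inner \<nu> f f |f. f \<in> C1_compact_support \<and> 0 < l2_inner \<nu> f f}"

lemma l2_inner_\<nu>_self: "f \<in> C1_compact_support \<Longrightarrow> l2_inner \<nu> f f = (\<integral>x. v x * (f x)\<^sup>2 \<partial>lborel)"
  by (simp add: l2_inner_\<nu> Cc_borel C1_compact_support_Cc power2_eq_square)

lemma nn_integral_\<nu>_self:
  assumes "f \<in> C1_compact_support"
  shows "(\<integral>\<^sup>+x. ennreal (v x * (f x)\<^sup>2) \<partial>lborel) = ennreal (l2_inner \<nu> f f)"
proof -
  have "integrable lborel (\<lambda>x. v x * (f x)\<^sup>2)"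
    using Cc_l2_\<nu>[OF C1_compact_support_Cc[OF assms]] l2_\<nu>_iff[OF Cc_borel[OF C1_compact_support_Cc[OF assms]]]
    by simp
  then show ?thesis
    using v_pos by (simp add: l2_inner_\<nu>_self[OF assms] nn_integral_eq_integral less_imp_le)
qed

text \<open>Guarantees that the set in \<open>rayleigh_inf\<close> is nonempty, without which
  \<open>Inf\<close> would be an unspecified real.\<close>

lemma ex_positive_norm: "\<exists>f\<in>C1_compact_support. 0 < l2_inner \<nu> f f"
proof -
  define bump :: "real \<Rightarrow> real" where "bump z = max 0 (1 - \<bar>z\<bar>)" for z
  have bump: "(\<lambda>z. bump (z - c)) \<in> Cc" for c
    unfolding bump_def by (intro CcI[of _ "\<bar>c\<bar> + 1"] continuous_intros) (auto simp: abs_if split: if_splits)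
  have pos: "(\<integral>z. bump (z - c) / w z \<partial>lborel) > 0" for c
  proof -
    have cc: "(\<lambda>z. bump (z - c) / w z) \<in> Cc" using Cc_mult_right[OF bump inverse_w_cont, of c] by simp
    have nn: "0 \<le> bump (z - c) / w z" for z using w_pos[of z] by (simp add: bump_def)
    have "(\<integral>z. bump (z - c) / w z \<partial>lborel) \<noteq> 0"
    proof
      assume "(\<integral>z. bump (z - c) / w z \<partial>lborel) = 0"
      then have "AE z in lborel. bump (z - c) / w z = 0"
        using integral_nonneg_eq_0_iff_AE[OF Cc_integrable[OF cc]] nn by simp
      then have "AE z in lborel. z \<notin> {c - 1<..<c + 1}"
        by eventually_elim (use w_pos in \<open>auto simp: bump_def less_imp_neq[symmetric]\<close>)
      then have "{c - 1<..<c + 1} \<in> null_sets lborel" by (subst AE_iff_null_sets) auto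
      then show False by (simp add: null_sets_def)
    qed
    moreover have "0 \<le> (\<integral>z. bump (z - c) / w z \<partial>lborel)" using nn by simp
    ultimately show ?thesis by simp
  qed
  \<comment> \<open>The bumps around 0 and 3 live on \<open>[-1, 1]\<close> and
    \<open>[2, 4]\<close>; between them \<open>f\<close> is 1 on \<open>[1, 2]\<close>.\<close>
  obtain f where f: "f \<in> C1_compact_support" "\<And>z. z \<in> {1..2} \<Longrightarrow> f z = 1"
    using test_function[OF bump[of 0] _ _ _ bump[of 3] _ _ _ _ refl pos refl pos, of 1 2]
    by (auto simp: bump_def)
  have "0 < (\<integral>\<^sup>+x. ennreal (v x * (f x)\<^sup>2) \<partial>lborel)"
  proof (rule ccontr)
    assume "\<not> 0 < (\<integral>\<^sup>+x. ennreal (v x * (f x)\<^sup>2) \<partial>lborel)"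
    then have "(\<integral>\<^sup>+x. ennreal (v x * (f x)\<^sup>2) \<partial>lborel) = 0" by simp
    then have "AE x in lborel. ennreal (v x * (f x)\<^sup>2) = 0"
      using Cc_borel[OF C1_compact_support_Cc[OF f(1)]] by (subst (asm) nn_integral_0_iff_AE) auto
    then have "AE x in lborel. x \<notin> {1..2::real}"
    proof eventually_elim
      fix x assume "ennreal (v x * (f x)\<^sup>2) = 0"
      then show "x \<notin> {1..2}" using f(2)[of x] v_pos[of x] by (auto simp: ennreal_eq_0_iff)
    qed
    then have "{1..2::real} \<in> null_sets lborel" by (subst AE_iff_null_sets) auto
    then show False by (simp add: null_sets_def)
  qed
  then show ?thesis using f(1) nn_integral_\<nu>_self[OF f(1)] by auto
qed

lemma rayleigh_inf_le: "f \<in> C1_compact_support \<Longrightarrow> rayleigh_inf * l2_inner \<nu> f f \<le> energy f f"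
proof (cases "l2_inner \<nu> f f = 0")
  case False
  assume f: "f \<in> C1_compact_support"
  have pos: "0 < l2_inner \<nu> f f" using False l2_inner_self_nonneg[of \<nu> f] by simp
  have "rayleigh_inf \<le> energy f f / l2_inner \<nu> f f"
    unfolding rayleigh_inf_def
    by (rule cInf_lower) (use f pos energy_nonneg in \<open>auto intro!: bdd_belowI[of _ 0]\<close>)
  then show ?thesis using pos by (simp add: field_simps)
qed (simp add: energy_nonneg)

lemma le_rayleigh_inf:
  assumes "\<And>f. f \<in> C1_compact_support \<Longrightarrow> c * l2_inner \<nu> f f \<le> energy f f"
  shows "c \<le> rayleigh_inf"
  unfolding rayleigh_inf_def
proof (rule cInf_greatest)
  show "{energy f f / l2_inner \<nu> f f |f. f \<in> C1_compact_support \<and> 0 < l2_inner \<nu> f f} \<noteq> {}"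
    using ex_positive_norm by auto
qed (use assms in \<open>auto simp: pos_le_divide_eq\<close>)

lemma rayleigh_inf_nonneg: "0 \<le> rayleigh_inf"
  by (intro le_rayleigh_inf) (simp add: energy_nonneg)

lemma rayleigh_inf_sharp:
  assumes "e > 0"
  shows "\<exists>f\<in>C1_compact_support. 0 < l2_inner \<nu> f f \<and> energy f f < (rayleigh_inf + e) * l2_inner \<nu> f f"
proof (rule ccontr)
  assume *: "\<not> ?thesis"
  have "(rayleigh_inf + e) * l2_inner \<nu> f f \<le> energy f f" if "f \<in> C1_compact_support" for f
  proof (cases "l2_inner \<nu> f f = 0")
    case True
    then show ?thesis by (simp add: energy_nonneg)
  next
    case False
    then show ?thesis using * that l2_inner_self_nonneg[of \<nu> f] by (auto simp: not_less)
  qed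
  then have "rayleigh_inf + e \<le> rayleigh_inf" by (rule le_rayleigh_inf)
  with assms show False by simp
qed

sublocale form: closable_form \<nu> C1_compact_support energy rayleigh_inf
proof
  show "f \<in> l2_space \<nu>" if "f \<in> C1_compact_support" for f
    using that by (intro Cc_l2_\<nu> C1_compact_support_Cc)
qed (auto intro: C1_compact_support_lincomb energy_commute energy_lincomb rayleigh_inf_le
    rayleigh_inf_sharp energy_weakly_closable)

section \<open>Lower bounds for the Rayleigh quotient by barriers\<close>

text \<open>
  Expanding \<open>\<integral> (w f' + \<psi> f)\<^sup>2 / w \<ge> 0\<close> and integrating the mixed term by parts gives
  \<open>\<integral> w f'\<^sup>2 \<ge> \<integral> (\<psi>' - \<psi>\<^sup>2 / w) f\<^sup>2\<close>.
\<close>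

lemma rayleigh_inf_ge_of_barrier:
  assumes \<psi>: "\<And>x. (\<psi> has_real_derivative \<psi>' x) (at x)" "continuous_on UNIV \<psi>'"
    and le: "\<And>x. c * v x \<le> \<psi>' x - (\<psi> x)\<^sup>2 / w x"
  shows "c / 2 \<le> rayleigh_inf"
proof (rule le_rayleigh_inf)
  fix f assume f: "f \<in> C1_compact_support"
  note df = C1_compact_supportD(1)[OF f] and f_cont = C1_compact_support_continuous[OF f]
  obtain R where R: "\<And>x. R \<le> \<bar>x\<bar> \<Longrightarrow> f x = 0 \<and> deriv f x = 0"
    using C1_compact_supportD(3)[OF f] by blast
  have \<psi>_cont: "continuous_on UNIV \<psi>" using \<psi>(1) by (meson DERIV_isCont continuous_at_imp_continuous_on)
  \<comment> \<open>The derivative of \<open>f\<^sup>2 * \<psi>\<close>; that its integral vanishes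
    is the integration by parts.\<close>
  let ?d = "\<lambda>x. 2 * f x * deriv f x * \<psi> x + (f x)\<^sup>2 * \<psi>' x"
  have d: "integrable lborel ?d" "(\<integral>x. ?d x \<partial>lborel) = 0"
  proof (rule_tac [!] integral_deriv_Cc[of "\<lambda>x. (f x)\<^sup>2 * \<psi> x"])
    show "((\<lambda>x. (f x)\<^sup>2 * \<psi> x) has_real_derivative ?d x) (at x)" for x
      using DERIV_mult[OF DERIV_power[OF df, of 2] \<psi>(1), of x] by (simp add: algebra_simps)
    then show "((\<lambda>x. (f x)\<^sup>2 * \<psi> x) has_real_derivative ?d x) (at x)" for x .
    show c: "continuous_on UNIV ?d"
      by (intro continuous_intros f_cont \<psi>_cont \<psi>(2) C1_compact_supportD(2)[OF f])
    then show "continuous_on UNIV ?d" .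
    show "(f x)\<^sup>2 * \<psi> x = 0 \<and> ?d x = 0" if "R \<le> \<bar>x\<bar>" for x using R[OF that] by simp
    then show "(f x)\<^sup>2 * \<psi> x = 0 \<and> ?d x = 0" if "R \<le> \<bar>x\<bar>" for x using that .
  qed
  have v_int: "integrable lborel (\<lambda>x. v x * (f x)\<^sup>2)"
    using Cc_l2_\<nu>[OF C1_compact_support_Cc[OF f]] l2_\<nu>_iff[OF Cc_borel[OF C1_compact_support_Cc[OF f]]] by simp
  have "(\<integral>x. c * (v x * (f x)\<^sup>2) - ?d x \<partial>lborel) \<le> (\<integral>x. w x * deriv f x * deriv f x \<partial>lborel)"
  proof (rule integral_mono)
    show "integrable lborel (\<lambda>x. c * (v x * (f x)\<^sup>2) - ?d x)" using v_int d(1) by (intro Bochner_Integration.integrable_diff integrable_mult_right)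
    show "integrable lborel (\<lambda>x. w x * deriv f x * deriv f x)" by (rule energy_integrable[OF f f])
    fix x
    have "0 \<le> (w x * deriv f x + \<psi> x * f x)\<^sup>2 / w x" using w_pos[of x] by simp
    also have "\<dots> = w x * deriv f x * deriv f x + 2 * f x * deriv f x * \<psi> x + (f x)\<^sup>2 * ((\<psi> x)\<^sup>2 / w x)"
      using w_pos[of x] by (simp add: field_simps power2_eq_square)
    finally have 1: "0 \<le> w x * deriv f x * deriv f x + 2 * f x * deriv f x * \<psi> x + (f x)\<^sup>2 * ((\<psi> x)\<^sup>2 / w x)" .
    have "(f x)\<^sup>2 * (c * v x) \<le> (f x)\<^sup>2 * (\<psi>' x - (\<psi> x)\<^sup>2 / w x)" by (intro mult_left_mono le) simp
    then have "c * (v x * (f x)\<^sup>2) \<le> (f x)\<^sup>2 * \<psi>' x - (f x)\<^sup>2 * ((\<psi> x)\<^sup>2 / w x)" by (simp only: algebra_simps)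
    with 1 show "c * (v x * (f x)\<^sup>2) - ?d x \<le> w x * deriv f x * deriv f x" by linarith
  qed
  also have "(\<integral>x. c * (v x * (f x)\<^sup>2) - ?d x \<partial>lborel) = c * l2_inner \<nu> f f"
    using v_int d by (simp add: l2_inner_\<nu>_self[OF f])
  finally show "c / 2 * l2_inner \<nu> f f \<le> energy f f" by (simp add: energy_def)
qed

text \<open>\<open>A * V \<le> \<omega>\<close> means
  \<open>V / (4 * \<omega>) \<le> 1 / (4 * A)\<close>, so the sum is at most
  \<open>1 / (2 * A)\<close>. The bound on its square, divided by \<open>w\<close>, is precisely the
  term that differentiating \<open>- 1 / (4 * A)\<close> supplies.\<close>

lemma barrier_square_le:
  fixes A V \<omega> :: real
  assumes "\<omega> > 0" "A > 0" "V \<ge> 0" "A * V \<le> \<omega>"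
  shows "(V / (4 * \<omega>) + 1 / (4 * A))\<^sup>2 \<le> 1 / (4 * A\<^sup>2)"
proof -
  have "V / \<omega> \<le> 1 / A" using assms by (simp add: field_simps)
  then have "(V / \<omega> + 1 / A)\<^sup>2 \<le> (2 / A)\<^sup>2" using assms by (intro power_mono) auto
  moreover have "(V / (4 * \<omega>) + 1 / (4 * A))\<^sup>2 = (V / \<omega> + 1 / A)\<^sup>2 / 16"
    using assms by (simp add: field_simps power2_eq_square)
  ultimately show ?thesis using assms by (simp add: power_divide)
qed

text \<open>The sign \<open>\<sigma> = \<plusminus>1\<close> selects whether \<open>A\<close> integrates \<open>1/w\<close> from the left or from the right.\<close>

lemma rayleigh_inf_ge_one_sided:
  assumes "\<omega> > 0" and \<sigma>: "\<sigma> * \<sigma> = 1"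
    and A: "\<And>x. (A has_real_derivative \<sigma> / w x) (at x)" "\<And>x. A x > 0"
    and V: "\<And>x. (V has_real_derivative - (\<sigma> * v x)) (at x)" "\<And>x. V x \<ge> 0"
    and AV: "\<And>x. A x * V x \<le> \<omega>"
  shows "1 / (8 * \<omega>) \<le> rayleigh_inf"
proof -
  have A_cont: "continuous_on UNIV A" using A(1) by (meson DERIV_isCont continuous_at_imp_continuous_on)
  have "1 / (4 * \<omega>) / 2 \<le> rayleigh_inf"
  proof (rule rayleigh_inf_ge_of_barrier)
    fix x
    let ?p = "V x / (4 * \<omega>) + 1 / (4 * A x)"
    \<comment> \<open>Reflection flips the signs of \<open>A'\<close>, of \<open>V'\<close> and of
      the barrier together, so \<open>\<sigma>\<close> enters the derivative only through
      \<open>\<sigma> * \<sigma> = 1\<close>.\<close>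
    have "((\<lambda>x. - \<sigma> * (V x / (4 * \<omega>) + 1 / (4 * A x))) has_real_derivative
        - \<sigma> * (- (\<sigma> * v x) / (4 * \<omega>) - \<sigma> / w x / (4 * (A x)\<^sup>2))) (at x)"
      using A(2)[of x] assms(1)
      by (auto intro!: derivative_eq_intros A(1) V(1) simp: field_simps power2_eq_square)
    also have "- \<sigma> * (- (\<sigma> * v x) / (4 * \<omega>) - \<sigma> / w x / (4 * (A x)\<^sup>2))
        = (\<sigma> * \<sigma>) * (v x / (4 * \<omega>) + 1 / w x / (4 * (A x)\<^sup>2))" by (simp add: algebra_simps)
    finally show "((\<lambda>x. - \<sigma> * (V x / (4 * \<omega>) + 1 / (4 * A x))) has_real_derivative
        v x / (4 * \<omega>) + 1 / w x / (4 * (A x)\<^sup>2)) (at x)" using \<sigma> by simp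
    have "(- \<sigma> * ?p)\<^sup>2 = (\<sigma> * \<sigma>) * ?p\<^sup>2" by (simp add: power2_eq_square)
    then have "(- \<sigma> * ?p)\<^sup>2 \<le> 1 / (4 * (A x)\<^sup>2)"
      using barrier_square_le[OF assms(1) A(2) V(2) AV] \<sigma> by simp
    then have "(- \<sigma> * ?p)\<^sup>2 / w x \<le> 1 / (4 * (A x)\<^sup>2) / w x"
      using w_pos[of x] by (intro divide_right_mono) auto
    then show "1 / (4 * \<omega>) * v x \<le> v x / (4 * \<omega>) + 1 / w x / (4 * (A x)\<^sup>2) - (- \<sigma> * ?p)\<^sup>2 / w x"
      by (simp add: mult.commute)
  next
    show "continuous_on UNIV (\<lambda>x. v x / (4 * \<omega>) + 1 / w x / (4 * (A x)\<^sup>2))"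
      using A(2) assms(1) by (intro continuous_intros v_cont inverse_w_cont A_cont) (auto simp: less_imp_neq[symmetric])
  qed
  then show ?thesis by simp
qed

text \<open>
  Writing \<open>f = h g\<close> turns the weights \<open>w\<close>, \<open>v\<close> into \<open>w h\<^sup>2\<close>, \<open>v h\<^sup>2\<close>; the barrier below is that of the
  one-sided case for these weights, transformed back.
\<close>

lemma rayleigh_inf_ge_two_sided:
  assumes "\<omega> > 0"
    and h: "\<And>x. (h has_real_derivative - 1 / w x) (at x)" "\<And>x. h x > 0"
    and A: "\<And>x. A x = 1 / h x - k" "\<And>x. A x > 0"
    and V: "\<And>x. (V has_real_derivative - ((h x)\<^sup>2 * v x)) (at x)" "\<And>x. V x \<ge> 0"
    and AV: "\<And>x. A x * V x \<le> \<omega>"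
  shows "1 / (8 * \<omega>) \<le> rayleigh_inf"
proof -
  have dA: "(A has_real_derivative 1 / (w x * (h x)\<^sup>2)) (at x)" for x
    unfolding A(1)[abs_def] using h(2)[of x]
    by (auto intro!: derivative_eq_intros h(1) simp: power2_eq_square)
  have conts: "continuous_on UNIV A" "continuous_on UNIV h" "continuous_on UNIV V"
    using dA h(1) V(1) by (meson DERIV_isCont continuous_at_imp_continuous_on)+
  define p where "p x = - (V x / (4 * \<omega>) + 1 / (4 * A x))" for x
  define p' where "p' x = (h x)\<^sup>2 * v x / (4 * \<omega>) + 1 / (w x * (h x)\<^sup>2) / (4 * (A x)\<^sup>2)" for x
  have dp: "(p has_real_derivative p' x) (at x)" for x
    unfolding p_def p'_def using A(2)[of x] assms(1)
    by (auto intro!: derivative_eq_intros dA V(1)) (simp add: field_simps power2_eq_square)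
  have p_cont: "continuous_on UNIV p" using dp by (meson DERIV_isCont continuous_at_imp_continuous_on)
  have "1 / (4 * \<omega>) / 2 \<le> rayleigh_inf"
  proof (rule rayleigh_inf_ge_of_barrier)
    fix x
    \<comment> \<open>With \<open>f = h * g\<close> and \<open>w * h' = - 1\<close>, the integrand
      \<open>w * f'\<^sup>2\<close> equals \<open>w * h\<^sup>2 * g'\<^sup>2\<close> minus the
      derivative of \<open>f\<^sup>2 / h\<close>; this gives the summand \<open>1 / h\<close>. The
      barrier \<open>p\<close> for \<open>g\<close> multiplies
      \<open>g\<^sup>2 = f\<^sup>2 / h\<^sup>2\<close>; this gives
      \<open>p / h\<^sup>2\<close>.\<close>
    show "((\<lambda>x. p x / (h x)\<^sup>2 + 1 / h x) has_real_derivative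
        p' x / (h x)\<^sup>2 + 2 * p x / (w x * (h x)^3) + 1 / (w x * (h x)\<^sup>2)) (at x)"
      using h(2)[of x] w_pos[of x]
      by (auto intro!: derivative_eq_intros dp h(1)) (simp add: field_simps power2_eq_square power3_eq_cube power4_eq_xxxx)
    have "(p x)\<^sup>2 \<le> 1 / (4 * (A x)\<^sup>2)"
      using barrier_square_le[OF assms(1) A(2) V(2) AV, of x] unfolding p_def power2_minus .
    then have "0 \<le> (1 / (4 * (A x)\<^sup>2) - (p x)\<^sup>2) / ((h x)^4 * w x)"
      using h(2)[of x] w_pos[of x] by simp
    \<comment> \<open>All terms produced by \<open>1 / h\<close> cancel. What is left is the
      one-sided inequality for the transformed weights, divided by \<open>h\<^sup>2\<close>.\<close>
    also have "\<dots> = p' x / (h x)\<^sup>2 + 2 * p x / (w x * (h x)^3) + 1 / (w x * (h x)\<^sup>2)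
        - (p x / (h x)\<^sup>2 + 1 / h x)\<^sup>2 / w x - v x / (4 * \<omega>)"
    proof -
      have "p' x / (h x)\<^sup>2 = v x / (4 * \<omega>) + 1 / (4 * (A x)\<^sup>2) / ((h x)^4 * w x)"
        using h(2)[of x] w_pos[of x] assms(1) by (simp add: p'_def add_divide_distrib power4_eq_xxxx power2_eq_square)
      moreover have "(p x / (h x)\<^sup>2 + 1 / h x)\<^sup>2 / w x
          = (p x)\<^sup>2 / ((h x)^4 * w x) + 2 * p x / (w x * (h x)^3) + 1 / (w x * (h x)\<^sup>2)"
        using h(2)[of x] w_pos[of x] by (simp add: field_simps power2_eq_square power3_eq_cube power4_eq_xxxx)
      ultimately show ?thesis by (simp add: diff_divide_distrib)
    qed
    finally show "1 / (4 * \<omega>) * v x \<le> p' x / (h x)\<^sup>2 + 2 * p x / (w x * (h x)^3) + 1 / (w x * (h x)\<^sup>2)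
        - (p x / (h x)\<^sup>2 + 1 / h x)\<^sup>2 / w x" by simp
  next
    have nz: "w x \<noteq> 0" "h x \<noteq> 0" "A x \<noteq> 0" for x
      using w_pos[of x] h(2)[of x] A(2)[of x] by auto
    show "continuous_on UNIV (\<lambda>x. p' x / (h x)\<^sup>2 + 2 * p x / (w x * (h x)^3) + 1 / (w x * (h x)\<^sup>2))"
      unfolding p'_def using nz assms(1)
      by (intro continuous_intros v_cont w_cont conts p_cont) auto
  qed
  then show ?thesis by simp
qed

end

section \<open>Tail integrals and cutoffs\<close>

definition ltail :: "(real \<Rightarrow> real) \<Rightarrow> real \<Rightarrow> ennreal" where
  "ltail f x = (\<integral>\<^sup>+ t \<in> {..x}. ennreal (f t) \<partial>lborel)"

definition rtail :: "(real \<Rightarrow> real) \<Rightarrow> real \<Rightarrow> ennreal" where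
  "rtail f x = (\<integral>\<^sup>+ t \<in> {x..}. ennreal (f t) \<partial>lborel)"

lemma nn_integral_lborel_reflect:
  fixes f :: "real \<Rightarrow> ennreal"
  assumes "f \<in> borel_measurable borel"
  shows "(\<integral>\<^sup>+ t. f (- t) \<partial>lborel) = (\<integral>\<^sup>+ t. f t \<partial>lborel)"
  using nn_integral_real_affine[OF assms, of "- 1" 0] by simp

lemma rtail_eq_ltail:
  assumes [measurable]: "f \<in> borel_measurable borel"
  shows "rtail f x = ltail (\<lambda>t. f (- t)) (- x)"
proof -
  have "(\<integral>\<^sup>+ t. ennreal (f t) * indicator {x..} t \<partial>lborel)
      = (\<integral>\<^sup>+ t. ennreal (f (- t)) * indicator {x..} (- t) \<partial>lborel)"
    by (subst nn_integral_lborel_reflect[symmetric]) simp_all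
  also have "(\<lambda>t. indicator {x..} (- t)) = (indicator {..- x} :: real \<Rightarrow> ennreal)"
    by (auto simp: fun_eq_iff indicator_def)
  then have "(\<integral>\<^sup>+ t. ennreal (f (- t)) * indicator {x..} (- t) \<partial>lborel)
      = (\<integral>\<^sup>+ t. ennreal (f (- t)) * indicator {..- x} t \<partial>lborel)"
    by (metis (no_types))
  finally show ?thesis by (simp add: ltail_def rtail_def)
qed

lemma nn_integral_incseq_sets:
  fixes f :: "'a \<Rightarrow> ennreal"
  assumes [measurable]: "f \<in> borel_measurable M" and A: "incseq A" "\<And>n. A n \<in> sets M"
  shows "(\<lambda>n. \<integral>\<^sup>+ t \<in> A n. f t \<partial>M) \<longlonglongrightarrow> (\<integral>\<^sup>+ t \<in> (\<Union>n. A n). f t \<partial>M)"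
proof (rule nn_integral_LIMSEQ)
  show "incseq (\<lambda>n t. f t * indicator (A n) t)"
    using A(1) by (auto simp: incseq_def le_fun_def indicator_def)
  show "(\<lambda>t. f t * indicator (A n) t) \<in> borel_measurable M" for n using A(2) by measurable
  show "(\<lambda>n. f t * indicator (A n) t) \<longlonglongrightarrow> f t * indicator (\<Union>n. A n) t" for t
  proof (cases "\<exists>m. t \<in> A m")
    case True
    then obtain m where m: "t \<in> A m" by blast
    have "\<forall>\<^sub>F n in sequentially. f t * indicator (A n) t = f t * indicator (\<Union>n. A n) t"
      using eventually_ge_at_top[of m]
    proof eventually_elim
      case (elim n)
      then have "t \<in> A n" using A(1) m by (auto simp: incseq_def)
      then show ?case using m by (auto simp: indicator_def)
    qed
    then show ?thesis by (rule tendsto_eventually)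
  qed (simp add: indicator_def)
qed

lemma ltail_split:
  fixes f :: "real \<Rightarrow> real"
  assumes f: "continuous_on UNIV f" "\<And>t. 0 \<le> f t"
    and F: "\<And>t. (F has_real_derivative f t) (at t)" and xy: "x \<le> y"
  shows "ltail f y = ltail f x + ennreal (F y - F x)"
proof -
  have [measurable]: "f \<in> borel_measurable borel" using f(1) by (rule borel_measurable_continuous_onI)
  have "ltail f y = (\<integral>\<^sup>+ t. ennreal (f t) * indicator {..x} t + ennreal (f t) * indicator {x..y} t \<partial>lborel)"
    unfolding ltail_def
  proof (rule nn_integral_cong_AE)
    show "AE t in lborel. ennreal (f t) * indicator {..y} t
        = ennreal (f t) * indicator {..x} t + ennreal (f t) * indicator {x..y} t"
      using AE_lborel_singleton[of x] by eventually_elim (use xy in \<open>auto simp: indicator_def\<close>)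
  qed
  also have "\<dots> = ltail f x + (\<integral>\<^sup>+ t. ennreal (f t) * indicator {x..y} t \<partial>lborel)"
    unfolding ltail_def by (rule nn_integral_add) measurable
  also have "(\<integral>\<^sup>+ t. ennreal (f t) * indicator {x..y} t \<partial>lborel) = ennreal (F y - F x)"
    by (rule nn_integral_FTC_Icc) (use F f xy in auto)
  finally show ?thesis .
qed

lemma ltail_finite:
  assumes f: "continuous_on UNIV f" "\<And>t. 0 \<le> f t" and fin: "ltail f x0 < \<infinity>"
  shows "ltail f x < \<infinity>"
proof -
  obtain F where F: "\<And>t. (F has_real_derivative f t) (at t)"
    using continuous_antiderivative[OF f(1)] by blast
  show ?thesis
  proof (cases "x0 \<le> x")
    case True
    then show ?thesis using ltail_split[OF f F, of x0 x] fin by simp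
  next
    case False
    then have "ltail f x \<le> ltail f x0" using ltail_split[OF f F, of x x0] by simp
    then show ?thesis using fin by (rule le_less_trans)
  qed
qed

lemma ltail_pos:
  assumes f: "continuous_on UNIV f" "\<And>t. 0 < f t"
  shows "0 < ltail f x"
proof -
  obtain F where F: "\<And>t. (F has_real_derivative f t) (at t)"
    using continuous_antiderivative[OF f(1)] by blast
  have "F (x - 1) < F x" by (rule DERIV_pos_imp_increasing) (use F f(2) in auto)
  then have "0 < ennreal (F x - F (x - 1))" by simp
  also have "\<dots> \<le> ltail f x"
    using ltail_split[OF f(1) less_imp_le[OF f(2)] F, of "x - 1" x] by simp
  finally show ?thesis .
qed

text \<open>A tail finite at one point is finite everywhere, so it equals an antiderivative plus a
  constant. For infinite tails \<open>enn2real\<close> would return the default value 0.\<close>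

lemma ltail_has_derivative:
  assumes f: "continuous_on UNIV f" "\<And>t. 0 \<le> f t" and fin: "ltail f x0 < \<infinity>"
  shows "((\<lambda>x. enn2real (ltail f x)) has_real_derivative f x) (at x)"
proof -
  obtain F where F: "\<And>t. (F has_real_derivative f t) (at t)"
    using continuous_antiderivative[OF f(1)] by blast
  have mono: "F x \<le> F y" if "x \<le> y" for x y
    by (rule DERIV_nonneg_imp_nondecreasing[OF that]) (use F f(2) in auto)
  have step: "enn2real (ltail f y) = enn2real (ltail f x) + (F y - F x)" if "x \<le> y" for x y
    using ltail_split[OF f F that] ltail_finite[OF f fin, of x] mono[OF that] by (simp add: enn2real_plus)
  have "enn2real (ltail f y) = F y + (enn2real (ltail f 0) - F 0)" for y
    using step[of 0 y] step[of y 0] by (cases "0 \<le> y") auto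
  then have "(\<lambda>x. enn2real (ltail f x)) = (\<lambda>y. F y + (enn2real (ltail f 0) - F 0))" by (rule ext)
  then show ?thesis using DERIV_add[OF F DERIV_const] by simp
qed

context
  fixes f :: "real \<Rightarrow> real"
  assumes f_cont: "continuous_on UNIV f"
begin

lemma reflect_cont: "continuous_on UNIV (\<lambda>t. f (- t))"
  by (rule continuous_on_compose2[OF f_cont]) (auto intro: continuous_intros)

lemma rtail_eq_ltail_continuous: "rtail f x = ltail (\<lambda>t. f (- t)) (- x)"
  by (rule rtail_eq_ltail[OF borel_measurable_continuous_onI[OF f_cont]])

lemma rtail_finite: "(\<And>t. 0 \<le> f t) \<Longrightarrow> rtail f x0 < \<infinity> \<Longrightarrow> rtail f x < \<infinity>"
  unfolding rtail_eq_ltail_continuous by (rule ltail_finite[OF reflect_cont])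

lemma rtail_pos: "(\<And>t. 0 < f t) \<Longrightarrow> 0 < rtail f x"
  unfolding rtail_eq_ltail_continuous by (rule ltail_pos[OF reflect_cont])

lemma rtail_has_derivative:
  assumes "\<And>t. 0 \<le> f t" "rtail f x0 < \<infinity>"
  shows "((\<lambda>x. enn2real (rtail f x)) has_real_derivative - f x) (at x)"
proof -
  have "((\<lambda>x. enn2real (ltail (\<lambda>t. f (- t)) x)) has_real_derivative f x) (at (- x))"
    using ltail_has_derivative[OF reflect_cont, of "- x0" "- x"] assms by (simp add: rtail_eq_ltail_continuous)
  then show ?thesis unfolding rtail_eq_ltail_continuous by (subst (asm) DERIV_mirror)
qed

end

text \<open>A trapezoid that vanishes to the left of \<open>- n\<close> and to the right of
  \<open>x\<close>. The slopes grow with \<open>n\<close> along with the support, so the cutoffs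
  increase to the indicator of \<open>{..<x}\<close> and monotone convergence applies.\<close>

definition cutoff :: "nat \<Rightarrow> real \<Rightarrow> real \<Rightarrow> real" where
  "cutoff n x t = max 0 (min 1 (min (real n * (t + real n)) (real n * (x - t))))"

lemma cutoff_bounds: "0 \<le> cutoff n x t" "cutoff n x t \<le> 1"
  by (auto simp: cutoff_def)

lemma cutoff_zero: "x \<le> t \<Longrightarrow> cutoff n x t = 0"
proof -
  assume "x \<le> t"
  then have "real n * (x - t) \<le> 0" by (simp add: mult_nonneg_nonpos)
  then show ?thesis by (simp add: cutoff_def)
qed

lemma cutoff_Cc: "cutoff n x \<in> Cc"
proof (rule CcI[of _ "max \<bar>x\<bar> (real n)"])
  show "continuous_on UNIV (cutoff n x)" unfolding cutoff_def by (intro continuous_intros)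
  fix t assume t: "max \<bar>x\<bar> (real n) \<le> \<bar>t\<bar>"
  show "cutoff n x t = 0"
  proof (cases "x \<le> t")
    case False
    then have "t + real n \<le> 0" using t by (auto simp: abs_if split: if_splits)
    then have "real n * (t + real n) \<le> 0" by (simp add: mult_nonneg_nonpos)
    then show ?thesis by (simp add: cutoff_def)
  qed (rule cutoff_zero)
qed

text \<open>The two products grow with \<open>n\<close> only where \<open>t + m\<close> and
  \<open>x - t\<close> are non-negative; elsewhere the smaller cutoff is already 0.\<close>

lemma cutoff_mono: "m \<le> n \<Longrightarrow> cutoff m x t \<le> cutoff n x t"
proof (cases "t + real m \<ge> 0 \<and> x - t \<ge> 0")
  case True
  assume "m \<le> n"
  then have "real m * (t + real m) \<le> real n * (t + real n)" "real m * (x - t) \<le> real n * (x - t)"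
    using True by (intro mult_mono mult_right_mono; simp)+
  then show ?thesis unfolding cutoff_def by linarith
next
  case False
  then have "real m * (t + real m) \<le> 0 \<or> real m * (x - t) \<le> 0"
    by (auto simp: mult_le_0_iff)
  then have "cutoff m x t = 0" by (auto simp: cutoff_def)
  then show ?thesis by (simp add: cutoff_bounds)
qed

lemma cutoff_tendsto: "(\<lambda>n. cutoff n x t) \<longlonglongrightarrow> indicator {..<x} t"
proof (cases "x \<le> t")
  case True
  then show ?thesis by (simp add: cutoff_zero)
next
  case False
  obtain N where N: "real N \<ge> max (\<bar>t\<bar> + 1) (1 / (x - t))" using real_arch_simple by blast
  have "\<forall>\<^sub>F n in sequentially. cutoff n x t = indicator {..<x} t"
    using eventually_ge_at_top[of N]
  proof eventually_elim
    case (elim n)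
    then have n: "real n \<ge> \<bar>t\<bar> + 1" "real n \<ge> 1 / (x - t)" using N by auto
    have "1 * 1 \<le> real n * (t + real n)" using n(1) by (intro mult_mono) auto
    moreover have "1 \<le> real n * (x - t)" using n(2) False by (simp add: field_simps)
    ultimately show ?case using False by (simp add: cutoff_def)
  qed
  then show ?thesis by (rule tendsto_eventually)
qed

text \<open>Monotone convergence; the limit misses only the point \<open>x\<close>. Finiteness of
  \<open>g t\<close> makes multiplication by it continuous in \<open>ennreal\<close>.\<close>

lemma nn_integral_cutoff_tendsto:
  fixes g :: "real \<Rightarrow> ennreal"
  assumes [measurable]: "g \<in> borel_measurable borel" and fin: "\<And>t. g t < \<infinity>"
  shows "(\<lambda>n. \<integral>\<^sup>+ t. ennreal (cutoff n x t) * g t \<partial>lborel) \<longlonglongrightarrow> (\<integral>\<^sup>+ t \<in> {..x}. g t \<partial>lborel)"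
proof -
  have [measurable]: "cutoff n x \<in> borel_measurable borel" for n by (rule Cc_borel[OF cutoff_Cc])
  have "(\<lambda>n. \<integral>\<^sup>+ t. ennreal (cutoff n x t) * g t \<partial>lborel)
      \<longlonglongrightarrow> (\<integral>\<^sup>+ t. ennreal (indicator {..<x} t) * g t \<partial>lborel)"
  proof (rule nn_integral_LIMSEQ)
    show "incseq (\<lambda>n t. ennreal (cutoff n x t) * g t)"
      by (auto simp: incseq_def le_fun_def intro!: mult_right_mono ennreal_leI cutoff_mono)
    show "(\<lambda>n. ennreal (cutoff n x t) * g t) \<longlonglongrightarrow> ennreal (indicator {..<x} t) * g t" for t
      using ennreal_tendsto_cmult[OF _ tendsto_ennrealI[OF cutoff_tendsto], of "g t" x t] fin[of t]
      by (simp add: mult.commute)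
  qed measurable
  also have "(\<integral>\<^sup>+ t. ennreal (indicator {..<x} t) * g t \<partial>lborel) = (\<integral>\<^sup>+ t \<in> {..x}. g t \<partial>lborel)"
    by (rule nn_integral_cong_AE)
      (use AE_lborel_singleton[of x] in \<open>eventually_elim, auto simp: indicator_def\<close>)
  finally show ?thesis .
qed

lemma nn_integral_cutoff_reflect_tendsto:
  fixes g :: "real \<Rightarrow> ennreal"
  assumes [measurable]: "g \<in> borel_measurable borel" and fin: "\<And>t. g t < \<infinity>"
  shows "(\<lambda>n. \<integral>\<^sup>+ t. ennreal (cutoff n (- y) (- t)) * g t \<partial>lborel) \<longlonglongrightarrow> (\<integral>\<^sup>+ t \<in> {y..}. g t \<partial>lborel)"
proof -
  have [measurable]: "cutoff n x \<in> borel_measurable borel" for n x by (rule Cc_borel[OF cutoff_Cc])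
  have "(\<lambda>n. \<integral>\<^sup>+ t. ennreal (cutoff n (- y) t) * g (- t) \<partial>lborel) \<longlonglongrightarrow> (\<integral>\<^sup>+ t \<in> {..- y}. g (- t) \<partial>lborel)"
    by (rule nn_integral_cutoff_tendsto) (use fin in auto)
  moreover have "(\<integral>\<^sup>+ t. ennreal (cutoff n (- y) t) * g (- t) \<partial>lborel)
      = (\<integral>\<^sup>+ t. ennreal (cutoff n (- y) (- t)) * g t \<partial>lborel)" for n
    by (subst nn_integral_lborel_reflect[symmetric]) simp_all
  moreover have "(\<integral>\<^sup>+ t \<in> {..- y}. g (- t) \<partial>lborel) = (\<integral>\<^sup>+ t \<in> {y..}. g t \<partial>lborel)"
  proof -
    have "indicator {..- y} (- t) = (indicator {y..} t :: ennreal)" for t :: real by (simp add: indicator_def)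
    then show ?thesis by (subst nn_integral_lborel_reflect[symmetric]) simp_all
  qed
  ultimately show ?thesis by simp
qed

text \<open>Divides by a possibly degenerate quantity under the conventions
  \<open>1 / 0 = top\<close> and \<open>1 / top = 0\<close>: for \<open>x = top\<close> the
  hypothesis forces \<open>c = 0\<close>.\<close>

lemma ennreal_le_inverse:
  fixes x c :: ennreal
  assumes "c * x \<le> 1"
  shows "c \<le> inverse x"
proof (cases "x = 0")
  case False
  show ?thesis
  proof (cases "x = top")
    case True
    then have "c = 0" using assms by (cases "c = 0") (auto simp: ennreal_mult_top top_unique)
    then show ?thesis by simp
  next
    case False
    have "c = c * (x * inverse x)"
      using ennreal_divide_self[OF \<open>x \<noteq> 0\<close>] False by (simp add: divide_ennreal_def less_top)
    also have "\<dots> = c * x * inverse x" by (simp add: mult.assoc)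
    also have "\<dots> \<le> 1 * inverse x" using assms by (intro mult_right_mono) auto
    finally show ?thesis by simp
  qed
qed simp

lemma ennreal_mult_inverse_le: "(x::ennreal) * inverse x \<le> 1"
  using ennreal_divide_self[of x] by (cases "x = 0 \<or> x = top") (auto simp: divide_ennreal_def less_top)

section \<open>The weighted Hardy constant\<close>

lemma ennreal_tendsto_power2:
  fixes f :: "nat \<Rightarrow> ennreal"
  assumes lim: "f \<longlonglongrightarrow> x" and le: "\<And>n. f n \<le> x" and fin: "x < \<infinity>"
  shows "(\<lambda>n. (f n)\<^sup>2) \<longlonglongrightarrow> x\<^sup>2"
proof -
  have x: "x = ennreal (enn2real x)" using fin by simp
  have f: "f n = ennreal (enn2real (f n))" for n using le_less_trans[OF le fin, of n] by simp
  have "(\<lambda>n. ennreal (enn2real (f n))) \<longlonglongrightarrow> ennreal (enn2real x)" using lim x f by simp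
  then have "(\<lambda>n. enn2real (f n)) \<longlonglongrightarrow> enn2real x" by (rule tendsto_ennrealD) auto
  then have "(\<lambda>n. ennreal ((enn2real (f n))\<^sup>2)) \<longlonglongrightarrow> ennreal ((enn2real x)\<^sup>2)"
    by (intro tendsto_ennrealI tendsto_power)
  then show ?thesis using x f by (simp flip: ennreal_power)
qed

lemma tendsto_inverse_ennreal:
  fixes f :: "nat \<Rightarrow> ennreal"
  assumes "f \<longlonglongrightarrow> x"
  shows "(\<lambda>n. inverse (f n)) \<longlonglongrightarrow> inverse x"
proof -
  have "continuous_on UNIV (inverse :: ennreal \<Rightarrow> ennreal)"
    by (intro continuous_on_inverse_ennreal continuous_on_id)
  from continuous_on_tendsto_compose[OF this assms] show ?thesis by simp
qed

section \<open>Cut-off tails and upper bounds for the Rayleigh infimum\<close>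

context weighted_line
begin

lemma w_borel [measurable]: "w \<in> borel_measurable borel"
  using w_cont by (rule borel_measurable_continuous_onI)

lemma inverse_w_pos: "0 < 1 / w t"
  using w_pos[of t] by simp

abbreviation L :: "real \<Rightarrow> ennreal" where "L \<equiv> ltail (\<lambda>t. 1 / w t)"
abbreviation R :: "real \<Rightarrow> ennreal" where "R \<equiv> rtail (\<lambda>t. 1 / w t)"

definition lcut :: "nat \<Rightarrow> real \<Rightarrow> ennreal" where
  "lcut n x = (\<integral>\<^sup>+ r. ennreal (cutoff n x r) * ennreal (1 / w r) \<partial>lborel)"

text \<open>The cutoff is anchored at \<open>y\<close>, while the integration starts at
  \<open>t\<close>: the quotient of \<open>rcut n y t\<close> by \<open>rcut n y y\<close> is the
  value at \<open>t\<close> of the test function to the right of its plateau.\<close>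

definition rcut :: "nat \<Rightarrow> real \<Rightarrow> real \<Rightarrow> ennreal" where
  "rcut n y t = (\<integral>\<^sup>+ r \<in> {t..}. ennreal (cutoff n (- y) (- r)) * ennreal (1 / w r) \<partial>lborel)"

lemma cutoff_borel [measurable]: "cutoff n x \<in> borel_measurable borel"
  by (rule Cc_borel[OF cutoff_Cc])

lemma lcut_tendsto: "(\<lambda>n. lcut n x) \<longlonglongrightarrow> L x"
  unfolding lcut_def ltail_def by (rule nn_integral_cutoff_tendsto) auto

lemma rcut_tendsto:
  assumes "y \<le> t"
  shows "(\<lambda>n. rcut n y t) \<longlonglongrightarrow> R t"
proof -
  have "(\<lambda>n. \<integral>\<^sup>+ r. ennreal (cutoff n (- y) (- r)) * (ennreal (1 / w r) * indicator {t..} r) \<partial>lborel)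
      \<longlonglongrightarrow> (\<integral>\<^sup>+ r \<in> {y..}. (ennreal (1 / w r) * indicator {t..} r) \<partial>lborel)"
    by (rule nn_integral_cutoff_reflect_tendsto) (auto simp: indicator_def)
  moreover have "(\<integral>\<^sup>+ r \<in> {y..}. (ennreal (1 / w r) * indicator {t..} r) \<partial>lborel) = R t"
    unfolding rtail_def by (rule nn_integral_cong) (use assms in \<open>auto simp: indicator_def\<close>)
  ultimately show ?thesis by (simp add: rcut_def mult.assoc)
qed

lemma rcut_mono: "m \<le> n \<Longrightarrow> rcut m y t \<le> rcut n y t"
  unfolding rcut_def by (intro nn_integral_mono mult_right_mono ennreal_leI cutoff_mono) auto

lemma rcut_le: "rcut n y t \<le> R t"
  unfolding rcut_def rtail_def
proof (intro nn_integral_mono mult_right_mono)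
  fix r
  have "ennreal (cutoff n (- y) (- r)) * ennreal (1 / w r) \<le> 1 * ennreal (1 / w r)"
    using ennreal_leI[OF cutoff_bounds(2)] by (intro mult_right_mono) auto
  then show "ennreal (cutoff n (- y) (- r)) * ennreal (1 / w r) \<le> ennreal (1 / w r)" by simp
qed auto

lemma rcut_measurable [measurable]: "rcut n y \<in> borel_measurable borel"
proof -
  \<comment> \<open>The condition \<open>t \<le> r\<close> displays the integrand as a jointly
    measurable function of \<open>t\<close> and \<open>r\<close>.\<close>
  have "rcut n y = (\<lambda>t. \<integral>\<^sup>+ r. (if t \<le> r then ennreal (cutoff n (- y) (- r)) * ennreal (1 / w r) else 0) \<partial>lborel)"
    unfolding rcut_def by (intro ext nn_integral_cong) (auto simp: indicator_def)
  also have "\<dots> \<in> borel_measurable borel" by measurable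
  finally show ?thesis .
qed

text \<open>\<open>test_function\<close> with a cutoff on the left and a reflected one on the right,
  combined with the definition of the infimum. It is phrased in \<open>ennreal\<close>, and the tail
  as a product, so that the limit in \<open>n\<close> can be taken even if \<open>L x\<close> or
  \<open>R y\<close> is infinite.\<close>

lemma test_sequence:
  assumes xy: "x \<le> y" and pos: "0 < lcut n x" "0 < rcut n y y"
  shows "\<exists>f\<in>C1_compact_support. (\<forall>t\<in>{x..y}. f t = 1)
    \<and> (\<forall>t\<ge>y. 0 \<le> f t \<and> rcut n y t = ennreal (f t) * rcut n y y)
    \<and> ennreal (2 * rayleigh_inf) * (\<integral>\<^sup>+ t. ennreal (v t * (f t)\<^sup>2) \<partial>lborel) \<le> inverse (lcut n x) + inverse (rcut n y y)"
proof -
  have \<kappa>2_cont: "continuous_on UNIV (\<lambda>t. cutoff n (- y) (- t))"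
    by (rule reflect_cont[OF Cc_continuous[OF cutoff_Cc]])
  obtain r where r: "\<And>t. r \<le> \<bar>t\<bar> \<Longrightarrow> cutoff n (- y) t = 0" using cutoff_Cc[of n "- y"] unfolding Cc_def by blast
  have \<kappa>2: "(\<lambda>t. cutoff n (- y) (- t)) \<in> Cc"
    by (rule CcI[OF \<kappa>2_cont, of r]) (use r in simp)
  have s1: "(\<lambda>t. cutoff n x t / w t) \<in> Cc" using Cc_mult_right[OF cutoff_Cc inverse_w_cont] by simp
  have s2: "(\<lambda>t. cutoff n (- y) (- t) / w t) \<in> Cc" using Cc_mult_right[OF \<kappa>2 inverse_w_cont] by simp
  have nn: "0 \<le> cutoff n z t / w t'" for z t t' using w_pos[of t'] by (simp add: cutoff_bounds)
  define A where "A = (\<integral>t. cutoff n x t / w t \<partial>lborel)"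
  define C where "C = (\<integral>t. cutoff n (- y) (- t) / w t \<partial>lborel)"
  have prod_eq: "ennreal (cutoff n z t) * ennreal (1 / w t') = ennreal (cutoff n z t / w t')" for z t t'
    using w_pos[of t'] by (simp add: cutoff_bounds flip: ennreal_mult)
  have A: "lcut n x = ennreal A"
    unfolding lcut_def prod_eq A_def by (rule nn_integral_eq_integral) (use Cc_integrable[OF s1] nn in auto)
  have tail: "rcut n y t = ennreal (\<integral>r. indicator {t..} r * (cutoff n (- y) (- r) / w r) \<partial>lborel)" for t
  proof -
    have "rcut n y t = (\<integral>\<^sup>+ r. ennreal (indicator {t..} r * (cutoff n (- y) (- r) / w r)) \<partial>lborel)"
      unfolding rcut_def prod_eq by (rule nn_integral_cong) (auto simp: indicator_def)
    also have "\<dots> = ennreal (\<integral>r. indicator {t..} r * (cutoff n (- y) (- r) / w r) \<partial>lborel)"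
    proof (rule nn_integral_eq_integral)
      show "integrable lborel (\<lambda>r. indicator {t..} r * (cutoff n (- y) (- r) / w r))"
        using integrable_mult_indicator[OF _ Cc_integrable[OF s2], of "{t..}"] by simp
    qed (use nn in \<open>auto simp: indicator_def\<close>)
    finally show ?thesis .
  qed
  have C: "rcut n y y = ennreal C"
  proof -
    have eq: "(\<lambda>r. indicator {y..} r * (cutoff n (- y) (- r) / w r)) = (\<lambda>r. cutoff n (- y) (- r) / w r)"
      by (rule ext) (auto simp: indicator_def cutoff_zero)
    show ?thesis unfolding tail C_def eq ..
  qed
  have Apos: "A > 0" and Cpos: "C > 0" using pos by (auto simp: A C)
  obtain f where f: "f \<in> C1_compact_support" "\<And>t. t \<in> {x..y} \<Longrightarrow> f t = 1"
      "\<And>t. t \<ge> y \<Longrightarrow> f t = (\<integral>r. indicator {t..} r * (cutoff n (- y) (- r) / w r) \<partial>lborel) / C"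
      "2 * energy f f \<le> 1 / A + 1 / C"
    using test_function[OF cutoff_Cc cutoff_bounds cutoff_zero \<kappa>2 cutoff_bounds _ xy A_def Apos C_def Cpos]
    by (auto simp: cutoff_zero)
  have "0 \<le> f t \<and> rcut n y t = ennreal (f t) * rcut n y y" if "t \<ge> y" for t
  proof -
    have "0 \<le> (\<integral>r. indicator {t..} r * (cutoff n (- y) (- r) / w r) \<partial>lborel)"
      using nn by (intro integral_nonneg_AE AE_I2) (auto simp: indicator_def)
    then show ?thesis using Cpos by (simp add: f(3)[OF that] tail[of t] C flip: ennreal_mult)
  qed
  moreover have "ennreal (2 * rayleigh_inf) * (\<integral>\<^sup>+ t. ennreal (v t * (f t)\<^sup>2) \<partial>lborel)
      \<le> inverse (lcut n x) + inverse (rcut n y y)"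
  proof -
    have "2 * (rayleigh_inf * l2_inner \<nu> f f) \<le> 1 / A + 1 / C"
      using rayleigh_inf_le[OF f(1)] f(4) by linarith
    then have "ennreal (2 * rayleigh_inf * l2_inner \<nu> f f) \<le> ennreal (1 / A + 1 / C)" by (intro ennreal_leI) simp
    also have "\<dots> = inverse (lcut n x) + inverse (rcut n y y)"
      using Apos Cpos by (simp add: A C inverse_ennreal divide_inverse)
    finally show ?thesis
      using rayleigh_inf_nonneg by (simp add: nn_integral_\<nu>_self[OF f(1)] l2_inner_self_nonneg ennreal_mult)
  qed
  ultimately show ?thesis using f(1,2) by blast
qed

lemma eventually_cut_pos:
  "\<forall>\<^sub>F n in sequentially. 0 < lcut n x \<and> 0 < rcut n y y"
  using order_tendstoD(1)[OF lcut_tendsto ltail_pos[OF inverse_w_cont inverse_w_pos]]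
    order_tendstoD(1)[OF rcut_tendsto[OF order_refl] rtail_pos[OF inverse_w_cont inverse_w_pos]]
  by (rule eventually_conj)

lemma cut_inverse_tendsto:
  "(\<lambda>n. inverse (lcut n x) + inverse (rcut n y y)) \<longlonglongrightarrow> inverse (L x) + inverse (R y)"
  by (intro tendsto_add tendsto_inverse_ennreal lcut_tendsto rcut_tendsto order_refl)

text \<open>Only the mass on the plateau, where the test function is 1, is kept. An infinite tail
  drops out of the right-hand side in the limit; letting the plateau grow in its direction yields
  the one-sided bounds.\<close>

lemma rayleigh_inf_plateau:
  assumes xy: "x \<le> y"
  shows "ennreal (2 * rayleigh_inf) * (\<integral>\<^sup>+ t \<in> {x..y}. ennreal (v t) \<partial>lborel) \<le> inverse (L x) + inverse (R y)"
proof (rule tendsto_lowerbound[OF cut_inverse_tendsto])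
  show "\<forall>\<^sub>F n in sequentially. ennreal (2 * rayleigh_inf) * (\<integral>\<^sup>+ t \<in> {x..y}. ennreal (v t) \<partial>lborel)
      \<le> inverse (lcut n x) + inverse (rcut n y y)"
    using eventually_cut_pos[of x y]
  proof eventually_elim
    case (elim n)
    then obtain f where f: "\<And>t. t \<in> {x..y} \<Longrightarrow> f t = 1"
        "ennreal (2 * rayleigh_inf) * (\<integral>\<^sup>+ t. ennreal (v t * (f t)\<^sup>2) \<partial>lborel) \<le> inverse (lcut n x) + inverse (rcut n y y)"
      using test_sequence[OF xy, of n] by blast
    have "(\<integral>\<^sup>+ t \<in> {x..y}. ennreal (v t) \<partial>lborel) \<le> (\<integral>\<^sup>+ t. ennreal (v t * (f t)\<^sup>2) \<partial>lborel)"
      by (intro nn_integral_mono) (use f(1) in \<open>auto simp: indicator_def\<close>)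
    then show ?case using f(2) by (meson mult_left_mono order_trans zero_le)
  qed
qed simp

text \<open>Here the plateau is a single point and the mass on the decaying side is kept: there the
  test functions tend to \<open>R t / R x\<close>, which produces the weight
  \<open>(R t)\<^sup>2\<close> of the two-sided Omega. Multiplication by
  \<open>(R x)\<^sup>2\<close> clears the denominators.\<close>

lemma rayleigh_inf_right_decay:
  assumes fin: "R x < \<infinity>"
  shows "ennreal (2 * rayleigh_inf) * (\<integral>\<^sup>+ t \<in> {x..}. ((R t)\<^sup>2 * ennreal (v t)) \<partial>lborel)
    \<le> (R x)\<^sup>2 * (inverse (L x) + inverse (R x))"
proof -
  have fin': "R t < \<infinity>" for t
    by (rule rtail_finite[OF inverse_w_cont less_imp_le[OF inverse_w_pos] fin])
  \<comment> \<open>The two limits are decoupled. For fixed \<open>m\<close> and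
    \<open>n \<ge> m\<close> the cut tail with index \<open>m\<close> is below
    \<open>f t * R x\<close>, so \<open>n\<close> can go to infinity on the right first and
    \<open>m\<close> on the left afterwards.\<close>
  have m: "ennreal (2 * rayleigh_inf) * (\<integral>\<^sup>+ t \<in> {x..}. ((rcut m x t)\<^sup>2 * ennreal (v t)) \<partial>lborel)
      \<le> (R x)\<^sup>2 * (inverse (L x) + inverse (R x))" for m
  proof (rule tendsto_lowerbound)
    show "(\<lambda>n. (R x)\<^sup>2 * (inverse (lcut n x) + inverse (rcut n x x))) \<longlonglongrightarrow> (R x)\<^sup>2 * (inverse (L x) + inverse (R x))"
      using fin by (intro ennreal_tendsto_cmult cut_inverse_tendsto) (simp add: power_less_top_ennreal)
    show "\<forall>\<^sub>F n in sequentially. ennreal (2 * rayleigh_inf) * (\<integral>\<^sup>+ t \<in> {x..}. ((rcut m x t)\<^sup>2 * ennreal (v t)) \<partial>lborel)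
        \<le> (R x)\<^sup>2 * (inverse (lcut n x) + inverse (rcut n x x))"
      using eventually_cut_pos[of x x] eventually_ge_at_top[of m]
    proof eventually_elim
      case (elim n)
      then obtain f where f: "f \<in> C1_compact_support" "\<And>t. x \<le> t \<Longrightarrow> 0 \<le> f t" "\<And>t. x \<le> t \<Longrightarrow> rcut n x t = ennreal (f t) * rcut n x x"
          "ennreal (2 * rayleigh_inf) * (\<integral>\<^sup>+ t. ennreal (v t * (f t)\<^sup>2) \<partial>lborel) \<le> inverse (lcut n x) + inverse (rcut n x x)"
        using test_sequence[OF order_refl, of n x] by blast
      have [measurable]: "f \<in> borel_measurable borel" using f(1) by (intro Cc_borel C1_compact_support_Cc)
      have "(\<integral>\<^sup>+ t \<in> {x..}. ((rcut m x t)\<^sup>2 * ennreal (v t)) \<partial>lborel)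
          \<le> (\<integral>\<^sup>+ t. (R x)\<^sup>2 * ennreal (v t * (f t)\<^sup>2) \<partial>lborel)"
      proof (rule nn_integral_mono)
        fix t
        show "(rcut m x t)\<^sup>2 * ennreal (v t) * indicator {x..} t \<le> (R x)\<^sup>2 * ennreal (v t * (f t)\<^sup>2)"
        proof (cases "x \<le> t")
          case True
          have "rcut m x t \<le> ennreal (f t) * rcut n x x"
            using rcut_mono[of m n x t] elim f(3)[OF True] by simp
          also have "\<dots> \<le> ennreal (f t) * R x" by (intro mult_left_mono rcut_le) simp
          finally have "(rcut m x t)\<^sup>2 \<le> (ennreal (f t) * R x)\<^sup>2" by (rule power_mono) simp
          then have "(rcut m x t)\<^sup>2 * ennreal (v t) \<le> (ennreal (f t) * R x)\<^sup>2 * ennreal (v t)"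
            by (rule mult_right_mono) simp
          also have "\<dots> = (R x)\<^sup>2 * ennreal (v t * (f t)\<^sup>2)"
            using f(2)[OF True] v_pos[of t]
            by (simp add: power_mult_distrib ennreal_mult less_imp_le ennreal_power mult.assoc mult.left_commute mult.commute)
          finally show ?thesis using True by simp
        qed simp
      qed
      also have "\<dots> = (R x)\<^sup>2 * (\<integral>\<^sup>+ t. ennreal (v t * (f t)\<^sup>2) \<partial>lborel)"
        by (rule nn_integral_cmult) measurable
      finally have "ennreal (2 * rayleigh_inf) * (\<integral>\<^sup>+ t \<in> {x..}. ((rcut m x t)\<^sup>2 * ennreal (v t)) \<partial>lborel)
          \<le> ennreal (2 * rayleigh_inf) * ((R x)\<^sup>2 * (\<integral>\<^sup>+ t. ennreal (v t * (f t)\<^sup>2) \<partial>lborel))"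
        by (rule mult_left_mono) simp
      also have "\<dots> = (R x)\<^sup>2 * (ennreal (2 * rayleigh_inf) * (\<integral>\<^sup>+ t. ennreal (v t * (f t)\<^sup>2) \<partial>lborel))"
        by (rule mult.left_commute)
      also have "\<dots> \<le> (R x)\<^sup>2 * (inverse (lcut n x) + inverse (rcut n x x))"
        using f(4) by (rule mult_left_mono) simp
      finally show ?case .
    qed
  qed simp
  have lim: "(\<lambda>m. \<integral>\<^sup>+ t \<in> {x..}. ((rcut m x t)\<^sup>2 * ennreal (v t)) \<partial>lborel)
      \<longlonglongrightarrow> (\<integral>\<^sup>+ t \<in> {x..}. ((R t)\<^sup>2 * ennreal (v t)) \<partial>lborel)"
  proof (rule nn_integral_LIMSEQ)
    show "incseq (\<lambda>m t. (rcut m x t)\<^sup>2 * ennreal (v t) * indicator {x..} t)"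
      by (auto simp: incseq_def le_fun_def intro!: mult_right_mono power_mono rcut_mono)
    show "(\<lambda>m. (rcut m x t)\<^sup>2 * ennreal (v t) * indicator {x..} t) \<longlonglongrightarrow> (R t)\<^sup>2 * ennreal (v t) * indicator {x..} t" for t
    proof (cases "x \<le> t")
      case True
      have "(\<lambda>m. (rcut m x t)\<^sup>2) \<longlonglongrightarrow> (R t)\<^sup>2"
        by (rule ennreal_tendsto_power2[OF rcut_tendsto[OF True] rcut_le fin'])
      from ennreal_tendsto_cmult[OF _ this, of "ennreal (v t)"] show ?thesis
        using True by (simp add: mult.commute)
    qed simp
  qed measurable
  show ?thesis
  proof (rule tendsto_upperbound[OF ennreal_tendsto_cmult[OF _ lim]])
    show "\<forall>\<^sub>F m in sequentially. ennreal (2 * rayleigh_inf) * (\<integral>\<^sup>+ t \<in> {x..}. ((rcut m x t)\<^sup>2 * ennreal (v t)) \<partial>lborel)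
        \<le> (R x)\<^sup>2 * (inverse (L x) + inverse (R x))"
      using m by simp
  qed simp_all
qed

lemma tail_sum: "L x + R x = (\<integral>\<^sup>+ t. ennreal (1 / w t) \<partial>lborel)"
proof -
  have "L x + R x = (\<integral>\<^sup>+ t. ennreal (1 / w t) * indicator {..x} t + ennreal (1 / w t) * indicator {x..} t \<partial>lborel)"
    unfolding ltail_def rtail_def by (rule nn_integral_add[symmetric]) measurable
  also have "\<dots> = (\<integral>\<^sup>+ t. ennreal (1 / w t) \<partial>lborel)"
    by (rule nn_integral_cong_AE)
      (use AE_lborel_singleton[of x] in \<open>eventually_elim, auto simp: indicator_def\<close>)
  finally show ?thesis .
qed

section \<open>Omega in terms of the two weights; the two-sided case\<close>

definition omega :: ennreal where
  "omega =
     (if R 0 = \<infinity> \<and> L 0 = \<infinity> then \<infinity>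
      else if R 0 = \<infinity> \<and> L 0 < \<infinity> then (SUP x. L x * rtail v x)
      else if R 0 < \<infinity> \<and> L 0 = \<infinity> then (SUP x. R x * ltail v x)
      else (SUP x. (\<integral>\<^sup>+ y \<in> {..x}. (1 / (R y)\<^sup>2) * ennreal (1 / w y) \<partial>lborel)
              * (\<integral>\<^sup>+ y \<in> {x..}. (R y)\<^sup>2 * ennreal (v y) \<partial>lborel)))"

lemma L_finite: "L 0 < \<infinity> \<Longrightarrow> L x < \<infinity>"
  by (rule ltail_finite[OF inverse_w_cont less_imp_le[OF inverse_w_pos]])

lemma R_finite: "R 0 < \<infinity> \<Longrightarrow> R x < \<infinity>"
  by (rule rtail_finite[OF inverse_w_cont less_imp_le[OF inverse_w_pos]])

lemma L_infinite: "L 0 = \<infinity> \<Longrightarrow> L x = \<infinity>"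
  using ltail_finite[OF inverse_w_cont less_imp_le[OF inverse_w_pos], of x 0]
  by (metis infinity_ennreal_def less_top)

lemma R_infinite: "R 0 = \<infinity> \<Longrightarrow> R x = \<infinity>"
  using rtail_finite[OF inverse_w_cont less_imp_le[OF inverse_w_pos], of x 0]
  by (metis infinity_ennreal_def less_top)

lemma L_pos: "0 < L x" and R_pos: "0 < R x"
  by (rule ltail_pos[OF inverse_w_cont inverse_w_pos], rule rtail_pos[OF inverse_w_cont inverse_w_pos])

end

locale weighted_line_two_sided = weighted_line +
  assumes L_fin: "L 0 < \<infinity>" and R_fin: "R 0 < \<infinity>"
begin

definition h :: "real \<Rightarrow> real" where "h x = enn2real (R x)"
text \<open>The value of \<open>h\<close> at minus infinity.\<close>

definition H :: real where "H = enn2real (\<integral>\<^sup>+ t. ennreal (1 / w t) \<partial>lborel)"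

lemma R_eq: "R x = ennreal (h x)"
  using R_finite[OF R_fin, of x] by (simp add: h_def)

lemma L_eq: "L x = ennreal (enn2real (L x))"
  using L_finite[OF L_fin, of x] by simp

lemma h_pos: "0 < h x"
  using R_pos[of x] by (simp add: R_eq)

lemma total_eq: "(\<integral>\<^sup>+ t. ennreal (1 / w t) \<partial>lborel) = ennreal H"
  using L_fin R_fin by (simp add: H_def flip: tail_sum[of 0])

lemma L_h: "enn2real (L x) + h x = H"
proof -
  have "ennreal (enn2real (L x) + h x) = ennreal H"
    using tail_sum[of x] less_imp_le[OF h_pos[of x]]
    by (subst ennreal_plus) (simp_all add: total_eq R_eq[of x] L_eq[symmetric])
  moreover have "0 \<le> H" by (simp add: H_def)
  ultimately show ?thesis using less_imp_le[OF h_pos[of x]] by (subst (asm) ennreal_inj) simp_all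
qed

lemma h_less_H: "h x < H"
proof -
  have "0 < enn2real (L x)" using L_pos[of x] by (subst (asm) L_eq) simp
  then show ?thesis using L_h[of x] by simp
qed

lemma h_deriv: "(h has_real_derivative - 1 / w x) (at x)"
  using rtail_has_derivative[OF inverse_w_cont less_imp_le[OF inverse_w_pos] R_fin, of x]
  unfolding h_def[abs_def] by simp

lemma h_cont: "continuous_on S h"
  using h_deriv by (meson DERIV_isCont continuous_at_imp_continuous_on)

lemma h_tendsto_H: "(\<lambda>n. h (- real n)) \<longlonglongrightarrow> H"
proof -
  have "(\<Union>n. {- real n..}) = UNIV"
  proof (intro equalityI subsetI UNIV_I)
    fix x :: real
    obtain n where "- x \<le> real n" using real_arch_simple by blast
    then show "x \<in> (\<Union>n. {- real n..})" by (auto intro!: exI[of _ n])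
  qed
  moreover have "(\<lambda>n. \<integral>\<^sup>+ t \<in> {- real n..}. ennreal (1 / w t) \<partial>lborel)
      \<longlonglongrightarrow> (\<integral>\<^sup>+ t \<in> (\<Union>n. {- real n..}). ennreal (1 / w t) \<partial>lborel)"
    by (rule nn_integral_incseq_sets) (auto simp: incseq_def)
  ultimately have "(\<lambda>n. R (- real n)) \<longlonglongrightarrow> (\<integral>\<^sup>+ t. ennreal (1 / w t) \<partial>lborel)"
    by (simp add: rtail_def)
  then have "(\<lambda>n. ennreal (h (- real n))) \<longlonglongrightarrow> ennreal H" by (simp add: R_eq total_eq)
  then show ?thesis
    by (rule tendsto_ennrealD) (auto simp: H_def less_imp_le[OF h_pos])
qed

text \<open>\<open>1 / h\<close> has derivative \<open>1 / (w * h\<^sup>2)\<close>, so the integral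
  over \<open>[-n, x]\<close> is a difference of values of \<open>1 / h\<close>, and
  \<open>h (- n)\<close> tends to \<open>H\<close>. This is the identity behind the two expressions
  for Omega when both tails are finite.\<close>

lemma left_weight_integral:
  "(\<integral>\<^sup>+ y \<in> {..x}. (1 / (R y)\<^sup>2) * ennreal (1 / w y) \<partial>lborel) = ennreal (1 / h x - 1 / H)"
proof -
  define g where "g y = 1 / w y / (h y)\<^sup>2" for y
  have g_cont: "continuous_on UNIV g"
    unfolding g_def using h_pos by (intro continuous_intros inverse_w_cont h_cont) (auto simp: less_imp_neq[symmetric])
  have [measurable]: "g \<in> borel_measurable borel" using g_cont by (rule borel_measurable_continuous_onI)
  have g_nonneg: "0 \<le> g y" for y using w_pos[of y] by (simp add: g_def)
  have g_eq: "(1 / (R y)\<^sup>2) * ennreal (1 / w y) = ennreal (g y)" for y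
  proof -
    have "1 / (R y)\<^sup>2 = ennreal (1 / (h y)\<^sup>2)"
      using h_pos[of y] divide_ennreal[of 1 "(h y)\<^sup>2"] by (simp add: R_eq ennreal_power)
    then show ?thesis using w_pos[of y] by (simp add: g_def mult.commute flip: ennreal_mult)
  qed
  have d: "((\<lambda>y. 1 / h y) has_real_derivative g y) (at y)" for y
    unfolding g_def using h_pos[of y]
    by (auto intro!: derivative_eq_intros h_deriv simp: power2_eq_square)
  have U: "(\<Union>n. {- real n..x}) = {..x}"
  proof (intro equalityI subsetI)
    fix y assume "y \<in> {..x}"
    obtain n where "- y \<le> real n" using real_arch_simple by blast
    then show "y \<in> (\<Union>n. {- real n..x})" using \<open>y \<in> {..x}\<close> by (auto intro!: exI[of _ n])
  qed auto
  have 1: "(\<lambda>n. \<integral>\<^sup>+ y \<in> {- real n..x}. ennreal (g y) \<partial>lborel) \<longlonglongrightarrow> (\<integral>\<^sup>+ y \<in> {..x}. ennreal (g y) \<partial>lborel)"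
    unfolding U[symmetric] by (rule nn_integral_incseq_sets) (auto simp: incseq_def)
  have 2: "(\<lambda>n. \<integral>\<^sup>+ y \<in> {- real n..x}. ennreal (g y) \<partial>lborel) \<longlonglongrightarrow> ennreal (1 / h x - 1 / H)"
  proof (rule Lim_transform_eventually)
    show "(\<lambda>n. ennreal (1 / h x - 1 / h (- real n))) \<longlonglongrightarrow> ennreal (1 / h x - 1 / H)"
      using h_less_H[of 0] h_pos[of 0] by (intro tendsto_ennrealI tendsto_intros h_tendsto_H) simp
    obtain N where N: "- x \<le> real N" using real_arch_simple by blast
    show "\<forall>\<^sub>F n in sequentially. ennreal (1 / h x - 1 / h (- real n)) = (\<integral>\<^sup>+ y \<in> {- real n..x}. ennreal (g y) \<partial>lborel)"
      using eventually_ge_at_top[of N]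
    proof eventually_elim
      case (elim n)
      then have "- real n \<le> x" using N by simp
      then show ?case by (intro nn_integral_FTC_Icc[symmetric]) (use d g_nonneg in auto)
    qed
  qed
  show ?thesis unfolding g_eq using LIMSEQ_unique[OF 1 2] .
qed

lemma right_weight_eq: "(\<integral>\<^sup>+ y \<in> {x..}. (R y)\<^sup>2 * ennreal (v y) \<partial>lborel) = rtail (\<lambda>y. (h y)\<^sup>2 * v y) x"
  unfolding rtail_def[of "\<lambda>y. (h y)\<^sup>2 * v y"]
  using h_pos v_pos by (simp add: R_eq ennreal_mult less_imp_le ennreal_power)

lemma omega_two_sided: "omega = (SUP x. ennreal (1 / h x - 1 / H) * rtail (\<lambda>y. (h y)\<^sup>2 * v y) x)"
  using L_fin R_fin unfolding omega_def left_weight_integral right_weight_eq by auto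

end

section \<open>Both bounds in terms of \<open>omega\<close>\<close>

context weighted_line
begin

lemma v_integral_pos: "x < y \<Longrightarrow> 0 < (\<integral>\<^sup>+ t \<in> {x..y}. ennreal (v t) \<partial>lborel)"
proof -
  assume xy: "x < y"
  obtain F where F: "\<And>t. (F has_real_derivative v t) (at t)"
    using continuous_antiderivative[OF v_cont] by blast
  have "F x < F y" by (rule DERIV_pos_imp_increasing[OF xy]) (use F v_pos in auto)
  moreover have "(\<integral>\<^sup>+ t \<in> {x..y}. ennreal (v t) \<partial>lborel) = ennreal (F y - F x)"
    by (rule nn_integral_FTC_Icc) (use F v_pos xy in \<open>auto simp: less_imp_le\<close>)
  ultimately show ?thesis by simp
qed

lemma mult_le_one_of_le_inverse:
  fixes c F V :: ennreal
  assumes "c * V \<le> inverse F"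
  shows "c * (F * V) \<le> 1"
proof -
  have "c * (F * V) = F * (c * V)" by (simp add: mult.left_commute)
  also have "\<dots> \<le> F * inverse F" using assms by (rule mult_left_mono) simp
  also have "\<dots> \<le> 1" by (rule ennreal_mult_inverse_le)
  finally show ?thesis .
qed

text \<open>The upper bound in product form, in which zero and infinite values of
  \<open>omega\<close> need no separate conventions.\<close>

lemma rayleigh_inf_mult_omega: "ennreal (2 * rayleigh_inf) * omega \<le> 1"
proof -
  let ?c = "ennreal (2 * rayleigh_inf)"
  consider (both) "R 0 = \<infinity>" "L 0 = \<infinity>" | (left) "R 0 = \<infinity>" "L 0 < \<infinity>"
    | (right) "R 0 < \<infinity>" "L 0 = \<infinity>" | (two) "R 0 < \<infinity>" "L 0 < \<infinity>"
    by (cases "R 0 = \<infinity>"; cases "L 0 = \<infinity>") (auto simp: less_top)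
  then show ?thesis
  proof cases
    case both
    \<comment> \<open>Both inverse tails are 0, so the infimum vanishes and the product is
      \<open>0 * top = 0\<close>.\<close>
    have "?c * (\<integral>\<^sup>+ t \<in> {0..1}. ennreal (v t) \<partial>lborel) \<le> 0"
      using rayleigh_inf_plateau[of 0 1] L_infinite[OF both(2), of 0] R_infinite[OF both(1), of 1] by simp
    then have "?c = 0" using v_integral_pos[of 0 1] by (auto simp: less_imp_neq[symmetric])
    then show ?thesis by (simp only: mult_zero_left) simp
  next
    case left
    have "?c * (L x * rtail v x) \<le> 1" for x
    proof (rule mult_le_one_of_le_inverse)
      have U: "(\<Union>n. {x..x + real n}) = {x..}"
      proof (intro equalityI subsetI)
        fix y assume "y \<in> {x..}"
        obtain n where "y - x \<le> real n" using real_arch_simple by blast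
        then show "y \<in> (\<Union>n. {x..x + real n})" using \<open>y \<in> {x..}\<close> by (auto intro!: exI[of _ n])
      qed auto
      have "(\<lambda>n. \<integral>\<^sup>+ t \<in> {x..x + real n}. ennreal (v t) \<partial>lborel) \<longlonglongrightarrow> rtail v x"
        unfolding rtail_def U[symmetric] by (rule nn_integral_incseq_sets) (auto simp: incseq_def)
      \<comment> \<open>The plateau is extended to the right, where the tail of \<open>1 / w\<close>
        is infinite and costs nothing.\<close>
      then have "(\<lambda>n. ?c * (\<integral>\<^sup>+ t \<in> {x..x + real n}. ennreal (v t) \<partial>lborel)) \<longlonglongrightarrow> ?c * rtail v x"
        by (intro ennreal_tendsto_cmult) simp_all
      then show "?c * rtail v x \<le> inverse (L x)"
        by (rule LIMSEQ_le_const2)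
          (use rayleigh_inf_plateau[of x "x + real _"] R_infinite[OF left(1)] in auto)
    qed
    then have "?c * (SUP x. L x * rtail v x) \<le> 1" unfolding SUP_mult_left_ennreal by (intro SUP_least)
    then show ?thesis using left less_imp_neq[OF left(2)] by (simp add: omega_def)
  next
    case right
    have "?c * (R x * ltail v x) \<le> 1" for x
    proof (rule mult_le_one_of_le_inverse)
      have U: "(\<Union>n. {x - real n..x}) = {..x}"
      proof (intro equalityI subsetI)
        fix y assume "y \<in> {..x}"
        obtain n where "x - y \<le> real n" using real_arch_simple by blast
        then show "y \<in> (\<Union>n. {x - real n..x})" using \<open>y \<in> {..x}\<close> by (auto intro!: exI[of _ n])
      qed auto
      have "(\<lambda>n. \<integral>\<^sup>+ t \<in> {x - real n..x}. ennreal (v t) \<partial>lborel) \<longlonglongrightarrow> ltail v x"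
        unfolding ltail_def U[symmetric] by (rule nn_integral_incseq_sets) (auto simp: incseq_def)
      then have "(\<lambda>n. ?c * (\<integral>\<^sup>+ t \<in> {x - real n..x}. ennreal (v t) \<partial>lborel)) \<longlonglongrightarrow> ?c * ltail v x"
        by (intro ennreal_tendsto_cmult) simp_all
      then show "?c * ltail v x \<le> inverse (R x)"
        by (rule LIMSEQ_le_const2)
          (use rayleigh_inf_plateau[of "x - real _" x] L_infinite[OF right(2)] in auto)
    qed
    then have "?c * (SUP x. R x * ltail v x) \<le> 1" unfolding SUP_mult_left_ennreal by (intro SUP_least)
    then show ?thesis using right less_imp_neq[OF right(1)] by (simp add: omega_def)
  next
    case two
    interpret weighted_line_two_sided w v by unfold_locales (use two in auto)
    have "?c * (ennreal (1 / h x - 1 / H) * rtail (\<lambda>y. (h y)\<^sup>2 * v y) x) \<le> 1" for x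
    proof (rule mult_le_one_of_le_inverse)
      have "enn2real (L x) = H - h x" using L_h[of x] by linarith
      then have l: "L x = ennreal (H - h x)" by (subst L_eq) simp
      have hH: "0 < h x" "h x < H" using h_pos h_less_H by auto
      have "?c * rtail (\<lambda>y. (h y)\<^sup>2 * v y) x \<le> (R x)\<^sup>2 * (inverse (L x) + inverse (R x))"
        using rayleigh_inf_right_decay[OF R_finite[OF R_fin]] unfolding right_weight_eq .
      also have "\<dots> = ennreal ((h x)\<^sup>2 * (inverse (H - h x) + inverse (h x)))"
      proof -
        have "inverse (L x) + inverse (R x) = ennreal (inverse (H - h x) + inverse (h x))"
          using hH by (simp add: R_eq l inverse_ennreal)
        moreover have "(R x)\<^sup>2 = ennreal ((h x)\<^sup>2)" using hH by (simp add: R_eq ennreal_power)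
        ultimately show ?thesis using hH by (simp add: ennreal_mult)
      qed
      \<comment> \<open>Since \<open>1 / (H - h) + 1 / h = H / (h * (H - h))\<close>, the product is
        \<open>h * H / (H - h)\<close>, the reciprocal of the left factor in
        \<open>omega\<close>.\<close>
      also have "(h x)\<^sup>2 * (inverse (H - h x) + inverse (h x)) = inverse (1 / h x - 1 / H)"
        using hH by (simp add: field_simps power2_eq_square)
      also have "ennreal (inverse (1 / h x - 1 / H)) = inverse (ennreal (1 / h x - 1 / H))"
        using hH by (intro inverse_ennreal[symmetric]) (simp add: field_simps)
      finally show "?c * rtail (\<lambda>y. (h y)\<^sup>2 * v y) x \<le> inverse (ennreal (1 / h x - 1 / H))" .
    qed
    then show ?thesis unfolding omega_two_sided SUP_mult_left_ennreal by (intro SUP_least)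
  qed
qed

text \<open>A finite product with a nonzero first factor forces the second to be finite. This
  supplies the antiderivatives \<open>V\<close> of the barrier lemmas as real functions.\<close>

lemma tail_product_real:
  fixes F G :: "real \<Rightarrow> ennreal"
  assumes le: "\<And>x. F x * G x \<le> ennreal \<omega>" and F: "\<And>x. 0 < F x" and \<omega>: "\<omega> > 0"
  shows "G x < \<infinity>" "enn2real (F x) * enn2real (G x) \<le> \<omega>"
proof -
  have "F x * G x < top" using le[of x] by (simp add: le_less_trans)
  then show "G x < \<infinity>" using F[of x] by (auto simp: ennreal_mult_less_top less_top)
  have "enn2real (F x * G x) \<le> \<omega>" using le[of x] \<omega> by (simp add: enn2real_leI)
  then show "enn2real (F x) * enn2real (G x) \<le> \<omega>" by (simp add: enn2real_mult)
qed

text \<open>Stated for every positive real above \<open>omega\<close>, so that it can also be used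
  to rule out \<open>omega = 0\<close>.\<close>

lemma rayleigh_inf_ge_of_omega_le:
  assumes \<omega>: "\<omega> > 0" and le: "omega \<le> ennreal \<omega>"
  shows "1 / (8 * \<omega>) \<le> rayleigh_inf"
proof -
  consider (both) "R 0 = \<infinity>" "L 0 = \<infinity>" | (left) "R 0 = \<infinity>" "L 0 < \<infinity>"
    | (right) "R 0 < \<infinity>" "L 0 = \<infinity>" | (two) "R 0 < \<infinity>" "L 0 < \<infinity>"
    by (cases "R 0 = \<infinity>"; cases "L 0 = \<infinity>") (auto simp: less_top)
  then show ?thesis
  proof cases
    case both
    then show ?thesis using le by (simp add: omega_def top_unique)
  next
    case left
    have prod: "L x * rtail v x \<le> ennreal \<omega>" for x
      using le left less_imp_neq[OF left(2)] by (simp add: omega_def SUP_le_iff)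
    have Vfin: "rtail v 0 < \<infinity>" by (rule tail_product_real(1)[OF prod L_pos \<omega>])
    show ?thesis
    proof (rule rayleigh_inf_ge_one_sided[where \<sigma> = 1 and A = "\<lambda>x. enn2real (L x)" and V = "\<lambda>x. enn2real (rtail v x)"])
      show "((\<lambda>x. enn2real (L x)) has_real_derivative 1 / w x) (at x)" for x
        by (rule ltail_has_derivative[OF inverse_w_cont less_imp_le[OF inverse_w_pos] left(2)])
      show "0 < enn2real (L x)" for x using L_pos[of x] L_finite[OF left(2)] by (simp add: enn2real_positive_iff)
      show "((\<lambda>x. enn2real (rtail v x)) has_real_derivative - (1 * v x)) (at x)" for x
        using rtail_has_derivative[OF v_cont less_imp_le[OF v_pos] Vfin] by simp
      show "enn2real (L x) * enn2real (rtail v x) \<le> \<omega>" for x by (rule tail_product_real(2)[OF prod L_pos \<omega>])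
    qed (use \<omega> in auto)
  next
    case right
    have prod: "R x * ltail v x \<le> ennreal \<omega>" for x
      using le right less_imp_neq[OF right(1)] by (simp add: omega_def SUP_le_iff)
    have Vfin: "ltail v 0 < \<infinity>" by (rule tail_product_real(1)[OF prod R_pos \<omega>])
    show ?thesis
    proof (rule rayleigh_inf_ge_one_sided[where \<sigma> = "- 1" and A = "\<lambda>x. enn2real (R x)" and V = "\<lambda>x. enn2real (ltail v x)"])
      show "((\<lambda>x. enn2real (R x)) has_real_derivative - 1 / w x) (at x)" for x
        using rtail_has_derivative[OF inverse_w_cont less_imp_le[OF inverse_w_pos] right(1)] by simp
      show "0 < enn2real (R x)" for x using R_pos[of x] R_finite[OF right(1)] by (simp add: enn2real_positive_iff)
      show "((\<lambda>x. enn2real (ltail v x)) has_real_derivative - (- 1 * v x)) (at x)" for x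
        using ltail_has_derivative[OF v_cont less_imp_le[OF v_pos] Vfin] by simp
      show "enn2real (R x) * enn2real (ltail v x) \<le> \<omega>" for x by (rule tail_product_real(2)[OF prod R_pos \<omega>])
    qed (use \<omega> in auto)
  next
    case two
    interpret weighted_line_two_sided w v by unfold_locales (use two in auto)
    have A_pos: "0 < 1 / h x - 1 / H" for x
      using h_pos[of x] h_less_H[of x] by (simp add: field_simps)
    let ?u = "\<lambda>y. (h y)\<^sup>2 * v y"
    have u_cont: "continuous_on UNIV ?u" by (intro continuous_intros h_cont v_cont)
    have u_nonneg: "0 \<le> ?u y" for y using v_pos[of y] by simp
    have prod: "ennreal (1 / h x - 1 / H) * rtail ?u x \<le> ennreal \<omega>" for x
      using le by (simp add: omega_two_sided SUP_le_iff)
    have epos: "0 < ennreal (1 / h x - 1 / H)" for x using A_pos by simp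
    have Vfin: "rtail ?u 0 < \<infinity>" by (rule tail_product_real(1)[OF prod epos \<omega>])
    show ?thesis
    proof (rule rayleigh_inf_ge_two_sided[OF \<omega> h_deriv h_pos, where k = "1 / H" and A = "\<lambda>x. 1 / h x - 1 / H"
          and V = "\<lambda>x. enn2real (rtail ?u x)"])
      show "((\<lambda>x. enn2real (rtail ?u x)) has_real_derivative - ?u x) (at x)" for x
        by (rule rtail_has_derivative[OF u_cont u_nonneg Vfin])
      show "(1 / h x - 1 / H) * enn2real (rtail ?u x) \<le> \<omega>" for x
      proof -
        have "enn2real (ennreal (1 / h x - 1 / H)) * enn2real (rtail ?u x) \<le> \<omega>"
          by (rule tail_product_real(2)[where F = "\<lambda>x. ennreal (1 / h x - 1 / H)" and G = "rtail ?u", OF prod epos \<omega>])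
        then show ?thesis using less_imp_le[OF A_pos[of x]] by simp
      qed
    qed (use A_pos in auto)
  qed
qed

theorem rayleigh_inf_le_omega: "ennreal rayleigh_inf \<le> 1 / (2 * omega)"
proof (rule divide_ennreal_def[THEN ssubst], simp, rule ennreal_le_inverse)
  have "ennreal (2 * rayleigh_inf) = ennreal rayleigh_inf * 2"
    using rayleigh_inf_nonneg by (simp add: ennreal_mult mult.commute)
  then show "ennreal rayleigh_inf * (2 * omega) \<le> 1"
    using rayleigh_inf_mult_omega by (simp add: mult.assoc)
qed

theorem rayleigh_inf_ge_omega: "1 / (8 * omega) \<le> ennreal rayleigh_inf"
proof (cases "omega = \<infinity>")
  case True
  then show ?thesis by (simp add: ennreal_mult_top)
next
  case False
  then obtain r where r: "0 \<le> r" "omega = ennreal r" by (cases omega) auto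
  have bound: "1 / (8 * \<omega>) \<le> rayleigh_inf" if "\<omega> > 0" "r \<le> \<omega>" for \<omega>
    using that r by (intro rayleigh_inf_ge_of_omega_le) (auto intro: ennreal_leI)
  have "r \<noteq> 0"
  proof
    assume "r = 0"
    \<comment> \<open>If \<open>omega\<close> were 0, every positive number would be admissible;
      this one would bound the infimum below by itself plus 1.\<close>
    then have "1 / (8 * (1 / (8 * (rayleigh_inf + 1)))) \<le> rayleigh_inf"
      using rayleigh_inf_nonneg by (intro bound) auto
    then show False using rayleigh_inf_nonneg by simp
  qed
  then have "0 < r" using r by simp
  have "8 * omega = ennreal (8 * r)" using r by (simp add: ennreal_mult)
  then have "1 / (8 * omega) = ennreal (1 / (8 * r))"
    using \<open>0 < r\<close> divide_ennreal[of 1 "8 * r"] by simp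
  then show ?thesis using bound[of r] \<open>0 < r\<close> by (simp add: ennreal_leI)
qed

end

section \<open>The diffusion operator and the Schroedinger-type operator\<close>

text \<open>\<open>U\<close> acts between the cores, linearly and onto, preserving the form and the
  norms. The bounds, the sharpness and the closability condition involve nothing beyond these
  data.\<close>

lemma closable_form_transfer:
  assumes "closable_form M D Q l0"
    and D': "\<And>f. f \<in> D' \<Longrightarrow> f \<in> l2_space M'" "\<And>f g s t. f \<in> D' \<Longrightarrow> g \<in> D' \<Longrightarrow> (\<lambda>x. s * f x + t * g x) \<in> D'"
    and U: "\<And>f. f \<in> D' \<Longrightarrow> U f \<in> D" "\<And>g. g \<in> D \<Longrightarrow> \<exists>f\<in>D'. U f = g"
      "\<And>f g s t. U (\<lambda>x. s * f x + t * g x) = (\<lambda>x. s * U f x + t * U g x)"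
    and inner: "\<And>f. f \<in> D' \<Longrightarrow> l2_inner M' f f = l2_inner M (U f) (U f)"
    and form: "\<And>f g. f \<in> D' \<Longrightarrow> g \<in> D' \<Longrightarrow> Q' f g = Q (U f) (U g)"
  shows "closable_form M' D' Q' l0"
proof -
  interpret closable_form M D Q l0 by fact
  show ?thesis
  proof
    show "Q' (\<lambda>x. s * f x + t * g x) h = s * Q' f h + t * Q' g h"
      if "f \<in> D'" "g \<in> D'" "h \<in> D'" for f g h s t
      using that by (simp add: form D' U Q_lincomb)
    show "\<exists>f\<in>D'. 0 < l2_inner M' f f \<and> Q' f f < (l0 + e) * l2_inner M' f f" if e: "e > 0" for e
    proof -
      obtain g where g: "g \<in> D" "0 < l2_inner M g g" "Q g g < (l0 + e) * l2_inner M g g"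
        using sharp[OF e] by blast
      obtain f where "f \<in> D'" "U f = g" using U(2)[OF g(1)] by blast
      then show ?thesis using g by (intro bexI[of _ f]) (simp_all add: inner form)
    qed
    show "(\<lambda>n. Q' (us n) \<phi>) \<longlonglongrightarrow> 0"
      if "\<And>n. us n \<in> D'" "(\<lambda>n. l2_norm M' (us n)) \<longlonglongrightarrow> 0" "\<And>n. Q' (us n) (us n) \<le> K" "\<phi> \<in> D'" for us K \<phi>
    proof -
      have "(\<lambda>n. Q (U (us n)) (U \<phi>)) \<longlonglongrightarrow> 0"
      proof (rule weakly_closable)
        show "(\<lambda>n. l2_norm M (U (us n))) \<longlonglongrightarrow> 0" using that(1,2) by (simp add: l2_norm_def inner)
        show "Q (U (us n)) (U (us n)) \<le> K" for n using that(1,3) by (simp flip: form)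
      qed (use that U in auto)
      then show ?thesis using that(1,4) by (simp add: form)
    qed
  qed (use D' U in \<open>simp_all add: form inner Q_commute lower\<close>)
qed

lemma C1_compact_support_mult_left:
  assumes E: "\<And>x. (E has_real_derivative E' x) (at x)" "continuous_on UNIV E'" and f: "f \<in> C1_compact_support"
  shows "(\<lambda>x. E x * f x) \<in> C1_compact_support"
    and "deriv (\<lambda>x. E x * f x) = (\<lambda>x. E' x * f x + E x * deriv f x)"
proof -
  have E_cont: "continuous_on UNIV E" using E(1) by (meson DERIV_isCont continuous_at_imp_continuous_on)
  have d: "((\<lambda>x. E x * f x) has_real_derivative E' x * f x + E x * deriv f x) (at x)" for x
    using DERIV_mult[OF E(1) C1_compact_supportD(1)[OF f], of x] by (simp add: algebra_simps)
  then show "deriv (\<lambda>x. E x * f x) = (\<lambda>x. E' x * f x + E x * deriv f x)" by (auto intro: DERIV_imp_deriv)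
  obtain R where R: "\<And>x. R \<le> \<bar>x\<bar> \<Longrightarrow> f x = 0" using C1_compact_supportD(3)[OF f] by blast
  show "(\<lambda>x. E x * f x) \<in> C1_compact_support"
  proof (rule C1_compact_supportI[OF d])
    show "continuous_on UNIV (\<lambda>x. E' x * f x + E x * deriv f x)"
      by (intro continuous_intros E E_cont C1_compact_support_continuous C1_compact_supportD f)
    show "E x * f x = 0" if "R \<le> \<bar>x\<bar>" for x using R[OF that] by simp
  qed
qed

lemma B_fn_has_derivative:
  assumes cont: "continuous_on UNIV (\<lambda>y. b y / a y)"
  shows "(B_fn b a has_real_derivative b x / a x) (at x)"
proof -
  \<comment> \<open>Places both 0 and \<open>x\<close> in the interior of \<open>{- m..m}\<close>,
    so the one-sided derivative is two-sided.\<close>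
  define m where "m = \<bar>x\<bar> + 1"
  have "((\<lambda>u. LBINT y=0..u. b y / a y) has_vector_derivative b x / a x) (at x within {- m..m})"
    using interval_integral_FTC2[of "- m" 0 m "\<lambda>y. b y / a y" x] continuous_on_subset[OF cont]
    by (simp add: m_def zero_ereal_def)
  moreover have "at x within {- m..m} = at x"
    by (rule at_within_Icc_at) (auto simp: m_def)
  ultimately show ?thesis
    by (simp add: B_fn_def[abs_def] has_real_derivative_iff_has_vector_derivative)
qed

locale diffusion =
  fixes a b :: "real \<Rightarrow> real"
  assumes a_cont: "continuous_on UNIV a" and a_pos: "\<And>x. 0 < a x" and b_cont: "continuous_on UNIV b"
begin

abbreviation B :: "real \<Rightarrow> real" where "B \<equiv> B_fn b a"

lemma drift_cont: "continuous_on UNIV (\<lambda>x. b x / a x)"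
  using a_pos by (intro continuous_intros a_cont b_cont) (auto simp: less_imp_neq[symmetric])

lemma B_deriv: "(B has_real_derivative b x / a x) (at x)"
  by (rule B_fn_has_derivative[OF drift_cont])

lemma B_cont: "continuous_on UNIV B"
  using B_deriv by (meson DERIV_isCont continuous_at_imp_continuous_on)

sublocale weighted_line "\<lambda>x. a x * exp (2 * B x)" "\<lambda>x. exp (2 * B x)"
  by unfold_locales (intro continuous_intros a_cont B_cont mult_pos_pos a_pos exp_gt_zero)+

lemma diffusion_measure_eq: "diffusion_measure b a = \<nu>"
  by (simp add: diffusion_measure_def \<nu>_def)

lemma Q_D_eq: "Q_D b a = energy"
proof -
  have eq: "a x * deriv f x * deriv g x * exp (2 * B x) = a x * exp (2 * B x) * deriv f x * deriv g x" for f g x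
    by (simp add: algebra_simps)
  show ?thesis by (intro ext) (simp only: Q_D_def energy_def eq)
qed

lemma inf_spectrum_H_D: "inf_spectrum (diffusion_measure b a) (H_D b a) = ereal rayleigh_inf"
  unfolding H_D_def Q_D_eq diffusion_measure_eq by (rule form.inf_spectrum_form_operator)

text \<open>The parameter \<open>c\<close> covers the multipliers
  \<open>exp (\<plusminus> B)\<close> and the weight \<open>exp (2 B)\<close> at once.\<close>

lemma exp_B_deriv: "((\<lambda>x. exp (c * B x)) has_real_derivative c * (b x / a x) * exp (c * B x)) (at x)"
  by (auto intro!: derivative_eq_intros B_deriv)

lemma exp_B_deriv_cont: "continuous_on UNIV (\<lambda>x. c * (b x / a x) * exp (c * B x))"
  by (intro continuous_on_mult continuous_on_const drift_cont continuous_on_exp B_cont)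

lemmas exp_B_mult = C1_compact_support_mult_left[OF exp_B_deriv exp_B_deriv_cont]

text \<open>
  With \<open>f = exp B F\<close> and \<open>g = exp B G\<close> the integrands of \<open>Q_S f g\<close> and \<open>Q_D F G\<close> differ by the total
  derivative of \<open>exp (2 B) b F G / 2\<close>.
\<close>

lemma Q_S_eq_energy:
  assumes b: "b C1_differentiable_on UNIV"
    and f: "f \<in> C1_compact_support" and g: "g \<in> C1_compact_support"
  shows "Q_S b a f g = energy (\<lambda>x. exp (- 1 * B x) * f x) (\<lambda>x. exp (- 1 * B x) * g x)"
proof -
  note db = C1_differentiable_onD[OF b]
  define F where "F x = exp (- 1 * B x) * f x" for x
  define G where "G x = exp (- 1 * B x) * g x" for x
  have F: "F \<in> C1_compact_support" and G: "G \<in> C1_compact_support"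
    unfolding F_def G_def by (intro exp_B_mult f g)+
  have f_eq: "f = (\<lambda>x. exp (1 * B x) * F x)" and g_eq: "g = (\<lambda>x. exp (1 * B x) * G x)"
    by (auto simp: F_def G_def fun_eq_iff exp_minus field_simps)
  have df: "deriv f x = exp (B x) * (b x / a x * F x + deriv F x)" for x
    using exp_B_mult(2)[OF F, of 1] unfolding f_eq[symmetric] by (simp add: algebra_simps)
  have dg: "deriv g x = exp (B x) * (b x / a x * G x + deriv G x)" for x
    using exp_B_mult(2)[OF G, of 1] unfolding g_eq[symmetric] by (simp add: algebra_simps)
  \<comment> \<open>The derivative of \<open>exp (2 * B) * b * F * G\<close>, with
    \<open>B' = b / a\<close>. The integrands below are twice those of the forms, hence no factor
    1/2.\<close>
  define d where "d x = exp (2 * B x) * (b x * (deriv F x * G x + F x * deriv G x)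
      + (2 * (b x)\<^sup>2 / a x + deriv b x) * (F x * G x))" for x
  obtain r where r: "\<And>x. r \<le> \<bar>x\<bar> \<Longrightarrow> F x = 0 \<and> deriv F x = 0"
    using C1_compact_supportD(3)[OF F] by blast
  have pot_cont: "continuous_on UNIV (\<lambda>x. 1/2 * ((b x)\<^sup>2 / a x + deriv b x))"
    using a_pos by (intro continuous_intros a_cont b_cont db) (auto simp: less_imp_neq[symmetric])
  have d_cont: "continuous_on UNIV d"
    unfolding d_def using a_pos
    by (intro continuous_intros a_cont b_cont db B_cont C1_compact_supportD F G C1_compact_support_continuous)
      (auto simp: less_imp_neq[symmetric])
  have dd: "((\<lambda>x. exp (2 * B x) * b x * (F x * G x)) has_real_derivative d x) (at x)" for x
  proof -
    have "((\<lambda>x. exp (2 * B x) * b x * (F x * G x)) has_real_derivative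
        (2 * (b x / a x) * exp (2 * B x) * b x + deriv b x * exp (2 * B x)) * (F x * G x)
        + (deriv F x * G x + deriv G x * F x) * (exp (2 * B x) * b x)) (at x)"
      by (intro DERIV_mult exp_B_deriv db C1_compact_supportD F G)
    also have "(2 * (b x / a x) * exp (2 * B x) * b x + deriv b x * exp (2 * B x)) * (F x * G x)
        + (deriv F x * G x + deriv G x * F x) * (exp (2 * B x) * b x) = d x"
      by (simp add: d_def power2_eq_square algebra_simps)
    finally show ?thesis .
  qed
  have d: "integrable lborel d" "(\<integral>x. d x \<partial>lborel) = 0"
    using r by (intro integral_deriv_Cc[OF dd d_cont, of r]; simp add: d_def)+
  have e2: "exp (2 * B x) = exp (B x) * exp (B x)" for x
    by (simp flip: exp_add)
  \<comment> \<open>Expanding \<open>f'\<close> and \<open>g'\<close> gives one term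
    \<open>b\<^sup>2 / a\<close> and the doubled potential another; together they form the
    \<open>2 * (b x)\<^sup>2 / a x\<close> of \<open>d\<close>.\<close>
  have "a x * deriv f x * deriv g x + 2 * (1/2 * ((b x)\<^sup>2 / a x + deriv b x) * f x * g x)
      = a x * exp (2 * B x) * deriv F x * deriv G x + d x" for x
    unfolding df dg using a_pos[of x] f_eq g_eq
    by (simp add: d_def e2 fun_eq_iff field_simps power2_eq_square)
  then have "(\<integral>x. a x * deriv f x * deriv g x + 2 * (1/2 * ((b x)\<^sup>2 / a x + deriv b x) * f x * g x) \<partial>lborel)
      = (\<integral>x. a x * exp (2 * B x) * deriv F x * deriv G x + d x \<partial>lborel)" by simp
  also have "\<dots> = 2 * energy F G"
    using energy_integrable[OF F G] d by (simp add: energy_def)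
  also have "(\<integral>x. a x * deriv f x * deriv g x + 2 * (1/2 * ((b x)\<^sup>2 / a x + deriv b x) * f x * g x) \<partial>lborel)
      = (\<integral>x. a x * deriv f x * deriv g x \<partial>lborel)
        + (\<integral>x. 2 * (1/2 * ((b x)\<^sup>2 / a x + deriv b x) * f x * g x) \<partial>lborel)"
  proof (rule Bochner_Integration.integral_add)
    show "integrable lborel (\<lambda>x. a x * deriv f x * deriv g x)"
      by (intro Cc_integrable Cc_mult_right Cc_mult_left deriv_Cc f a_cont C1_compact_supportD g)
    show "integrable lborel (\<lambda>x. 2 * (1/2 * ((b x)\<^sup>2 / a x + deriv b x) * f x * g x))"
      by (intro integrable_mult_right Cc_integrable Cc_mult_right Cc_mult_left C1_compact_support_Cc f pot_cont
          C1_compact_support_continuous g)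
  qed
  also have "\<dots> = 2 * Q_S b a f g"
    unfolding Q_S_def integral_mult_right_zero by simp
  finally show ?thesis by (simp add: F_def[abs_def] G_def[abs_def])
qed

lemma inf_spectrum_H_S:
  assumes b: "b C1_differentiable_on UNIV"
  shows "inf_spectrum lborel (H_S b a) = ereal rayleigh_inf"
proof -
  \<comment> \<open>The known closable form lives on the diffusion side and is pulled back, so the
    map goes from the core of \<open>H_S\<close> to that of \<open>H_D\<close>: the inverse of
    multiplication by \<open>exp B\<close>.\<close>
  let ?U = "\<lambda>f x. exp (- 1 * B x) * f x"
  have "closable_form lborel C1_compact_support (Q_S b a) rayleigh_inf"
  proof (rule closable_form_transfer[where U = ?U, OF form.closable_form_axioms])
    show "f \<in> l2_space lborel" if "f \<in> C1_compact_support" for f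
      using that by (intro Cc_l2 C1_compact_support_Cc)
    show "?U f \<in> C1_compact_support" if "f \<in> C1_compact_support" for f
      using that by (rule exp_B_mult)
    show "\<exists>f\<in>C1_compact_support. ?U f = g" if "g \<in> C1_compact_support" for g
      using exp_B_mult(1)[OF that, of 1]
      by (intro bexI[of _ "\<lambda>x. exp (1 * B x) * g x"]) (auto simp: fun_eq_iff exp_minus)
    show "l2_inner lborel f f = l2_inner \<nu> (?U f) (?U f)" if "f \<in> C1_compact_support" for f
    proof -
      have eq: "exp (2 * B x) * (exp (- 1 * B x) * f x)\<^sup>2 = f x * f x" for x
      proof -
        have "exp (2 * B x) * (exp (- 1 * B x))\<^sup>2 = 1" by (simp flip: exp_double exp_add)
        then show ?thesis by (simp add: power_mult_distrib power2_eq_square flip: mult.assoc)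
      qed
      show ?thesis
        unfolding l2_inner_\<nu>_self[OF exp_B_mult(1)[OF that, of "- 1"]] by (simp only: eq l2_inner_def)
    qed
    show "Q_S b a f g = energy (?U f) (?U g)" if "f \<in> C1_compact_support" "g \<in> C1_compact_support" for f g
      using b that by (rule Q_S_eq_energy)
  qed (auto intro: C1_compact_support_lincomb simp: algebra_simps)
  then show ?thesis unfolding H_S_def by (rule closable_form.inf_spectrum_form_operator)
qed

section \<open>Identification of \<open>Omega\<close> with \<open>omega\<close>\<close>

lemma scale_density_eq: "scale_density b a y = ennreal (1 / (a y * exp (2 * B y)))"
  by (simp add: scale_density_def exp_minus field_simps)

lemma h_fn_eq: "h_fn b a = R"
  by (simp add: fun_eq_iff h_fn_def rtail_def scale_density_eq)

lemma I_plus_eq: "I_plus b a = R 0"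
  by (simp add: I_plus_def rtail_def scale_density_eq)

lemma I_minus_eq: "I_minus b a = L 0"
  by (simp add: I_minus_def ltail_def scale_density_eq)

lemma Omega_eq: "Omega b a = omega"
  unfolding Omega_def omega_def I_plus_eq I_minus_eq h_fn_eq
  by (simp only: scale_density_eq speed_density_def ltail_def rtail_def)

text \<open>The second expression for Omega uses the truncated subtraction of
  \<open>ennreal\<close>; it is the genuine difference because \<open>h x < H\<close>.\<close>

lemma Omega_two_sided:
  assumes "I_plus b a < \<infinity>" "I_minus b a < \<infinity>"
  shows "Omega b a = (SUP x. (1 / h_fn b a x - 1 / h_fn_minus_infinity b a)
    * (\<integral>\<^sup>+ y \<in> {x..}. (h_fn b a y)\<^sup>2 * speed_density b a y \<partial>lborel))"
proof -
  interpret weighted_line_two_sided "\<lambda>x. a x * exp (2 * B x)" "\<lambda>x. exp (2 * B x)"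
    by unfold_locales (use assms in \<open>simp_all add: I_plus_eq I_minus_eq\<close>)
  have H: "h_fn_minus_infinity b a = ennreal H"
    unfolding h_fn_minus_infinity_def scale_density_eq by (rule total_eq)
  have "1 / h_fn b a x - 1 / h_fn_minus_infinity b a = ennreal (1 / h x - 1 / H)" for x
  proof -
    have "1 / ennreal (h x) = ennreal (1 / h x)" "1 / ennreal H = ennreal (1 / H)"
      using h_pos[of x] h_less_H[of x] divide_ennreal[of 1 "h x"] divide_ennreal[of 1 H] by simp_all
    then show ?thesis
      using h_pos[of x] h_less_H[of x] by (simp add: h_fn_eq R_eq H ennreal_minus)
  qed
  then show ?thesis
    unfolding Omega_eq omega_two_sided
    by (simp add: h_fn_eq speed_density_def flip: right_weight_eq)
qed

end

theorem theorem3: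
  fixes a b :: "real \<Rightarrow> real"
  assumes "a C1_differentiable_on UNIV"
    and "\<And>x. a x > 0"
    and "continuous_on UNIV b"
  shows "enn2ereal (1 / (8 * Omega b a)) \<le> inf_spectrum (diffusion_measure b a) (H_D b a)
    \<and> (b C1_differentiable_on UNIV
         \<and> (\<exists>c. \<forall>x. c \<le> (b x)\<^sup>2 / a x + deriv b x)
         \<and> (\<integral>\<^sup>+ x \<in> {0..}. ennreal (a x) \<partial>lborel) = \<infinity>
         \<and> (\<integral>\<^sup>+ x \<in> {..0}. ennreal (a x) \<partial>lborel) = \<infinity>
       \<longrightarrow> inf_spectrum (diffusion_measure b a) (H_D b a) = inf_spectrum lborel (H_S b a))
    \<and> inf_spectrum (diffusion_measure b a) (H_D b a) \<le> enn2ereal (1 / (2 * Omega b a))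
    \<and> (I_plus b a < \<infinity> \<and> I_minus b a < \<infinity> \<longrightarrow>
         Omega b a = (SUP x. (1 / h_fn b a x - 1 / h_fn_minus_infinity b a)
           * (\<integral>\<^sup>+ y \<in> {x..}. (h_fn b a y)\<^sup>2 * speed_density b a y \<partial>lborel)))"
proof -
  have "continuous_on UNIV a"
    using C1_differentiable_onD(1)[OF assms(1)] by (meson DERIV_isCont continuous_at_imp_continuous_on)
  then interpret diffusion a b by unfold_locales (use assms in auto)
  \<comment> \<open>The infimum of the spectrum is an \<open>ereal\<close> and the bounds are
    embedded \<open>ennreal\<close> values; as \<open>rayleigh_inf\<close> is non-negative, all
    comparisons can be made in \<open>ennreal\<close>.\<close>
  have inf_eq: "inf_spectrum (diffusion_measure b a) (H_D b a) = enn2ereal (ennreal rayleigh_inf)"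
    using rayleigh_inf_nonneg by (simp add: inf_spectrum_H_D enn2ereal_ennreal)
  show ?thesis
  proof (intro conjI impI)
    show "enn2ereal (1 / (8 * Omega b a)) \<le> inf_spectrum (diffusion_measure b a) (H_D b a)"
      unfolding inf_eq Omega_eq less_eq_ennreal.rep_eq[symmetric] by (rule rayleigh_inf_ge_omega)
    show "inf_spectrum (diffusion_measure b a) (H_D b a) \<le> enn2ereal (1 / (2 * Omega b a))"
      unfolding inf_eq Omega_eq less_eq_ennreal.rep_eq[symmetric] by (rule rayleigh_inf_le_omega)
  qed (auto simp: inf_spectrum_H_D inf_spectrum_H_S intro: Omega_two_sided)
qed

end
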